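(* Consider the binary relay channel described in the context, with parameters $p,\delta,\epsilon\in[0,1]$, and let $R_0=\max_{p(x_1)} I(X_1;S)$ be the capacity of the binary symmetric channel from relay to destination (so $R_0=1-h(\epsilon)$). Then the capacity of this relay channel is $$C=\max_{p(u\mid y_1):\ I(U;Y_1)\le R_0}\ \bigl(1-H(Z\mid U)\bigr),$$ where the maximum is over all conditional distributions $p(u\mid y_1)$ on a finite alphabet $\mathcal U$, the joint law of $(Z,Y_1,U)$ being $p(z)p(y_1\mid z)p(u\mid y_1)$ with $Z\sim\mathrm{Ber}(p)$ and $Y_1=Z\oplus V$, $V\sim \mathrm{Ber}(\delta)$ independent of $Z$. Moreover, the maximization may be restricted to $U$ with $|\mathcal U|\le|\mathcal Y_1|+2=4$.
   Context: Binary relay channel: all alphabets are $\{0,1\}$ and $\oplus$ denotes addition mod 2. Let $Z_i$, $V_i$, $N_i$ ($i=1,2,\dots$) be mutually independent i.i.d. sequences with $Z_i\sim\mathrm{Ber}(p)$, $V_i\sim\mathrm{Ber}(\delta)$, $N_i\sim\mathrm{Ber}(\epsilon)$, independent of the message. The source sends $X_i$; the destination receives $Y_i=X_i\oplus Z_i$; the relay observes $Y_{1i}=Z_i\oplus V_i$ and sends $X_{1i}$ over a separate channel, the destination receiving $S_i=X_{1i}\oplus N_i$. An $(n,2^{nR})$ code consists of a message $W$ uniform on $\{1,\dots,2^{nR}\}$, an encoder $X^n=X^n(W)$, relay functions $X_{1i}=f_i(Y_{1}^{i-1})$, and a decoder $\hat W=g(Y^n,S^n)$. A rate $R$ is achievable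 if there are codes with $\Pr(\hat W\neq W)\to 0$ as $n\to\infty$; the capacity $C$ is the supremum of achievable rates. Entropies are in bits; $h(q)=-q\log_2q-(1-q)\log_2(1-q)$. *)

theory Defs
  imports "HOL-Analysis.Analysis" "HOL-Library.Extended_Real"
begin

text \<open>Bits are booleans; addition mod 2 is inequality on bool.\<close>

definition ber :: "real \<Rightarrow> bool \<Rightarrow> real" where
  "ber q b = (if b then q else 1 - q)"

definition mutinf :: "('a \<Rightarrow> 'b \<Rightarrow> real) \<Rightarrow> 'a set \<Rightarrow> 'b set \<Rightarrow> real" where
  "mutinf P A B = (\<Sum>a\<in>A. \<Sum>b\<in>B. if P a b = 0 then 0 else
      P a b * log 2 (P a b / ((\<Sum>b'\<in>B. P a b') * (\<Sum>a'\<in>A. P a' b))))"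

definition condent :: "('a \<Rightarrow> 'b \<Rightarrow> real) \<Rightarrow> 'a set \<Rightarrow> 'b set \<Rightarrow> real" where
  "condent P A B = (\<Sum>a\<in>A. \<Sum>b\<in>B. if P a b = 0 then 0 else
      - P a b * log 2 (P a b / (\<Sum>a'\<in>A. P a' b)))"

definition R0 :: "real \<Rightarrow> real" where
  "R0 eps = Sup ((\<lambda>a. mutinf (\<lambda>x1 s. ber a x1 * ber eps (s \<noteq> x1)) UNIV UNIV) ` {0..1})"

definition jointZYU :: "real \<Rightarrow> real \<Rightarrow> (bool \<Rightarrow> nat \<Rightarrow> real) \<Rightarrow> bool \<Rightarrow> bool \<Rightarrow> nat \<Rightarrow> real" where
  "jointZYU p \<delta> q z y1 u = ber p z * ber \<delta> (y1 \<noteq> z) * q y1 u"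

definition feasible :: "real \<Rightarrow> real \<Rightarrow> real \<Rightarrow> nat \<Rightarrow> (bool \<Rightarrow> nat \<Rightarrow> real) \<Rightarrow> bool" where
  "feasible p \<delta> eps k q \<longleftrightarrow> 0 < k \<and> (\<forall>y1 u. 0 \<le> q y1 u) \<and> (\<forall>y1. (\<Sum>u<k. q y1 u) = 1)
     \<and> mutinf (\<lambda>y1 u. \<Sum>z\<in>UNIV. jointZYU p \<delta> q z y1 u) UNIV {..<k} \<le> R0 eps"

definition objective :: "real \<Rightarrow> real \<Rightarrow> nat \<Rightarrow> (bool \<Rightarrow> nat \<Rightarrow> real) \<Rightarrow> real" where
  "objective p \<delta> k q = 1 - condent (\<lambda>z u. \<Sum>y1\<in>UNIV. jointZYU p \<delta> q z y1 u) UNIV {..<k}"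

text \<open>Operational side. Time indices are 0-based: i < n. A code with M messages {0..<M}:
  enc m i = X_i(m); relay i ys = X_{1i} computed from ys = Y_1^{i-1} (the first i relay
  observations); dec ys ss = decoded message from (Y^n, S^n).\<close>

definition seq_prob :: "real \<Rightarrow> bool list \<Rightarrow> real" where
  "seq_prob q xs = prod_list (map (ber q) xs)"

definition error_prob :: "real \<Rightarrow> real \<Rightarrow> real \<Rightarrow> nat \<Rightarrow> nat \<Rightarrow> (nat \<Rightarrow> nat \<Rightarrow> bool)
    \<Rightarrow> (nat \<Rightarrow> bool list \<Rightarrow> bool) \<Rightarrow> (bool list \<Rightarrow> bool list \<Rightarrow> nat) \<Rightarrow> real" where
  "error_prob p \<delta> eps n M enc relay dec =
     (1 / real M) * (\<Sum>m<M. \<Sum>zs\<in>{xs. length xs = n}. \<Sum>vs\<in>{xs. length xs = n}. \<Sum>ns\<in>{xs. length xs = n}.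
        seq_prob p zs * seq_prob \<delta> vs * seq_prob eps ns *
        (let ys = map (\<lambda>i. enc m i \<noteq> zs ! i) [0..<n];
             y1s = map (\<lambda>i. zs ! i \<noteq> vs ! i) [0..<n];
             ss = map (\<lambda>i. relay i (take i y1s) \<noteq> ns ! i) [0..<n]
         in if dec ys ss \<noteq> m then 1 else 0))"

definition achievable :: "real \<Rightarrow> real \<Rightarrow> real \<Rightarrow> real \<Rightarrow> bool" where
  "achievable p \<delta> eps R \<longleftrightarrow> 0 \<le> R \<and>
     (\<exists>enc relay dec. (\<lambda>n. error_prob p \<delta> eps n (nat \<lceil>2 powr (real n * R)\<rceil>)
                               (enc n) (relay n) (dec n)) \<longlonglongrightarrow> 0)"

definition relay_capacity :: "real \<Rightarrow> real \<Rightarrow> real \<Rightarrow> ereal" where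
  "relay_capacity p \<delta> eps = Sup (ereal ` {R. achievable p \<delta> eps R})"

end

theory Submission
  imports Defs "HOL-Real_Asymp.Real_Asymp"
begin

text \<open>
  A test channel \<open>U\<close> enters only through the conditional laws \<open>t = P(Y\<^sub>1 = 1 | U = u)\<close>: averaging the points
  \<open>(t, H(Y\<^sub>1 | U = u), H(Z | U = u))\<close> of a compact curve in three-space over \<open>U\<close> gives a point of its
  convex hull with first coordinate \<open>P(Y\<^sub>1 = 1)\<close>, and the optimisation minimises the third
  coordinate over a compact slice of that hull. The minimum is attained, and Caratheodory's theorem
  yields the bound \<open>4\<close> on the alphabet.

  Converse: since \<open>S\<^sup>n\<close> is independent of the message, decoding reliably at rate \<open>R\<close> forces
  \<open>n R \<le> n - H(Z\<^sup>n | S\<^sup>n)\<close> up to lower order terms. Revealing \<open>Y\<^sub>1\<close> bit by bit shows, by the chain rule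
  and the concavity of entropy, that \<open>(H(Y\<^sub>1\<^sup>n | S\<^sup>n), H(Z\<^sup>n | S\<^sup>n)) / n\<close> is dominated by a point of the
  hull, while \<open>H(Y\<^sub>1\<^sup>n | S\<^sup>n) \<ge> n H(Y\<^sub>1) - n R\<^sub>0\<close> because \<open>H(S\<^sup>n) \<le> n\<close>.

  Achievability: the relay quantises a block of \<open>Y\<^sub>1\<close> and sends the index with a channel code during
  the next block. The destination recovers a sequence \<open>u\<close> and decodes the message with the metric
  \<open>\<Prod> Q(z\<^sub>i | u\<^sub>i)\<close>, where \<open>Q\<close> is \<open>P(z | u)\<close> smoothed to be positive. The rate
  lost is then the expected logarithmic loss of \<open>Q\<close>, which is an additive distortion between \<open>Y\<^sub>1\<close>
  and \<open>u\<close>, so ordinary rate-distortion quantisation suffices, and the rare failures of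
  the relay link cost only a bounded amount per letter.
\<close>

section \<open>Entropy of unnormalised weights\<close>

text \<open>A direct compress-and-forward argument would need joint typicality of Z, Y1 and u,
  although the quantiser that produces u never sees Z. The loss metric removes this obstacle: within
  one block only the expected loss is computed, by averaging over Z given Y1. A block length m is
  fixed at which this expectation is small enough; the losses of k successive blocks are then
  i.i.d., and Chebyshev over blocks supplies the concentration. Since the guesses sum to one over z,
  at most \<open>2 powr \<theta>\<close> noise words have loss at most \<open>\<theta>\<close>, so a
  mismatch between the guess and the true posterior of Z does no harm.

  Coding needs I(U;Y1) strictly below R0, while the optimum may lie on the boundary. Mixing the
  optimal point with the constant test channel gains the slack at a small cost in the objective.
  This fails exactly when R0 = 0; there data processing shows that no test channel beats the
  constant one, and the relay can be ignored.

  Codebooks are found by finite averaging, so weighted finite sums take the place of probability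
  spaces throughout.\<close>

definition eta :: "real \<Rightarrow> real" where
  "eta x = - x * log 2 x"

definition bent :: "real \<Rightarrow> real" where
  "bent t = eta t + eta (1 - t)"

text \<open>For weights of total mass \<open>c\<close> this is \<open>c\<close> times the entropy of the normalised weights. Working
  with unnormalised weights makes conditional entropies plain sums and avoids dividing by zero.\<close>

definition ent :: "'a set \<Rightarrow> ('a \<Rightarrow> real) \<Rightarrow> real" where
  "ent A \<mu> = (\<Sum>a\<in>A. eta (\<mu> a)) - eta (\<Sum>a\<in>A. \<mu> a)"

lemma eta_0 [simp]: "eta 0 = 0" and eta_1 [simp]: "eta 1 = 0"
  by (auto simp: eta_def)

lemma eta_mult:
  assumes "0 \<le> x" "0 \<le> y"
  shows "eta (x * y) = x * eta y + y * eta x"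
  using assms by (cases "x = 0 \<or> y = 0") (auto simp: eta_def log_mult algebra_simps)

lemma ber_nonneg: "0 \<le> q \<Longrightarrow> q \<le> 1 \<Longrightarrow> 0 \<le> ber q b"
  by (auto simp: ber_def)

lemma ber_le_1: "0 \<le> q \<Longrightarrow> q \<le> 1 \<Longrightarrow> ber q b \<le> 1"
  by (auto simp: ber_def)

lemma sum_ber [simp]: "(\<Sum>b\<in>UNIV. ber q b) = 1"
  by (simp add: UNIV_bool ber_def)

lemma sum_eta_ber: "(\<Sum>b\<in>UNIV. eta (ber q b)) = bent q"
  by (simp add: UNIV_bool ber_def bent_def)

text \<open>The log-sum inequality: \<open>ln r \<le> r - 1\<close> is applied letter by letter to
  the ratio of \<open>y a * X / Y\<close> to \<open>x a\<close>, where \<open>X\<close> and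
  \<open>Y\<close> are the total masses, and the linear right sides cancel on summation.\<close>

lemma gibbs:
  assumes fin: "finite A"
    and x: "\<And>a. a \<in> A \<Longrightarrow> 0 \<le> x a"
    and y: "\<And>a. a \<in> A \<Longrightarrow> 0 \<le> y a"
    and xy: "\<And>a. a \<in> A \<Longrightarrow> y a = 0 \<Longrightarrow> x a = 0"
  shows "ent A x \<le> (\<Sum>a\<in>A. - x a * log 2 (y a)) + (\<Sum>a\<in>A. x a) * log 2 (\<Sum>a\<in>A. y a)"
proof (cases "(\<Sum>a\<in>A. x a) = 0")
  case True
  hence "\<And>a. a \<in> A \<Longrightarrow> x a = 0" using fin x by (simp add: sum_nonneg_eq_0_iff)
  thus ?thesis by (simp add: ent_def)
next
  case False
  define X Y where "X = (\<Sum>a\<in>A. x a)" and "Y = (\<Sum>a\<in>A. y a)"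
  have X: "X > 0" using False x by (simp add: X_def sum_nonneg order_less_le)
  have "Y \<noteq> 0"
  proof
    assume "Y = 0"
    hence "\<And>a. a \<in> A \<Longrightarrow> y a = 0" using fin y by (simp add: Y_def sum_nonneg_eq_0_iff)
    hence "X = 0" using xy by (simp add: X_def)
    with X show False by simp
  qed
  moreover have "Y \<ge> 0" using y by (simp add: Y_def sum_nonneg)
  ultimately have Y: "Y > 0" by simp
  have summand: "eta (x a) + x a * log 2 (y a) + x a * (log 2 X - log 2 Y) \<le> (y a * (X / Y) - x a) / ln 2"
    if "a \<in> A" for a
  proof (cases "x a = 0")
    case True
    have "eta (x a) + x a * log 2 (y a) + x a * (log 2 X - log 2 Y) = 0" by (simp add: True)
    also have "0 \<le> (y a * (X / Y) - x a) / ln 2"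
      unfolding True using y[OF that] X Y by (intro divide_nonneg_pos) auto
    finally show ?thesis .
  next
    case False
    hence xa: "x a > 0" and ya: "y a > 0" using x[OF that] y[OF that] xy[OF that] by force+
    have "ln (y a * X / (x a * Y)) \<le> y a * X / (x a * Y) - 1"
      using xa ya X Y by (intro ln_le_minus_one) simp
    hence "x a * ln (y a * X / (x a * Y)) \<le> x a * (y a * X / (x a * Y) - 1)"
      using xa by (intro mult_left_mono) auto
    also have "\<dots> = y a * (X / Y) - x a" using xa by (simp add: field_simps)
    finally have "x a * ln (y a * X / (x a * Y)) / ln 2 \<le> (y a * (X / Y) - x a) / ln 2"
      by (intro divide_right_mono) auto
    moreover have "x a * ln (y a * X / (x a * Y)) / ln 2
        = eta (x a) + x a * log 2 (y a) + x a * (log 2 X - log 2 Y)"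
      using xa ya X Y by (simp add: eta_def log_def ln_mult ln_div field_simps)
    ultimately show ?thesis by simp
  qed
  have "(\<Sum>a\<in>A. eta (x a) + x a * log 2 (y a) + x a * (log 2 X - log 2 Y))
      \<le> (\<Sum>a\<in>A. (y a * (X / Y) - x a) / ln 2)"
    by (intro sum_mono summand)
  also have "\<dots> = (Y * (X / Y) - X) / ln 2"
    by (simp add: X_def Y_def sum_subtractf sum_distrib_right flip: sum_divide_distrib)
  also have "\<dots> = 0" using Y by simp
  finally have "(\<Sum>a\<in>A. eta (x a)) + (\<Sum>a\<in>A. x a * log 2 (y a)) + X * (log 2 X - log 2 Y) \<le> 0"
    by (simp add: sum.distrib X_def flip: sum_distrib_right)
  thus ?thesis
    by (simp add: ent_def X_def[symmetric] Y_def[symmetric] eta_def[of X] sum_negf algebra_simps)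
qed

lemma ent_le_log_card:
  assumes "finite A" "A \<noteq> {}" "\<And>a. a \<in> A \<Longrightarrow> 0 \<le> x a"
  shows "ent A x \<le> (\<Sum>a\<in>A. x a) * log 2 (card A)"
  using gibbs[of A x "\<lambda>_. 1"] assms by simp

text \<open>Concavity of entropy: as \<open>ent\<close> is homogeneous of degree one, concavity
  takes this form. Both summands are compared by Gibbs with the same reference
  \<open>x a + y a\<close>.\<close>

lemma ent_superadditive:
  assumes fin: "finite A" and x: "\<And>a. a \<in> A \<Longrightarrow> 0 \<le> x a" and y: "\<And>a. a \<in> A \<Longrightarrow> 0 \<le> y a"
  shows "ent A x + ent A y \<le> ent A (\<lambda>a. x a + y a)"
proof -
  have "ent A x \<le> (\<Sum>a\<in>A. - x a * log 2 (x a + y a)) + (\<Sum>a\<in>A. x a) * log 2 (\<Sum>a\<in>A. x a + y a)"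
  proof (rule gibbs[OF fin])
    fix a assume "a \<in> A" "x a + y a = 0" thus "x a = 0" using x[of a] y[of a] by linarith
  qed (use x y in auto)
  moreover have "ent A y \<le> (\<Sum>a\<in>A. - y a * log 2 (x a + y a)) + (\<Sum>a\<in>A. y a) * log 2 (\<Sum>a\<in>A. x a + y a)"
  proof (rule gibbs[OF fin])
    fix a assume "a \<in> A" "x a + y a = 0" thus "y a = 0" using x[of a] y[of a] by linarith
  qed (use x y in auto)
  ultimately show ?thesis
    by (simp add: ent_def eta_def sum_negf sum.distrib sum_subtractf algebra_simps)
qed

lemma ent_scale:
  assumes "finite A" "0 \<le> c" "\<And>a. a \<in> A \<Longrightarrow> 0 \<le> x a"
  shows "ent A (\<lambda>a. c * x a) = c * ent A x"
proof -
  have "(\<Sum>a\<in>A. eta (c * x a)) = c * (\<Sum>a\<in>A. eta (x a)) + (\<Sum>a\<in>A. x a) * eta c"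
    using assms by (simp add: eta_mult sum.distrib sum_distrib_left sum_distrib_right)
  moreover have "eta (\<Sum>a\<in>A. c * x a) = c * eta (\<Sum>a\<in>A. x a) + (\<Sum>a\<in>A. x a) * eta c"
    using assms by (simp add: eta_mult sum_nonneg flip: sum_distrib_left)
  ultimately show ?thesis by (simp add: ent_def algebra_simps)
qed

lemma bent_le_1:
  assumes "0 \<le> t" "t \<le> 1"
  shows "bent t \<le> 1"
  using ent_le_log_card[of UNIV "ber t"] assms
  by (simp add: ent_def sum_eta_ber ber_nonneg)

text \<open>Grouping rule for one binary split of the mass. If both parts vanish, the quotient is 0
  by convention and is multiplied by 0.\<close>

lemma eta_sum_two:
  assumes "0 \<le> x" "0 \<le> y"
  shows "eta x + eta y - eta (x + y) = (x + y) * bent (y / (x + y))"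
proof (cases "x + y = 0")
  case True
  hence "x = 0" "y = 0" using assms by linarith+
  thus ?thesis by simp
next
  case False
  define c where "c = x + y"
  have c: "c > 0" using False assms by (simp add: c_def)
  have yc: "c * (y / c) = y" and xc: "c * (1 - y / c) = x" using c by (simp_all add: c_def field_simps)
  have "eta y = c * eta (y / c) + (y / c) * eta c"
    using eta_mult[of c "y / c"] c assms unfolding yc by simp
  moreover have "eta x = c * eta (1 - y / c) + (1 - y / c) * eta c"
    using eta_mult[of c "1 - y / c"] c assms unfolding xc by (simp add: c_def)
  ultimately have "eta x + eta y = c * bent (y / c) + eta c"
    by (simp add: bent_def algebra_simps)
  thus ?thesis by (simp add: c_def)
qed

text \<open>Only 0 is delicate, where \<open>x * ln x\<close> tends to 0. Continuity up to the
  endpoint makes the curve of test channels compact, deterministic channels included.\<close>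

lemma continuous_on_eta: "continuous_on {0..} eta"
proof -
  have "((\<lambda>x. x * ln x :: real) \<longlongrightarrow> 0) (at_right 0)"
    by real_asymp
  hence "(eta \<longlongrightarrow> 0) (at_right 0)"
    unfolding eta_def log_def using tendsto_divide[of "\<lambda>x. x * ln x :: real" 0 _ "\<lambda>x. - ln 2" "- ln 2"]
    by simp
  hence *: "(eta \<longlongrightarrow> eta 0) (at 0 within {0..})"
    by (simp add: at_within_Ici_at_right)
  have "isCont eta x" if "x > 0" for x
    unfolding eta_def using that by (intro continuous_intros) auto
  thus ?thesis
    unfolding continuous_on_def using *
    by (metis atLeast_iff continuous_at_imp_continuous_at_within continuous_within order_le_less)
qed

lemma continuous_on_bent: "continuous_on {0..1} bent"
  unfolding bent_def
  by (intro continuous_intros continuous_on_compose2[OF continuous_on_eta]) auto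

section \<open>Words and product weights\<close>

text \<open>The alphabet is a set, not a type, so that pairs, triples and whole blocks can serve as
  letters of longer words.\<close>

definition words :: "'a set \<Rightarrow> nat \<Rightarrow> 'a list set" where
  "words A n = {xs. length xs = n \<and> set xs \<subseteq> A}"

text \<open>\<open>w\<close> need not be a probability: likelihood ratios and reciprocals are
  multiplied out in the same way.\<close>

definition wt :: "('a \<Rightarrow> real) \<Rightarrow> 'a list \<Rightarrow> real" where
  "wt w xs = prod_list (map w xs)"

lemma words_UNIV: "words UNIV n = {xs. length xs = n}"
  by (simp add: words_def)

lemma length_words: "xs \<in> words A n \<Longrightarrow> length xs = n"
  by (simp add: words_def)

lemma finite_words [intro, simp]: "finite A \<Longrightarrow> finite (words A n)"
  using finite_lists_length_eq[of A n] by (simp add: words_def conj_commute)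

lemma words_0 [simp]: "words A 0 = {[]}"
  by (auto simp: words_def)

lemma words_Suc: "words A (Suc n) = (\<lambda>(a, xs). a # xs) ` (A \<times> words A n)"
  by (auto simp: words_def length_Suc_conv image_iff)

lemma sum_words_Suc:
  "(\<Sum>xs\<in>words A (Suc n). F xs) = (\<Sum>a\<in>A. \<Sum>xs\<in>words A n. F (a # xs))"
proof -
  have "(\<Sum>xs\<in>words A (Suc n). F xs) = (\<Sum>(a, xs)\<in>A \<times> words A n. F (a # xs))"
    unfolding words_Suc by (subst sum.reindex) (auto simp: inj_on_def case_prod_beta')
  thus ?thesis by (simp add: sum.cartesian_product)
qed

lemma card_words_bool: "card (words (UNIV :: bool set) n) = 2 ^ n"
  using card_lists_length_eq[of "UNIV :: bool set" n] by (simp add: words_def)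

lemma sum_words_append:
  "(\<Sum>xs\<in>words A (m + n). F xs) = (\<Sum>xs\<in>words A m. \<Sum>ys\<in>words A n. F (xs @ ys))"
  by (induction m arbitrary: F) (simp_all add: sum_words_Suc)

lemma wt_Nil [simp]: "wt w [] = 1" and wt_Cons [simp]: "wt w (x # xs) = w x * wt w xs"
  and wt_append [simp]: "wt w (xs @ ys) = wt w xs * wt w ys"
  by (simp_all add: wt_def)

lemma wt_nonneg: "(\<And>a. a \<in> A \<Longrightarrow> 0 \<le> w a) \<Longrightarrow> xs \<in> words A n \<Longrightarrow> 0 \<le> wt w xs"
  unfolding wt_def words_def by (intro prod_list_nonneg) auto

lemma sum_wt: "(\<Sum>xs\<in>words A n. wt w xs) = (\<Sum>a\<in>A. w a) ^ n"
  by (induction n) (simp_all add: sum_words_Suc flip: sum_distrib_left sum_distrib_right)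

lemma seq_prob_wt: "seq_prob q = wt (ber q)"
  by (simp add: fun_eq_iff seq_prob_def wt_def)

text \<open>Two words become one word of pairs, so that the bounds for i.i.d. letters apply to joint
  laws.\<close>

lemma sum_words_zip:
  "(\<Sum>xs\<in>words A n. \<Sum>ys\<in>words B n. F xs ys)
    = (\<Sum>zs\<in>words (A \<times> B) n. F (map fst zs) (map snd zs))"
proof (induction n arbitrary: F)
  case (Suc n)
  have "(\<Sum>xs\<in>words A (Suc n). \<Sum>ys\<in>words B (Suc n). F xs ys)
      = (\<Sum>a\<in>A. \<Sum>xs\<in>words A n. \<Sum>b\<in>B. \<Sum>ys\<in>words B n. F (a # xs) (b # ys))"
    by (simp add: sum_words_Suc)
  also have "\<dots> = (\<Sum>a\<in>A. \<Sum>b\<in>B. \<Sum>xs\<in>words A n. \<Sum>ys\<in>words B n. F (a # xs) (b # ys))"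
    by (intro sum.cong refl sum.swap)
  also have "\<dots> = (\<Sum>zs\<in>words (A \<times> B) (Suc n). F (map fst zs) (map snd zs))"
    unfolding sum_words_Suc Suc.IH sum.cartesian_product[of _ B, symmetric]
    by (subst sum.cartesian_product) (simp add: case_prod_beta')
  finally show ?case .
qed simp

section \<open>Second moments and the weak law for i.i.d. letters\<close>

lemma second_moment_words:
  fixes f w :: "'a \<Rightarrow> real"
  assumes w1: "(\<Sum>a\<in>A. w a) = 1" and \<mu>: "\<mu> = (\<Sum>a\<in>A. w a * f a)"
  shows "(\<Sum>xs\<in>words A n. wt w xs * (sum_list (map f xs) - n * \<mu>)\<^sup>2)
    = n * (\<Sum>a\<in>A. w a * (f a - \<mu>)\<^sup>2)"
proof (induction n)
  case (Suc n)
  \<comment> \<open>The centred sum has mean zero, which removes the cross term when the square of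
    the longer sum is expanded.\<close>
  have mean: "(\<Sum>xs\<in>words A n. wt w xs * (sum_list (map f xs) - n * \<mu>)) = 0" for n
  proof (induction n)
    case (Suc n)
    have "(\<Sum>xs\<in>words A (Suc n). wt w xs * (sum_list (map f xs) - real (Suc n) * \<mu>))
      = (\<Sum>a\<in>A. w a * (\<Sum>xs\<in>words A n. wt w xs * (sum_list (map f xs) - n * \<mu>))
          + w a * (f a - \<mu>) * (\<Sum>xs\<in>words A n. wt w xs))"
      unfolding sum_words_Suc sum_distrib_left sum.distrib[symmetric]
      by (intro sum.cong refl) (simp add: algebra_simps)
    also have "\<dots> = (\<Sum>a\<in>A. w a * (f a - \<mu>))" by (simp add: Suc sum_wt w1)
    also have "\<dots> = (\<Sum>a\<in>A. w a * f a) - (\<Sum>a\<in>A. w a) * \<mu>"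
      by (simp add: right_diff_distrib sum_subtractf sum_distrib_right)
    also have "\<dots> = 0" by (simp add: w1 \<mu>)
    finally show ?case .
  qed simp
  define S where "S = (\<lambda>xs. sum_list (map f xs) - n * \<mu>)"
  have "(\<Sum>xs\<in>words A (Suc n). wt w xs * (sum_list (map f xs) - real (Suc n) * \<mu>)\<^sup>2)
      = (\<Sum>a\<in>A. w a * (\<Sum>xs\<in>words A n. wt w xs * (S xs)\<^sup>2)
          + 2 * w a * (f a - \<mu>) * (\<Sum>xs\<in>words A n. wt w xs * S xs)
          + w a * (f a - \<mu>)\<^sup>2 * (\<Sum>xs\<in>words A n. wt w xs))"
    unfolding sum_words_Suc sum_distrib_left sum.distrib[symmetric]
    by (intro sum.cong refl) (simp add: S_def algebra_simps power2_eq_square)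
  also have "\<dots> = (\<Sum>xs\<in>words A n. wt w xs * (S xs)\<^sup>2) + (\<Sum>a\<in>A. w a * (f a - \<mu>)\<^sup>2)"
    using mean[of n] by (simp add: sum.distrib sum_wt w1 S_def flip: sum_distrib_right)
  also have "\<dots> = real (Suc n) * (\<Sum>a\<in>A. w a * (f a - \<mu>)\<^sup>2)"
    using Suc.IH by (simp add: S_def algebra_simps)
  finally show ?case .
qed simp

lemma chebyshev_words:
  fixes f w :: "'a \<Rightarrow> real"
  assumes w0: "\<And>a. a \<in> A \<Longrightarrow> 0 \<le> w a"
    and w1: "(\<Sum>a\<in>A. w a) = 1" and \<mu>: "\<mu> = (\<Sum>a\<in>A. w a * f a)"
    and n: "0 < n" and e: "0 < e"
  shows "(\<Sum>xs\<in>words A n. wt w xs * of_bool (sum_list (map f xs) > n * (\<mu> + e)))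
    \<le> (\<Sum>a\<in>A. w a * (f a - \<mu>)\<^sup>2) / e\<^sup>2 / n"
proof -
  define S where "S = (\<lambda>xs. sum_list (map f xs) - n * \<mu>)"
  have ne: "0 < real n * e" using n e by simp
  have "(\<Sum>xs\<in>words A n. wt w xs * of_bool (sum_list (map f xs) > n * (\<mu> + e)))
      \<le> (\<Sum>xs\<in>words A n. wt w xs * ((S xs)\<^sup>2 / (n * e)\<^sup>2))"
  proof (intro sum_mono mult_left_mono)
    fix xs
    show "of_bool (real n * (\<mu> + e) < sum_list (map f xs)) \<le> (S xs)\<^sup>2 / (n * e)\<^sup>2"
    proof (cases "sum_list (map f xs) > n * (\<mu> + e)")
      case True
      hence "S xs \<ge> n * e" by (simp add: S_def algebra_simps)
      hence "(S xs)\<^sup>2 \<ge> (n * e)\<^sup>2" using ne by (intro power_mono) auto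
      hence "1 \<le> (S xs)\<^sup>2 / (n * e)\<^sup>2" using zero_less_power[OF ne, of 2] by (subst pos_le_divide_eq) simp_all
      thus ?thesis using True by simp
    qed simp
  qed (use wt_nonneg w0 in blast)
  also have "\<dots> = n * (\<Sum>a\<in>A. w a * (f a - \<mu>)\<^sup>2) / (n * e)\<^sup>2"
    using second_moment_words[OF w1 \<mu>, of n] by (simp add: S_def flip: sum_divide_distrib)
  also have "\<dots> = (\<Sum>a\<in>A. w a * (f a - \<mu>)\<^sup>2) / e\<^sup>2 / n"
    using n by (simp add: power2_eq_square field_simps)
  finally show ?thesis .
qed

text \<open>The weak law for \<open>log 2 (r a)\<close>. The weight \<open>r\<close> is not tied to
  \<open>w\<close>: it is a likelihood ratio for the quantiser and a reciprocal probability for the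
  relay link. The logarithm of the product splits on every word of nonzero weight, because
  \<open>r\<close> is positive on its letters.\<close>

lemma aep_words:
  fixes r w :: "'a \<Rightarrow> real"
  assumes w0: "\<And>a. a \<in> A \<Longrightarrow> 0 \<le> w a"
    and w1: "(\<Sum>a\<in>A. w a) = 1" and \<mu>: "\<mu> = (\<Sum>a\<in>A. w a * log 2 (r a))"
    and r: "\<And>a. a \<in> A \<Longrightarrow> w a > 0 \<Longrightarrow> r a > 0"
    and n: "0 < n" and e: "0 < e"
  shows "(\<Sum>xs\<in>words A n. wt w xs * of_bool (wt r xs > 2 powr (n * (\<mu> + e))))
    \<le> (\<Sum>a\<in>A. w a * (log 2 (r a) - \<mu>)\<^sup>2) / e\<^sup>2 / n"
proof -
  have eq: "wt w xs = 0 \<or> (wt r xs > 0 \<and> log 2 (wt r xs) = sum_list (map (\<lambda>a. log 2 (r a)) xs))"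
    if "set xs \<subseteq> A" for xs
    using that
  proof (induction xs)
    case (Cons a xs)
    show ?case
    proof (cases "w a = 0")
      case False
      hence "r a > 0" using Cons.prems w0[of a] r[of a] by force
      thus ?thesis using Cons by (auto simp: log_mult)
    qed simp
  qed simp
  have "(\<Sum>xs\<in>words A n. wt w xs * of_bool (wt r xs > 2 powr (n * (\<mu> + e))))
     = (\<Sum>xs\<in>words A n. wt w xs * of_bool (sum_list (map (\<lambda>a. log 2 (r a)) xs) > n * (\<mu> + e)))"
  proof (intro sum.cong refl)
    fix xs assume "xs \<in> words A n"
    hence "wt w xs = 0 \<or> (wt r xs > 0 \<and> log 2 (wt r xs) = sum_list (map (\<lambda>a. log 2 (r a)) xs))"
      using eq by (simp add: words_def)
    thus "wt w xs * of_bool (wt r xs > 2 powr (n * (\<mu> + e)))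
       = wt w xs * of_bool (sum_list (map (\<lambda>a. log 2 (r a)) xs) > n * (\<mu> + e))"
      by (elim disjE conjE) (simp_all add: less_log_iff[of 2, symmetric])
  qed
  also have "\<dots> \<le> (\<Sum>a\<in>A. w a * (log 2 (r a) - \<mu>)\<^sup>2) / e\<^sup>2 / n"
    by (rule chebyshev_words[OF w0 w1 \<mu> n e])
  finally show ?thesis .
qed

section \<open>Addition mod 2 on words\<close>

definition bxor :: "bool list \<Rightarrow> bool list \<Rightarrow> bool list" where
  "bxor xs ys = map2 (\<noteq>) xs ys"

lemma bxor_simps [simp]: "bxor [] ys = []" "bxor (x # xs) (y # ys) = (x \<noteq> y) # bxor xs ys"
  by (simp_all add: bxor_def)

lemma length_bxor [simp]: "length (bxor xs ys) = min (length xs) (length ys)"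
  by (simp add: bxor_def)

lemma bxor_cancel: "length xs = length ys \<Longrightarrow> bxor xs (bxor xs ys) = ys"
  by (induction xs ys rule: list_induct2) auto

lemma bxor_map: "length xs = n \<Longrightarrow> length ys = n \<Longrightarrow> map (\<lambda>i. xs ! i \<noteq> ys ! i) [0..<n] = bxor xs ys"
  by (rule nth_equalityI) (auto simp: bxor_def)

lemma bij_betw_bxor: "length x = n \<Longrightarrow> bij_betw (bxor x) (words UNIV n) (words UNIV n)"
  by (rule bij_betw_byWitness[where f' = "bxor x"]) (auto simp: words_def bxor_cancel)

lemma sum_bxor:
  assumes "length x = n"
  shows "(\<Sum>ys\<in>words UNIV n. F (bxor x ys)) = (\<Sum>ys\<in>words UNIV n. F ys)"
  by (rule sum.reindex_bij_betw[OF bij_betw_bxor[OF assms]])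

text \<open>\<open>bxor x\<close> is an involution, so noise and channel output can exchange roles
  as the summation variable.\<close>

lemma sum_bxor':
  assumes "length x = n"
  shows "(\<Sum>ys\<in>words UNIV n. F ys (bxor x ys)) = (\<Sum>ys\<in>words UNIV n. F (bxor x ys) ys)"
proof -
  have "(\<Sum>ys\<in>words UNIV n. F ys (bxor x ys)) = (\<Sum>ys\<in>words UNIV n. F (bxor x (bxor x ys)) (bxor x ys))"
    using assms by (intro sum.cong refl) (simp add: bxor_cancel length_words)
  also have "\<dots> = (\<Sum>ys\<in>words UNIV n. F (bxor x ys) ys)"
    by (rule sum_bxor[OF assms])
  finally show ?thesis .
qed

section \<open>Test channels as points of a convex hull\<close>

locale binary_relay =
  fixes p \<delta> eps :: real
  assumes p: "0 \<le> p" "p \<le> 1" and \<delta>: "0 \<le> \<delta>" "\<delta> \<le> 1" and eps: "0 \<le> eps" "eps \<le> 1"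
begin

definition py1 :: real where
  "py1 = p * (1 - \<delta>) + (1 - p) * \<delta>"

text \<open>\<open>P(Z = 1 | Y\<^sub>1 = y)\<close>; when \<open>P(Y\<^sub>1 = y) = 0\<close> the division makes it \<open>0\<close>, which is harmless.\<close>

definition post :: "bool \<Rightarrow> real" where
  "post y = p * ber \<delta> (\<not> y) / ber py1 y"

text \<open>P(Z = 1 | U = u) when P(Y1 = 1 | U = u) is t, because U and Z are independent given
  Y1.\<close>

definition mix :: "real \<Rightarrow> real" where
  "mix t = t * post True + (1 - t) * post False"

definition curve :: "(real \<times> real \<times> real) set" where
  "curve = (\<lambda>t. (t, bent t, bent (mix t))) ` {0..1}"

lemma py1_bounds: "0 \<le> py1" "py1 \<le> 1"
proof -
  have "0 \<le> p * (1 - \<delta>)" "0 \<le> (1 - p) * \<delta>" "0 \<le> p * \<delta>" "0 \<le> (1 - p) * (1 - \<delta>)"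
    using p \<delta> by simp_all
  thus "0 \<le> py1" "py1 \<le> 1" by (simp_all add: py1_def algebra_simps)
qed

lemma joint_nonneg: "0 \<le> ber p z * ber \<delta> b"
  using p \<delta> by (simp add: ber_nonneg)

lemma joint_marginal: "(\<Sum>z\<in>UNIV. ber p z * ber \<delta> (y \<noteq> z)) = ber py1 y"
  by (cases y) (simp_all add: UNIV_bool ber_def py1_def algebra_simps)

lemma post_bounds: "0 \<le> post y" "post y \<le> 1"
proof -
  have 1: "ber p True * ber \<delta> (y \<noteq> True) \<le> ber py1 y"
    using joint_marginal[of y] joint_nonneg[of False "y \<noteq> False"] by (simp add: UNIV_bool)
  have 2: "0 \<le> ber p True * ber \<delta> (y \<noteq> True)" by (rule joint_nonneg)
  have 3: "ber p True * ber \<delta> (y \<noteq> True) = p * ber \<delta> (\<not> y)" by (simp add: ber_def)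
  have "0 \<le> ber py1 y" using py1_bounds by (simp add: ber_nonneg)
  thus "0 \<le> post y" "post y \<le> 1" using 1 2 unfolding 3 post_def
    by (auto simp: divide_le_eq_1)
qed

text \<open>Bayes' rule, valid also for a letter y of probability zero: the joint weight is then a
  nonnegative term of a vanishing sum, so both sides are 0 whatever \<open>post y\<close>
  is.\<close>

lemma joint_eq_post: "ber p z * ber \<delta> (y \<noteq> z) = ber py1 y * ber (post y) z"
proof (cases "ber py1 y = 0")
  case True
  have "ber p z * ber \<delta> (y \<noteq> z) = 0"
    using joint_marginal[of y] True joint_nonneg
    by (metis (no_types, lifting) UNIV_I finite sum_nonneg_eq_0_iff)
  thus ?thesis using True by simp
next
  case False
  have 1: "ber py1 y * post y = p * ber \<delta> (\<not> y)" using False by (simp add: post_def)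
  have 2: "ber p True * ber \<delta> (y \<noteq> True) + ber p False * ber \<delta> (y \<noteq> False) = ber py1 y"
    using joint_marginal[of y] by (simp add: UNIV_bool add.commute)
  show ?thesis
  proof (cases z)
    case True thus ?thesis using 1 by (simp add: ber_def[of p] ber_def[of "post y"])
  next
    case z: False
    have "ber py1 y * ber (post y) False = ber py1 y - p * ber \<delta> (\<not> y)"
      using 1 by (simp add: ber_def[of "post y"] algebra_simps)
    thus ?thesis using 2 z by (simp add: ber_def[of p])
  qed
qed

lemma mix_bounds:
  assumes "0 \<le> t" "t \<le> 1"
  shows "0 \<le> mix t" "mix t \<le> 1"
proof -
  show "0 \<le> mix t" using assms post_bounds by (simp add: mix_def)
  have "mix t \<le> t * 1 + (1 - t) * 1"
    unfolding mix_def using assms post_bounds by (intro add_mono mult_left_mono) auto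
  thus "mix t \<le> 1" by simp
qed

lemma ber_mix: "ber (mix t) z = (\<Sum>y\<in>UNIV. ber t y * ber (post y) z)"
  by (cases z) (simp_all add: UNIV_bool ber_def mix_def algebra_simps)

lemma mix_py1: "mix py1 = p"
proof -
  have "mix py1 = (\<Sum>y\<in>UNIV. ber p True * ber \<delta> (y \<noteq> True))"
    using ber_mix[of py1 True] unfolding joint_eq_post by (simp add: ber_def[of "mix py1"])
  thus ?thesis by (simp add: UNIV_bool ber_def algebra_simps)
qed

lemma compact_curve: "compact curve"
  unfolding curve_def
proof (intro compact_continuous_image continuous_intros)
  show "continuous_on {0..1} bent" by (rule continuous_on_bent)
  show "continuous_on {0..1} (\<lambda>x. bent (mix x))"
  proof (rule continuous_on_compose2[OF continuous_on_bent])
    show "continuous_on {0..1} mix" unfolding mix_def by (intro continuous_intros)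
  qed (use mix_bounds in auto)
qed simp

text \<open>\<open>w u = P(U = u)\<close> and \<open>t u = P(Y\<^sub>1 = 1 | U = u)\<close>.\<close>

definition repr :: "nat \<Rightarrow> (nat \<Rightarrow> real) \<Rightarrow> (nat \<Rightarrow> real) \<Rightarrow> bool" where
  "repr k w t \<longleftrightarrow> 0 < k \<and> (\<forall>u<k. 0 \<le> w u \<and> 0 \<le> t u \<and> t u \<le> 1) \<and> (\<Sum>u<k. w u) = 1"

text \<open>The coordinates stand for P(Y1 = 1), H(Y1 | U) and H(Z | U).\<close>

definition bary :: "nat \<Rightarrow> (nat \<Rightarrow> real) \<Rightarrow> (nat \<Rightarrow> real) \<Rightarrow> real \<times> real \<times> real" where
  "bary k w t = (\<Sum>u<k. w u * t u, \<Sum>u<k. w u * bent (t u), \<Sum>u<k. w u * bent (mix (t u)))"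

lemma bary_eq_sum: "bary k w t = (\<Sum>u<k. w u *\<^sub>R (t u, bent (t u), bent (mix (t u))))"
  by (simp add: bary_def prod_eq_iff fst_sum snd_sum)

lemma bary_in_hull:
  assumes "repr k w t"
  shows "bary k w t \<in> convex hull curve"
  unfolding bary_eq_sum
proof (rule convex_sum)
  fix u assume "u \<in> {..<k}"
  hence "(t u, bent (t u), bent (mix (t u))) \<in> curve"
    using assms by (auto simp: repr_def curve_def)
  thus "(t u, bent (t u), bent (mix (t u))) \<in> convex hull curve" by (rule hull_inc)
qed (use assms in \<open>auto simp: repr_def\<close>)

text \<open>Caratheodory in dimension 3 leaves at most 3 + 1 points. The curve is a graph over its
  first coordinate, so \<open>fst\<close> recovers the parameter of each point.\<close>

lemma hull_repr:
  assumes "v \<in> convex hull curve"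
  obtains k w t where "repr k w t" "k \<le> 4" "v = bary k w t"
proof -
  obtain S where S: "finite S" "S \<subseteq> curve" "card S \<le> 4" "v \<in> convex hull S"
    using assms unfolding caratheodory[of curve] by auto
  then obtain c where c: "\<forall>x\<in>S. 0 \<le> c x" "sum c S = 1" "(\<Sum>x\<in>S. c x *\<^sub>R x) = v"
    unfolding convex_hull_finite[OF S(1)] by auto
  obtain h where h: "bij_betw h {..<card S} S"
    using ex_bij_betw_nat_finite[OF S(1)] by (auto simp: atLeast0LessThan)
  have hS: "h u \<in> S" if "u < card S" for u
    using h that by (auto simp: bij_betw_def)
  hence hc: "h u \<in> curve" if "u < card S" for u using that S(2) by auto
  have sums: "(\<Sum>u<card S. F (h u)) = sum F S" for F :: "_ \<Rightarrow> 'b::comm_monoid_add"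
    using sum.reindex_bij_betw[OF h] .
  have "S \<noteq> {}" using c(2) by auto
  hence "repr (card S) (c \<circ> h) (fst \<circ> h)"
    using S(1) c(1,2) hS hc by (force simp: repr_def card_gt_0_iff sums curve_def)
  moreover have "v = bary (card S) (c \<circ> h) (fst \<circ> h)"
  proof -
    have "bary (card S) (c \<circ> h) (fst \<circ> h) = (\<Sum>u<card S. c (h u) *\<^sub>R h u)"
      unfolding bary_eq_sum using hc by (intro sum.cong refl) (force simp: curve_def)
    thus ?thesis using sums[of "\<lambda>x. c x *\<^sub>R x"] c(3) by simp
  qed
  ultimately show thesis using S(3) that by blast
qed

text \<open>\<open>wq\<close> equates the two factorisations of the joint law of Y1 and U. Its
  product form avoids dividing by the probability of a letter that may never occur.\<close>

lemma test_channel_values: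
  assumes rep: "repr k w t" and q: "\<And>y. (\<Sum>u<k. q y u) = 1"
    and wq: "\<And>y u. u < k \<Longrightarrow> ber py1 y * q y u = w u * ber (t u) y"
  shows "mutinf (\<lambda>y1 u. \<Sum>z\<in>UNIV. jointZYU p \<delta> q z y1 u) UNIV {..<k}
      = bent py1 - (\<Sum>u<k. w u * bent (t u))"
    and "objective p \<delta> k q = 1 - (\<Sum>u<k. w u * bent (mix (t u)))"
proof -
  have w0: "0 \<le> w u" and t0: "0 \<le> t u" "t u \<le> 1" if "u < k" for u
    using rep that by (auto simp: repr_def)
  have YU: "(\<Sum>z\<in>UNIV. jointZYU p \<delta> q z y u) = w u * ber (t u) y" if "u < k" for y u
    using wq[OF that] joint_marginal[of y] by (simp add: jointZYU_def flip: sum_distrib_right)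
  have ZU: "(\<Sum>y\<in>UNIV. jointZYU p \<delta> q z y u) = w u * ber (mix (t u)) z" if "u < k" for z u
  proof -
    have "jointZYU p \<delta> q z y u = w u * (ber (t u) y * ber (post y) z)" for y
      unfolding jointZYU_def joint_eq_post using wq[OF that, of y] by (simp add: algebra_simps)
    thus ?thesis by (simp add: ber_mix sum_distrib_left)
  qed
  have Y: "(\<Sum>u<k. w u * ber (t u) y) = ber py1 y" for y
  proof -
    have "(\<Sum>u<k. w u * ber (t u) y) = (\<Sum>u<k. ber py1 y * q y u)"
      by (intro sum.cong refl) (simp add: wq)
    thus ?thesis using q[of y] by (simp flip: sum_distrib_left)
  qed
  have U: "(\<Sum>y\<in>UNIV. w u * ber s y) = w u" for u s
    by (simp flip: sum_distrib_left)
  have "mutinf (\<lambda>y1 u. \<Sum>z\<in>UNIV. jointZYU p \<delta> q z y1 u) UNIV {..<k}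
    = (\<Sum>y\<in>UNIV. \<Sum>u<k. w u * (- eta (ber (t u) y)) - w u * ber (t u) y * log 2 (ber py1 y))"
    unfolding mutinf_def
  proof (intro sum.cong refl)
    fix y u assume u: "u \<in> {..<k}"
    let ?b = "w u * ber (t u) y"
    have "(if ?b = 0 then 0 else ?b * log 2 (?b / (ber py1 y * w u)))
      = w u * (- eta (ber (t u) y)) - ?b * log 2 (ber py1 y)"
    proof (cases "?b = 0")
      case True thus ?thesis by (auto simp: eta_def)
    next
      case False
      have b: "0 < ?b" using False w0[of u] t0[of u] u by (simp add: order_less_le ber_nonneg)
      \<comment> \<open>A joint weight is at most its marginal, so a positive one makes both
        marginals positive and the logarithm splits.\<close>
      have "?b \<le> ber py1 y" unfolding Y[of y, symmetric]
        using u w0 t0 by (intro member_le_sum) (auto simp: ber_nonneg)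
      hence "0 < ber py1 y" using b by simp
      moreover have "0 < w u" "0 < ber (t u) y" using b w0[of u] u
        by (auto simp: zero_less_mult_iff)
      ultimately show ?thesis by (simp add: eta_def log_divide log_mult algebra_simps)
    qed
    thus "(if (\<Sum>z\<in>UNIV. jointZYU p \<delta> q z y u) = 0 then 0
      else (\<Sum>z\<in>UNIV. jointZYU p \<delta> q z y u) * log 2 ((\<Sum>z\<in>UNIV. jointZYU p \<delta> q z y u) /
        ((\<Sum>b'<k. \<Sum>z\<in>UNIV. jointZYU p \<delta> q z y b') * (\<Sum>a'\<in>UNIV. \<Sum>z\<in>UNIV. jointZYU p \<delta> q z a' u))))
      = w u * (- eta (ber (t u) y)) - ?b * log 2 (ber py1 y)"
      using u by (simp add: YU Y U cong: if_cong split: if_splits)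
  qed
  also have "\<dots> = (\<Sum>y\<in>UNIV. \<Sum>u<k. w u * (- eta (ber (t u) y)))
      - (\<Sum>y\<in>UNIV. (\<Sum>u<k. w u * ber (t u) y) * log 2 (ber py1 y))"
    by (simp add: sum_subtractf sum_distrib_right)
  also have "(\<Sum>y\<in>UNIV. (\<Sum>u<k. w u * ber (t u) y) * log 2 (ber py1 y)) = - bent py1"
    by (simp add: Y sum_negf eta_def flip: sum_eta_ber)
  also have "(\<Sum>y\<in>UNIV. \<Sum>u<k. w u * (- eta (ber (t u) y))) = - (\<Sum>u<k. w u * bent (t u))"
    by (subst sum.swap) (simp add: sum_negf flip: sum_distrib_left sum_eta_ber)
  finally show "mutinf (\<lambda>y1 u. \<Sum>z\<in>UNIV. jointZYU p \<delta> q z y1 u) UNIV {..<k}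
      = bent py1 - (\<Sum>u<k. w u * bent (t u))" by simp
  have "condent (\<lambda>z u. \<Sum>y1\<in>UNIV. jointZYU p \<delta> q z y1 u) UNIV {..<k}
    = (\<Sum>z\<in>UNIV. \<Sum>u<k. w u * eta (ber (mix (t u)) z))"
    unfolding condent_def
  proof (intro sum.cong refl)
    fix z u assume u: "u \<in> {..<k}"
    let ?b = "w u * ber (mix (t u)) z"
    have "(if ?b = 0 then 0 else - ?b * log 2 (?b / w u)) = w u * eta (ber (mix (t u)) z)"
      by (auto simp: eta_def)
    thus "(if (\<Sum>y\<in>UNIV. jointZYU p \<delta> q z y u) = 0 then 0
      else - (\<Sum>y\<in>UNIV. jointZYU p \<delta> q z y u) * log 2 ((\<Sum>y\<in>UNIV. jointZYU p \<delta> q z y u) /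
        (\<Sum>a'\<in>UNIV. \<Sum>y\<in>UNIV. jointZYU p \<delta> q a' y u)))
      = w u * eta (ber (mix (t u)) z)"
      using u by (simp add: ZU U eta_def)
  qed
  also have "\<dots> = (\<Sum>u<k. w u * bent (mix (t u)))"
    by (subst sum.swap) (simp flip: sum_distrib_left sum_eta_ber)
  finally show "objective p \<delta> k q = 1 - (\<Sum>u<k. w u * bent (mix (t u)))"
    by (simp add: objective_def)
qed

text \<open>Bayes' rule turns \<open>q\<close> into weights P(U = u) and posteriors P(Y1 = 1 | U =
  u), hence into a point of the hull. A symbol of weight zero gets posterior 0 by the convention for
  division.\<close>

lemma feasible_point:
  assumes k: "0 < k" and q0: "\<And>y u. 0 \<le> q y u" and q1: "\<And>y. (\<Sum>u<k. q y u) = 1"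
  obtains v where "v \<in> convex hull curve" "fst v = py1"
    "mutinf (\<lambda>y1 u. \<Sum>z\<in>UNIV. jointZYU p \<delta> q z y1 u) UNIV {..<k} = bent py1 - fst (snd v)"
    "objective p \<delta> k q = 1 - snd (snd v)"
proof -
  define w where "w = (\<lambda>u. \<Sum>y\<in>UNIV. ber py1 y * q y u)"
  define t where "t = (\<lambda>u. ber py1 True * q True u / w u)"
  have nn: "0 \<le> ber py1 y * q y u" for y u using q0 py1_bounds by (simp add: ber_nonneg)
  have w0: "0 \<le> w u" for u unfolding w_def by (intro sum_nonneg nn)
  have w_split: "w u = ber py1 True * q True u + ber py1 False * q False u" for u
    by (simp add: w_def UNIV_bool)
  have wt: "ber py1 y * q y u = w u * ber (t u) y" for y u
  proof (cases "w u = 0")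
    case True
    hence "ber py1 True * q True u = 0" "ber py1 False * q False u = 0"
      using w_split[of u] nn[of True u] nn[of False u] by linarith+
    thus ?thesis using True by (cases y) auto
  next
    case False
    thus ?thesis using w_split[of u] by (cases y) (simp_all add: t_def ber_def[of "_ / _"] field_simps)
  qed
  have t01: "0 \<le> t u \<and> t u \<le> 1" for u
    using w_split[of u] nn[of True u] nn[of False u] w0[of u] unfolding t_def
    by (auto simp: divide_le_eq_1 simp del: mult_nonneg_nonneg)
  have w1: "(\<Sum>u<k. w u) = 1"
    unfolding w_def by (subst sum.swap) (simp add: q1 flip: sum_distrib_left)
  have rep: "repr k w t" using k w0 t01 w1 by (simp add: repr_def)
  have "(\<Sum>u<k. w u * t u) = py1"
  proof -
    have "(\<Sum>u<k. w u * t u) = (\<Sum>u<k. py1 * q True u)"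
      by (intro sum.cong refl) (use wt[of True] in \<open>simp add: ber_def\<close>)
    thus ?thesis using q1[of True] by (simp flip: sum_distrib_left)
  qed
  thus thesis
    using that[OF bary_in_hull[OF rep]] test_channel_values[OF rep q1 wt] by (simp add: bary_def)
qed

lemma point_test_channel:
  assumes rep: "repr k w t" and mean: "(\<Sum>u<k. w u * t u) = py1"
  obtains q where "\<And>y u. 0 \<le> q y u" "\<And>y. (\<Sum>u<k. q y u) = 1"
    "\<And>y u. u < k \<Longrightarrow> ber py1 y * q y u = w u * ber (t u) y"
proof -
  have w0: "0 \<le> w u" and t0: "0 \<le> t u" "t u \<le> 1" if "u < k" for u
    using rep that by (auto simp: repr_def)
  have w1: "(\<Sum>u<k. w u) = 1" using rep by (simp add: repr_def)
  have Y: "(\<Sum>u<k. w u * ber (t u) y) = ber py1 y" for y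
    using mean w1 by (cases y) (simp_all add: ber_def right_diff_distrib sum_subtractf)
  \<comment> \<open>For a letter y of probability zero the row of \<open>q\<close> must still sum to
    one; \<open>w\<close> itself is such a row.\<close>
  define q where "q = (\<lambda>y u. if u < k then
    (if ber py1 y = 0 then w u else w u * ber (t u) y / ber py1 y) else 0)"
  have "0 \<le> ber py1 y" for y using py1_bounds by (simp add: ber_nonneg)
  hence "0 \<le> q y u" for y u using w0 t0 by (auto simp: q_def ber_nonneg)
  moreover have "(\<Sum>u<k. q y u) = 1" for y
    using w1 Y[of y] by (cases "ber py1 y = 0") (simp_all add: q_def flip: sum_divide_distrib)
  moreover have "ber py1 y * q y u = w u * ber (t u) y" if u: "u < k" for y u
  proof (cases "ber py1 y = 0")
    case True
    have "\<forall>u\<in>{..<k}. w u * ber (t u) y = 0"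
      using Y[of y] True w0 t0 by (subst sum_nonneg_eq_0_iff[symmetric]) (auto simp: ber_nonneg)
    thus ?thesis using True u by simp
  qed (use u in \<open>simp add: q_def\<close>)
  ultimately show thesis using that by blast
qed

end

section \<open>Capacity of the relay link\<close>

lemma R0_eq:
  assumes eps: "0 \<le> eps" "eps \<le> 1"
  shows "R0 eps = 1 - bent eps"
proof -
  define m where "m = (\<lambda>a. a * (1 - eps) + (1 - a) * eps)"
  have val: "mutinf (\<lambda>x1 s. ber a x1 * ber eps (s \<noteq> x1)) UNIV UNIV = bent (m a) - bent eps"
    if a: "0 \<le> a" "a \<le> 1" for a
  proof -
    \<comment> \<open>The link is read as a source pair: its input takes the place of Z and its
      noise that of V, so \<open>py1\<close> is P(S = 1).\<close>
    interpret binary_relay a eps eps using a eps by unfold_locales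
    have m: "py1 = m a" by (simp add: py1_def m_def)
    have X: "(\<Sum>s\<in>UNIV. ber a x * ber eps (s \<noteq> x)) = ber a x" for x
      by (cases x) (simp_all add: UNIV_bool ber_def algebra_simps)
    have tm: "(if ber a x * ber eps (s \<noteq> x) = 0 then 0 else
      ber a x * ber eps (s \<noteq> x) * log 2 (ber a x * ber eps (s \<noteq> x) / (ber a x * ber py1 s)))
      = ber a x * (- eta (ber eps (s \<noteq> x))) - ber a x * ber eps (s \<noteq> x) * log 2 (ber py1 s)" for x s
    proof (cases "ber a x * ber eps (s \<noteq> x) = 0")
      case True thus ?thesis by (auto simp: eta_def)
    next
      case False
      have "0 < ber a x" "0 < ber eps (s \<noteq> x)"
        using False a eps by (simp_all add: order_less_le ber_nonneg)
      moreover have "ber a x * ber eps (s \<noteq> x) \<le> ber py1 s"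
        unfolding joint_marginal[symmetric] by (intro member_le_sum joint_nonneg) auto
      ultimately have "0 < ber py1 s" by (meson less_le_trans mult_pos_pos)
      thus ?thesis using \<open>0 < ber a x\<close> \<open>0 < ber eps (s \<noteq> x)\<close>
        by (simp add: eta_def log_divide algebra_simps)
    qed
    have sum_flip: "(\<Sum>s\<in>UNIV. eta (ber eps (s \<noteq> x))) = bent eps" for x :: bool
      by (cases x) (simp_all add: UNIV_bool ber_def bent_def)
    have "mutinf (\<lambda>x1 s. ber a x1 * ber eps (s \<noteq> x1)) UNIV UNIV
      = (\<Sum>x\<in>UNIV. \<Sum>s\<in>UNIV. ber a x * (- eta (ber eps (s \<noteq> x)))
          - ber a x * ber eps (s \<noteq> x) * log 2 (ber py1 s))"
      unfolding mutinf_def X joint_marginal tm ..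
    also have "\<dots> = (\<Sum>x\<in>UNIV. \<Sum>s\<in>UNIV. ber a x * (- eta (ber eps (s \<noteq> x))))
      - (\<Sum>s\<in>UNIV. (\<Sum>x\<in>UNIV. ber a x * ber eps (s \<noteq> x)) * log 2 (ber py1 s))"
      unfolding sum_subtractf sum_distrib_right by (subst (2) sum.swap) (rule refl)
    also have "(\<Sum>x\<in>UNIV. \<Sum>s\<in>UNIV. ber a x * (- eta (ber eps (s \<noteq> x)))) = - bent eps"
      unfolding sum_distrib_left[symmetric] sum_negf sum_flip by (simp add: sum_negf flip: sum_distrib_right)
    also have "(\<Sum>s\<in>UNIV. (\<Sum>x\<in>UNIV. ber a x * ber eps (s \<noteq> x)) * log 2 (ber py1 s)) = - bent py1"
      unfolding joint_marginal by (simp add: sum_negf eta_def flip: sum_eta_ber)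
    finally show ?thesis by (simp add: m)
  qed
  have m01: "0 \<le> m a \<and> m a \<le> 1" if "0 \<le> a" "a \<le> 1" for a
  proof -
    interpret binary_relay a eps eps using that eps by unfold_locales
    show ?thesis using py1_bounds by (simp add: py1_def m_def)
  qed
  \<comment> \<open>A fair input makes the output fair whatever the noise, and a binary output has
    entropy at most one bit.\<close>
  have "eta (1 / 2) = 1 / 2" by (simp add: eta_def log_divide)
  hence half: "bent (1 / 2) = 1" by (simp add: bent_def)
  show ?thesis unfolding R0_def
  proof (rule cSup_eq_maximum)
    have "mutinf (\<lambda>x1 s. ber (1/2) x1 * ber eps (s \<noteq> x1)) UNIV UNIV = 1 - bent eps"
    proof -
      have m_half: "m (1 / 2) = 1 / 2" by (simp add: m_def field_simps)
      show ?thesis using val[of "1 / 2"] unfolding m_half half by simp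
    qed
    thus "1 - bent eps \<in> (\<lambda>a. mutinf (\<lambda>x1 s. ber a x1 * ber eps (s \<noteq> x1)) UNIV UNIV) ` {0..1}"
      by (intro image_eqI[of _ _ "1 / 2"]) auto
  next
    fix x assume "x \<in> (\<lambda>a. mutinf (\<lambda>x1 s. ber a x1 * ber eps (s \<noteq> x1)) UNIV UNIV) ` {0..1}"
    then obtain a where "0 \<le> a" "a \<le> 1" "x = bent (m a) - bent eps" using val by auto
    thus "x \<le> 1 - bent eps" using bent_le_1 m01 by simp
  qed
qed

section \<open>Converse\<close>

lemma wt_ber_nonneg: "0 \<le> q \<Longrightarrow> q \<le> 1 \<Longrightarrow> 0 \<le> wt (ber q) xs"
  unfolding wt_def by (intro prod_list_nonneg) (auto simp: ber_nonneg)

lemma sum_wt_ber [simp]: "(\<Sum>xs\<in>words UNIV n. wt (ber q) xs) = 1"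
  by (simp add: sum_wt)

lemma sum_eta_wt_ber:
  assumes q: "0 \<le> q" "q \<le> 1"
  shows "(\<Sum>xs\<in>words UNIV n. eta (wt (ber q) xs)) = n * bent q"
proof (induction n)
  case (Suc n)
  have "(\<Sum>xs\<in>words UNIV (Suc n). eta (wt (ber q) xs))
    = (\<Sum>b\<in>UNIV. ber q b * (\<Sum>xs\<in>words UNIV n. eta (wt (ber q) xs))
        + (\<Sum>xs\<in>words UNIV n. wt (ber q) xs) * eta (ber q b))"
    using q by (simp add: sum_words_Suc eta_mult ber_nonneg wt_ber_nonneg sum.distrib
        sum_distrib_left sum_distrib_right del: sum_wt_ber)
  also have "\<dots> = n * bent q + bent q"
    using Suc by (simp add: sum.distrib sum_eta_ber flip: sum_distrib_right)
  finally show ?case by (simp add: algebra_simps)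
qed simp

text \<open>Chain rule for the first bit. The conditional entropy of the tail is a plain sum over
  the two slices because these are left unnormalised.\<close>

lemma ent_words_Suc:
  fixes n :: nat
  assumes \<mu>: "\<And>ys. 0 \<le> \<mu> ys"
  defines "c \<equiv> (\<lambda>b. \<Sum>ys\<in>words UNIV n. \<mu> (b # ys))"
  shows "ent (words UNIV (Suc n)) \<mu> = (\<Sum>b\<in>UNIV. ent (words UNIV n) (\<lambda>ys. \<mu> (b # ys)))
      + (c False + c True) * bent (c True / (c False + c True))"
proof -
  have "0 \<le> c b" for b unfolding c_def using \<mu> by (intro sum_nonneg) auto
  hence "eta (c False) + eta (c True) - eta (c False + c True)
      = (c False + c True) * bent (c True / (c False + c True))"
    by (intro eta_sum_two) auto
  thus ?thesis by (simp add: ent_def sum_words_Suc UNIV_bool c_def add.commute)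
qed

text \<open>Gibbs' inequality against the reference weights \<open>1/2 + M/2 \<cdot> [decoding succeeds]\<close>, which sum to
  at most \<open>2\<^sup>n M\<close> because the decoder outputs only one message.\<close>

lemma fano_additive:
  fixes J :: "bool list \<Rightarrow> real" and d :: "bool list \<Rightarrow> nat"
  assumes J: "\<And>z. 0 \<le> J z" and M: "0 < M" and x: "\<And>m. length (x m) = n"
  shows "ent (words UNIV n) J \<le> (\<Sum>z\<in>words UNIV n. J z) * (n + 1)
    - log 2 M / M * (\<Sum>m<M. \<Sum>z\<in>words UNIV n. J z * of_bool (d (bxor (x m) z) = m))"
proof -
  define W where "W = words (UNIV :: bool set) n"
  define T where "T = (\<Sum>z\<in>W. J z)"
  define hit where "hit = (\<lambda>m z. of_bool (d (bxor (x m) z) = m) :: real)"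
  define b where "b = (\<lambda>m z. hit m z * (M / 2) + 1 / 2)"
  have finW: "finite W" by (simp add: W_def)
  have T0: "0 \<le> T" unfolding T_def by (intro sum_nonneg J)
  have b0: "0 < b m z" for m z by (simp add: b_def hit_def add_nonneg_pos)
  have logb: "- log 2 (b m z) \<le> 1 - hit m z * log 2 M" for m z
  proof (cases "d (bxor (x m) z) = m")
    case True
    have "log 2 (real M / 2) \<le> log 2 (b m z)"
      using True M by (intro log_mono) (auto simp: b_def hit_def)
    thus ?thesis using True M by (simp add: hit_def log_divide)
  next
    case False
    thus ?thesis by (simp add: b_def hit_def log_divide)
  qed
  have "(\<Sum>m<M. \<Sum>z\<in>W. hit m z) = (\<Sum>m<M. \<Sum>y\<in>W. of_bool (d y = m))"
    unfolding hit_def W_def by (intro sum.cong refl sum_bxor[OF x])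
  also have "\<dots> = (\<Sum>y\<in>W. \<Sum>m<M. of_bool (d y = m))" by (rule sum.swap)
  also have "\<dots> \<le> (\<Sum>y\<in>W. 1)"
    by (intro sum_mono) (simp add: of_bool_def)
  finally have hits: "(\<Sum>m<M. \<Sum>z\<in>W. hit m z) \<le> 2 ^ n" by (simp add: W_def card_words_bool)
  have "(\<Sum>m<M. \<Sum>z\<in>W. b m z) = (\<Sum>m<M. \<Sum>z\<in>W. hit m z) * (M / 2) + 2 ^ n * (M / 2)"
    by (simp only: b_def sum.distrib sum_distrib_right) (simp add: W_def card_words_bool)
  also have "\<dots> \<le> 2 ^ n * (M / 2) + 2 ^ n * (M / 2)"
    using hits by (intro add_mono mult_right_mono) auto
  finally have sumb: "(\<Sum>m<M. \<Sum>z\<in>W. b m z) \<le> 2 ^ n * M" by (simp add: mult.commute)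
  have "0 < (\<Sum>m<M. \<Sum>z\<in>W. b m z)"
  proof (intro sum_pos)
    show "W \<noteq> {}" using x[of 0] by (auto simp: W_def words_def)
  qed (use b0 M finW in auto)
  hence "log 2 (\<Sum>m<M. \<Sum>z\<in>W. b m z) \<le> log 2 (2 ^ n * M)"
    using sumb by (intro log_mono) auto
  also have "\<dots> = n + log 2 M" using M by (simp add: log_mult log_nat_power)
  finally have logsum: "log 2 (\<Sum>m<M. \<Sum>z\<in>W. b m z) \<le> n + log 2 M" .
  have cart: "(\<Sum>a\<in>{..<M} \<times> W. F (fst a) (snd a)) = (\<Sum>m<M. \<Sum>z\<in>W. F m z)"
    for F :: "nat \<Rightarrow> bool list \<Rightarrow> real"
    by (simp add: sum.cartesian_product case_prod_beta')
  have "ent ({..<M} \<times> W) (\<lambda>a. J (snd a)) \<le>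
    (\<Sum>a\<in>{..<M} \<times> W. - J (snd a) * log 2 (b (fst a) (snd a)))
      + (\<Sum>a\<in>{..<M} \<times> W. J (snd a)) * log 2 (\<Sum>a\<in>{..<M} \<times> W. b (fst a) (snd a))"
    using finW J b0 by (intro gibbs) (auto simp: less_le)
  also have "\<dots> = (\<Sum>m<M. \<Sum>z\<in>W. J z * (- log 2 (b m z))) + M * T * log 2 (\<Sum>m<M. \<Sum>z\<in>W. b m z)"
    unfolding cart[of "\<lambda>m z. - J z * log 2 (b m z)"] cart[of "\<lambda>m. J"] cart[of b]
    by (simp add: T_def)
  also have "\<dots> \<le> (\<Sum>m<M. \<Sum>z\<in>W. J z * (1 - hit m z * log 2 M)) + M * T * (n + log 2 M)"
    using logsum logb J T0 by (intro add_mono sum_mono mult_left_mono) auto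
  also have "\<dots> = M * T - log 2 M * (\<Sum>m<M. \<Sum>z\<in>W. J z * hit m z) + M * T * (n + log 2 M)"
    by (simp add: right_diff_distrib sum_subtractf T_def sum_distrib_left mult_ac)
  finally have 1: "ent ({..<M} \<times> W) (\<lambda>a. J (snd a))
    \<le> M * T - log 2 M * (\<Sum>m<M. \<Sum>z\<in>W. J z * hit m z) + M * T * (n + log 2 M)" .
  \<comment> \<open>\<open>M\<close> equal copies of \<open>J\<close> carry the extra entropy
    \<open>M * T * log 2 M\<close> of a uniform message, which cancels the \<open>log 2 M\<close>
    coming from the mass of the reference weights.\<close>
  have "ent ({..<M} \<times> W) (\<lambda>a. J (snd a)) = M * (\<Sum>z\<in>W. eta (J z)) - eta (M * T)"
    unfolding ent_def cart[of "\<lambda>m. J"] cart[of "\<lambda>m z. eta (J z)"] by (simp add: T_def)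
  also have "\<dots> = M * ent W J + M * T * log 2 M"
    using T0 by (simp add: eta_mult ent_def T_def[symmetric]) (simp add: eta_def algebra_simps)
  finally have "M * ent W J \<le> M * (T * (n + 1)) - log 2 M * (\<Sum>m<M. \<Sum>z\<in>W. J z * hit m z)"
    using 1 by (simp add: algebra_simps)
  hence "M * ent W J / M \<le> (M * (T * (n + 1)) - log 2 M * (\<Sum>m<M. \<Sum>z\<in>W. J z * hit m z)) / M"
    by (rule divide_right_mono) simp
  thus ?thesis using M
    by (simp add: diff_divide_distrib T_def[unfolded W_def] W_def hit_def add.commute)
qed

lemma error_prob_bxor:
  "error_prob p \<delta> eps n M enc relay dec = (1 / real M) * (\<Sum>m<M.
     \<Sum>zs\<in>words UNIV n. \<Sum>vs\<in>words UNIV n. \<Sum>ns\<in>words UNIV n.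
       wt (ber p) zs * wt (ber \<delta>) vs * wt (ber eps) ns *
       of_bool (dec (bxor (map (enc m) [0..<n]) zs)
         (bxor (map (\<lambda>i. relay i (take i (bxor zs vs))) [0..<n]) ns) \<noteq> m))"
proof -
  have *: "map (\<lambda>i. f i \<noteq> xs ! i) [0..<n] = bxor (map f [0..<n]) xs" if "length xs = n" for f xs
    by (rule nth_equalityI) (use that in \<open>auto simp: bxor_def\<close>)
  show ?thesis
    unfolding error_prob_def words_UNIV seq_prob_wt Let_def
  proof (intro arg_cong2[where f = "(*)"] sum.cong refl)
    fix m zs vs ns assume "zs \<in> {xs :: bool list. length xs = n}" "vs \<in> {xs :: bool list. length xs = n}"
      "ns \<in> {xs :: bool list. length xs = n}"
    hence l: "length zs = n" "length vs = n" "length ns = n" by auto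
    show "(if dec (map (\<lambda>i. enc m i \<noteq> zs ! i) [0..<n])
        (map (\<lambda>i. relay i (take i (map (\<lambda>i. zs ! i \<noteq> vs ! i) [0..<n])) \<noteq> ns ! i) [0..<n]) \<noteq> m
      then 1 else 0) = (of_bool (dec (bxor (map (enc m) [0..<n]) zs)
         (bxor (map (\<lambda>i. relay i (take i (bxor zs vs))) [0..<n]) ns) \<noteq> m) :: real)"
      unfolding *[OF l(1)] bxor_map[OF l(1,2)] *[OF l(3)] of_bool_def ..
  qed
qed

context binary_relay
begin

section \<open>Posterior law of Z given the relay's observations\<close>

definition kern :: "bool list \<Rightarrow> bool list \<Rightarrow> real" where
  "kern ys zs = prod_list (map2 (\<lambda>y z. ber (post y) z) ys zs)"

lemma kern_simps [simp]: "kern [] zs = 1" "kern (y # ys) (z # zs) = ber (post y) z * kern ys zs"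
  by (simp_all add: kern_def)

lemma kern_nonneg: "0 \<le> kern ys zs"
  unfolding kern_def using post_bounds by (intro prod_list_nonneg) (auto simp: ber_nonneg)

lemma sum_kern: "length ys = n \<Longrightarrow> (\<Sum>zs\<in>words UNIV n. kern ys zs) = 1"
  by (induction ys arbitrary: n) (auto simp: sum_words_Suc simp flip: sum_distrib_left sum_distrib_right)

lemma wt_joint_eq_kern:
  "length zs = length ys \<Longrightarrow> wt (ber p) zs * wt (ber \<delta>) (bxor zs ys) = wt (ber py1) ys * kern ys zs"
proof (induction zs ys rule: list_induct2)
  case (Cons z zs y ys)
  have "wt (ber p) (z # zs) * wt (ber \<delta>) (bxor (z # zs) (y # ys))
    = (ber p z * ber \<delta> (y \<noteq> z)) * (wt (ber p) zs * wt (ber \<delta>) (bxor zs ys))"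
    by (cases y; cases z) simp_all
  also have "\<dots> = wt (ber py1) (y # ys) * kern (y # ys) (z # zs)"
    unfolding Cons.IH joint_eq_post by simp
  finally show ?case .
qed simp

text \<open>The pair (Z, V) is exchanged for (Y1, Z). The relay depends on Y1 alone, so in the new
  order Z can be drawn last, from \<open>kern\<close>, independently of the link.\<close>

lemma sum_noise_change:
  "(\<Sum>zs\<in>words UNIV n. \<Sum>vs\<in>words UNIV n. wt (ber p) zs * wt (ber \<delta>) vs * F zs (bxor zs vs))
    = (\<Sum>ys\<in>words UNIV n. \<Sum>zs\<in>words UNIV n. wt (ber py1) ys * kern ys zs * F zs ys)"
proof -
  have "(\<Sum>vs\<in>words UNIV n. wt (ber p) zs * wt (ber \<delta>) vs * F zs (bxor zs vs))
    = (\<Sum>ys\<in>words UNIV n. wt (ber py1) ys * kern ys zs * F zs ys)" if "zs \<in> words UNIV n" for zs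
  proof -
    have "(\<Sum>vs\<in>words UNIV n. wt (ber p) zs * wt (ber \<delta>) vs * F zs (bxor zs vs))
      = (\<Sum>ys\<in>words UNIV n. wt (ber p) zs * wt (ber \<delta>) (bxor zs ys) * F zs ys)"
      by (rule sum_bxor') (use that length_words in blast)
    also have "\<dots> = (\<Sum>ys\<in>words UNIV n. wt (ber py1) ys * kern ys zs * F zs ys)"
      using that by (intro sum.cong refl arg_cong2[where f = "(*)"] wt_joint_eq_kern) (simp add: length_words)
    finally show ?thesis .
  qed
  hence "(\<Sum>zs\<in>words UNIV n. \<Sum>vs\<in>words UNIV n. wt (ber p) zs * wt (ber \<delta>) vs * F zs (bxor zs vs))
      = (\<Sum>zs\<in>words UNIV n. \<Sum>ys\<in>words UNIV n. wt (ber py1) ys * kern ys zs * F zs ys)"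
    by (rule sum.cong[OF refl])
  also have "\<dots> = (\<Sum>ys\<in>words UNIV n. \<Sum>zs\<in>words UNIV n. wt (ber py1) ys * kern ys zs * F zs ys)"
    by (rule sum.swap)
  finally show ?thesis .
qed

text \<open>The cone over the hull, closed upwards in the last coordinate.\<close>

definition cone :: "real \<Rightarrow> real \<Rightarrow> real \<Rightarrow> real \<Rightarrow> bool" where
  "cone c x y z \<longleftrightarrow> 0 \<le> c \<and>
    (\<exists>v\<in>convex hull curve. x = c * fst v \<and> y = c * fst (snd v) \<and> c * snd (snd v) \<le> z)"

lemma cone_curve:
  assumes "0 \<le> c" "0 \<le> t" "t \<le> 1"
  shows "cone c (c * t) (c * bent t) (c * bent (mix t))"
proof -
  have "(t, bent t, bent (mix t)) \<in> convex hull curve"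
    using assms by (intro hull_inc) (auto simp: curve_def)
  thus ?thesis unfolding cone_def using assms(1) by force
qed

lemma cone_mono: "cone c x y z \<Longrightarrow> z \<le> z' \<Longrightarrow> cone c x y z'"
  unfolding cone_def by force

lemma cone_0: "cone 0 0 0 0"
  using cone_curve[of 0 0] by simp

text \<open>Convexity of the hull: the two points are averaged with weights proportional to their
  scales. If both scales are 0, either point will do.\<close>

lemma cone_add:
  assumes "cone c x y z" "cone c' x' y' z'"
  shows "cone (c + c') (x + x') (y + y') (z + z')"
proof -
  obtain v v' where v: "0 \<le> c" "v \<in> convex hull curve" "x = c * fst v" "y = c * fst (snd v)" "c * snd (snd v) \<le> z"
    and v': "0 \<le> c'" "v' \<in> convex hull curve" "x' = c' * fst v'" "y' = c' * fst (snd v')" "c' * snd (snd v') \<le> z'"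
    using assms unfolding cone_def by blast
  show ?thesis
  proof (cases "c + c' = 0")
    case True
    hence "c = 0" "c' = 0" using v(1) v'(1) by linarith+
    thus ?thesis unfolding cone_def using v v' by (intro conjI bexI[of _ v]) auto
  next
    case False
    hence pos: "0 < c + c'" using v(1) v'(1) by linarith
    define u where "u = (c / (c + c')) *\<^sub>R v + (c' / (c + c')) *\<^sub>R v'"
    have "u \<in> convex hull curve" unfolding u_def
      using v v' pos by (intro convexD[OF convex_convex_hull]) (auto simp flip: add_divide_distrib)
    moreover have "(c + c') * fst u = x + x'" "(c + c') * fst (snd u) = y + y'"
      "(c + c') * snd (snd u) = c * snd (snd v) + c' * snd (snd v')"
      using pos v v' by (simp_all add: u_def distrib_left)
    ultimately show ?thesis unfolding cone_def using v v' by (intro conjI bexI[of _ u]) auto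
  qed
qed

lemma cone_sum:
  assumes "finite S" "\<And>s. s \<in> S \<Longrightarrow> cone (c s) (x s) (y s) (z s)"
  shows "cone (\<Sum>s\<in>S. c s) (\<Sum>s\<in>S. x s) (\<Sum>s\<in>S. y s) (\<Sum>s\<in>S. z s)"
  using assms by (induction S rule: finite_induct) (auto intro: cone_0 cone_add)

text \<open>Single-letterisation, by peeling off the first bit of Y1. That bit contributes a
  multiple of a point of \<open>curve\<close>, and its two possible tails fall under the induction
  hypothesis. The entropy of Y1 splits exactly by the chain rule; for Z there is only an inequality,
  which is why \<open>cone\<close> is closed upwards.\<close>

lemma cone_words:
  assumes "\<And>ys. 0 \<le> \<mu> ys"
  shows "cone (n * (\<Sum>ys\<in>words UNIV n. \<mu> ys))
    (\<Sum>ys\<in>words UNIV n. \<mu> ys * sum_list (map of_bool ys))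
    (ent (words UNIV n) \<mu>)
    (ent (words UNIV n) (\<lambda>zs. \<Sum>ys\<in>words UNIV n. \<mu> ys * kern ys zs))"
  using assms
proof (induction n arbitrary: \<mu>)
  case 0
  thus ?case using cone_0 by (simp add: ent_def)
next
  case (Suc n)
  define W where "W = words (UNIV :: bool set) n"
  define c where "c = (\<lambda>b. \<Sum>ys\<in>W. \<mu> (b # ys))"
  define C where "C = c False + c True"
  define t where "t = c True / C"
  define \<nu> where "\<nu> = (\<lambda>b zs. \<Sum>ys\<in>W. \<mu> (b # ys) * kern ys zs)"
  define X where "X = (\<lambda>b. \<Sum>ys\<in>W. \<mu> (b # ys) * sum_list (map of_bool ys))"
  have c0: "0 \<le> c b" for b unfolding c_def by (intro sum_nonneg Suc.prems)
  have C0: "0 \<le> C" unfolding C_def using c0 by simp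
  have t01: "0 \<le> t" "t \<le> 1" using c0[of True] c0[of False] by (auto simp: t_def C_def divide_le_eq_1)
  have Ct: "C * t = c True" using c0[of True] c0[of False] by (auto simp: t_def C_def)
  have \<nu>0: "0 \<le> \<nu> b zs" for b zs unfolding \<nu>_def by (intro sum_nonneg mult_nonneg_nonneg Suc.prems kern_nonneg)
  have \<nu>_sum: "(\<Sum>zs\<in>W. \<nu> b zs) = c b" for b
    unfolding \<nu>_def c_def
    by (subst sum.swap) (simp add: sum_kern length_words W_def flip: sum_distrib_left)
  have IH: "cone (n * c b) (X b) (ent W (\<lambda>ys. \<mu> (b # ys))) (ent W (\<nu> b))" for b
    unfolding X_def c_def \<nu>_def W_def by (intro Suc.IH Suc.prems)
  define \<nu>' where "\<nu>' = (\<lambda>zs. \<Sum>ys\<in>words UNIV (Suc n). \<mu> ys * kern ys zs)"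
  have \<nu>'_Cons: "\<nu>' (z # zs) = ber (post True) z * \<nu> True zs + ber (post False) z * \<nu> False zs" for z zs
    by (simp add: \<nu>'_def sum_words_Suc UNIV_bool \<nu>_def W_def sum_distrib_left mult_ac)
  have \<nu>'0: "0 \<le> \<nu>' zs" for zs
    unfolding \<nu>'_def by (intro sum_nonneg mult_nonneg_nonneg Suc.prems kern_nonneg)
  have \<nu>'_sum: "(\<Sum>zs\<in>W. \<nu>' (z # zs)) = ber (post True) z * c True + ber (post False) z * c False" for z
    by (simp add: \<nu>'_Cons sum.distrib \<nu>_sum flip: sum_distrib_left)
  \<comment> \<open>Given the first bit of Y1, the first bit of Z is independent of the tail of Z.
    Given the first bit of Z instead, the tail therefore follows a mixture of the two laws
    \<open>\<nu> True\<close> and \<open>\<nu> False\<close>, and by concavity its conditional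
    entropy can only grow.\<close>
  have "C * bent (mix t) + (ent W (\<nu> True) + ent W (\<nu> False)) \<le> ent (words UNIV (Suc n)) \<nu>'"
  proof -
    define d where "d = (\<lambda>z. \<Sum>zs\<in>W. \<nu>' (z # zs))"
    have dC: "d False + d True = C"
      by (simp add: d_def \<nu>'_sum C_def ber_def algebra_simps)
    have "C * bent (d True / C) = C * bent (mix t)"
    proof (cases "C = 0")
      case False
      have "d True / C = (post True * c True + post False * c False) / C"
        by (simp add: d_def \<nu>'_sum ber_def)
      also have "\<dots> = t * post True + (c False / C) * post False"
        by (simp add: t_def add_divide_distrib mult.commute)
      also have "c False / C = 1 - t" using False by (simp add: t_def C_def field_simps)
      finally have "d True / C = mix t" by (simp add: mix_def)
      thus ?thesis by simp
    qed simp
    moreover have "ent W (\<nu> True) + ent W (\<nu> False) \<le> (\<Sum>z\<in>UNIV. ent W (\<lambda>zs. \<nu>' (z # zs)))"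
    proof -
      have "ber (post True) z * ent W (\<nu> True) + ber (post False) z * ent W (\<nu> False)
        \<le> ent W (\<lambda>zs. \<nu>' (z # zs))" for z
      proof -
        have b0: "0 \<le> ber (post b) z" for b using post_bounds by (simp add: ber_nonneg)
        have "ber (post True) z * ent W (\<nu> True) + ber (post False) z * ent W (\<nu> False)
          = ent W (\<lambda>zs. ber (post True) z * \<nu> True zs) + ent W (\<lambda>zs. ber (post False) z * \<nu> False zs)"
          by (simp add: ent_scale \<nu>0 b0 W_def)
        also have "\<dots> \<le> ent W (\<lambda>zs. \<nu>' (z # zs))"
          unfolding \<nu>'_Cons by (intro ent_superadditive mult_nonneg_nonneg b0 \<nu>0) (simp add: W_def)
        finally show ?thesis .
      qed
      note le = this
      have "ent W (\<nu> True) + ent W (\<nu> False) =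
        (\<Sum>z\<in>UNIV. ber (post True) z * ent W (\<nu> True) + ber (post False) z * ent W (\<nu> False))"
        by (simp add: sum.distrib flip: sum_distrib_right)
      also have "\<dots> \<le> (\<Sum>z\<in>UNIV. ent W (\<lambda>zs. \<nu>' (z # zs)))" by (intro sum_mono le)
      finally show ?thesis .
    qed
    moreover have "ent (words UNIV (Suc n)) \<nu>' = (\<Sum>z\<in>UNIV. ent W (\<lambda>zs. \<nu>' (z # zs))) + C * bent (d True / C)"
      using ent_words_Suc[of \<nu>' n, OF \<nu>'0] dC by (simp add: d_def W_def)
    ultimately show ?thesis by linarith
  qed
  moreover have "cone (C + (n * c True + n * c False)) (C * t + (X True + X False))
     (C * bent t + (ent W (\<lambda>ys. \<mu> (True # ys)) + ent W (\<lambda>ys. \<mu> (False # ys))))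
     (C * bent (mix t) + (ent W (\<nu> True) + ent W (\<nu> False)))"
    by (intro cone_add cone_curve IH C0 t01)
  ultimately have "cone (C + (n * c True + n * c False)) (C * t + (X True + X False))
     (C * bent t + (ent W (\<lambda>ys. \<mu> (True # ys)) + ent W (\<lambda>ys. \<mu> (False # ys))))
     (ent (words UNIV (Suc n)) \<nu>')"
    using cone_mono by blast
  moreover have "C + (n * c True + n * c False) = real (Suc n) * (\<Sum>ys\<in>words UNIV (Suc n). \<mu> ys)"
    by (simp add: sum_words_Suc UNIV_bool C_def c_def W_def algebra_simps)
  moreover have "C * t + (X True + X False) = (\<Sum>ys\<in>words UNIV (Suc n). \<mu> ys * sum_list (map of_bool ys))"
    unfolding Ct by (simp add: sum_words_Suc UNIV_bool c_def X_def W_def distrib_left sum.distrib)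
  moreover have "C * bent t + (ent W (\<lambda>ys. \<mu> (True # ys)) + ent W (\<lambda>ys. \<mu> (False # ys)))
      = ent (words UNIV (Suc n)) \<mu>"
    using ent_words_Suc[of \<mu> n, OF Suc.prems] by (simp add: UNIV_bool C_def t_def c_def W_def)
  ultimately show ?case unfolding \<nu>'_def by simp
qed

lemma mean_ones: "(\<Sum>ys\<in>words UNIV n. wt (ber q) ys * sum_list (map of_bool ys)) = n * q"
proof (induction n)
  case (Suc n)
  have "(\<Sum>ys\<in>words UNIV (Suc n). wt (ber q) ys * sum_list (map of_bool ys))
    = (\<Sum>b\<in>UNIV. ber q b * of_bool b * (\<Sum>ys\<in>words UNIV n. wt (ber q) ys)
        + ber q b * (\<Sum>ys\<in>words UNIV n. wt (ber q) ys * sum_list (map of_bool ys)))"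
    unfolding sum_words_Suc sum_distrib_left sum.distrib[symmetric]
    by (intro sum.cong refl) (simp add: algebra_simps)
  also have "\<dots> = real (Suc n) * q"
    unfolding Suc sum_wt_ber by (simp add: UNIV_bool ber_def algebra_simps)
  finally show ?case .
qed simp

lemma converse_bound:
  assumes n: "0 < n" and M: "0 < M"
  obtains v where "v \<in> convex hull curve" "fst v = py1" "bent py1 - R0 eps \<le> fst (snd v)"
    "(1 - error_prob p \<delta> eps n M enc relay dec) * log 2 M \<le> n * (1 - snd (snd v)) + 1"
proof -
  define W where "W = words (UNIV :: bool set) n"
  define X where "X = (\<lambda>ys. map (\<lambda>i. relay i (take i ys)) [0..<n])"
  define x where "x = (\<lambda>m. map (enc m) [0..<n])"
  \<comment> \<open>The joint laws of (S, Y1) and of (S, Z) on words of length n. Only the relay map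
    and the noises enter, not the message.\<close>
  define \<mu> where "\<mu> = (\<lambda>s y. wt (ber py1) y * wt (ber eps) (bxor (X y) s))"
  define J where "J = (\<lambda>s z. \<Sum>y\<in>W. \<mu> s y * kern y z)"
  have finW: "finite W" by (simp add: W_def)
  have \<mu>0: "0 \<le> \<mu> s y" for s y
    unfolding \<mu>_def using eps py1_bounds by (simp add: wt_ber_nonneg)
  have J0: "0 \<le> J s z" for s z
    unfolding J_def by (intro sum_nonneg mult_nonneg_nonneg \<mu>0 kern_nonneg)
  have X: "length (X y) = n" for y by (simp add: X_def)
  have sum_\<mu>: "(\<Sum>s\<in>W. \<mu> s y) = wt (ber py1) y" for y
    unfolding \<mu>_def W_def using sum_bxor[OF X, of "wt (ber eps)" y]
    by (simp flip: sum_distrib_left)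
  have sumJ: "(\<Sum>z\<in>W. J s z) = (\<Sum>y\<in>W. \<mu> s y)" for s
    unfolding J_def by (subst sum.swap) (simp add: W_def sum_kern length_words flip: sum_distrib_left)
  have sum_all: "(\<Sum>s\<in>W. \<Sum>y\<in>W. \<mu> s y) = 1"
    by (subst sum.swap) (simp add: sum_\<mu>, simp add: W_def)

  define hit where "hit = (\<lambda>m s z. of_bool (dec (bxor (x m) z) s = m) :: real)"
  have expand: "(\<Sum>zs\<in>W. \<Sum>vs\<in>W. \<Sum>ns\<in>W.
       wt (ber p) zs * wt (ber \<delta>) vs * wt (ber eps) ns * F zs (bxor (X (bxor zs vs)) ns))
     = (\<Sum>s\<in>W. \<Sum>z\<in>W. J s z * F z s)" for F :: "bool list \<Rightarrow> bool list \<Rightarrow> real"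
  proof -
    have "(\<Sum>ns\<in>W. wt (ber eps) ns * F z (bxor (X y) ns)) = (\<Sum>s\<in>W. wt (ber eps) (bxor (X y) s) * F z s)" for z y
      unfolding W_def by (rule sum_bxor'[OF X])
    hence "(\<Sum>zs\<in>W. \<Sum>vs\<in>W. \<Sum>ns\<in>W.
       wt (ber p) zs * wt (ber \<delta>) vs * wt (ber eps) ns * F zs (bxor (X (bxor zs vs)) ns))
     = (\<Sum>zs\<in>W. \<Sum>vs\<in>W. wt (ber p) zs * wt (ber \<delta>) vs *
        (\<Sum>s\<in>W. wt (ber eps) (bxor (X (bxor zs vs)) s) * F zs s))"
      by (simp add: mult.assoc flip: sum_distrib_left)
    also have "\<dots> = (\<Sum>y\<in>W. \<Sum>z\<in>W. wt (ber py1) y * kern y z * (\<Sum>s\<in>W. wt (ber eps) (bxor (X y) s) * F z s))"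
      unfolding W_def by (rule sum_noise_change)
    also have "\<dots> = (\<Sum>y\<in>W. \<Sum>z\<in>W. \<Sum>s\<in>W. \<mu> s y * kern y z * F z s)"
      by (simp add: \<mu>_def sum_distrib_left mult_ac)
    also have "\<dots> = (\<Sum>z\<in>W. \<Sum>s\<in>W. \<Sum>y\<in>W. \<mu> s y * kern y z * F z s)"
      by (subst sum.swap) (intro sum.cong refl sum.swap)
    also have "\<dots> = (\<Sum>s\<in>W. \<Sum>z\<in>W. J s z * F z s)"
      by (subst sum.swap) (simp add: J_def sum_distrib_right)
    finally show ?thesis .
  qed
  have "error_prob p \<delta> eps n M enc relay dec = (1 / M) * (\<Sum>m<M. \<Sum>s\<in>W. \<Sum>z\<in>W. J s z * (1 - hit m s z))"
  proof -
    have "1 - hit m s z = of_bool (dec (bxor (x m) z) s \<noteq> m)" for m s z by (simp add: hit_def)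
    moreover have "map (enc m) [0..<n] = x m" "map (\<lambda>i. relay i (take i ys)) [0..<n] = X ys" for m ys
      by (simp_all add: x_def X_def)
    ultimately show ?thesis
      unfolding error_prob_bxor W_def[symmetric] 
      by (simp only: expand[of "\<lambda>z s. of_bool (dec (bxor (x m) z) s \<noteq> m)" for m])
  qed
  also have "\<dots> = (1 / M) * (\<Sum>m<M. 1 - (\<Sum>s\<in>W. \<Sum>z\<in>W. J s z * hit m s z))"
    using sum_all sumJ by (simp add: right_diff_distrib sum_subtractf)
  also have "\<dots> = 1 - (1 / M) * (\<Sum>m<M. \<Sum>s\<in>W. \<Sum>z\<in>W. J s z * hit m s z)"
    using M by (simp add: sum_subtractf right_diff_distrib)
  finally have succ: "(1 - error_prob p \<delta> eps n M enc relay dec) * log 2 M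
      = log 2 M / M * (\<Sum>m<M. \<Sum>s\<in>W. \<Sum>z\<in>W. J s z * hit m s z)" by simp
  \<comment> \<open>For fixed s the decoder is a function of the other received word alone, so the
    Fano bound applies to each slice \<open>J s\<close>.\<close>
  have "(\<Sum>s\<in>W. ent W (J s)) \<le> (\<Sum>s\<in>W. (\<Sum>z\<in>W. J s z) * (n + 1)
      - log 2 M / M * (\<Sum>m<M. \<Sum>z\<in>W. J s z * hit m s z))"
  proof (intro sum_mono)
    fix s
    have "length (x m) = n" for m by (simp add: x_def)
    hence "ent W (J s) \<le> (\<Sum>z\<in>W. J s z) * (real n + 1) - log 2 M / M *
        (\<Sum>m<M. \<Sum>z\<in>W. J s z * of_bool ((\<lambda>y. dec y s) (bxor (x m) z) = m))"
      unfolding W_def by (intro fano_additive J0 M)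
    thus
      "ent W (J s) \<le> (\<Sum>z\<in>W. J s z) * (n + 1)
      - log 2 M / M * (\<Sum>m<M. \<Sum>z\<in>W. J s z * hit m s z)"
      by (simp only: hit_def of_nat_add of_nat_1)
  qed
  also have "\<dots> = n + 1 - log 2 M / M * (\<Sum>m<M. \<Sum>s\<in>W. \<Sum>z\<in>W. J s z * hit m s z)"
  proof -
    have "(\<Sum>s\<in>W. (\<Sum>z\<in>W. J s z) * (real n + 1)) = (\<Sum>s\<in>W. \<Sum>y\<in>W. \<mu> s y) * (real n + 1)"
      by (simp only: sumJ sum_distrib_right)
    moreover have "(\<Sum>s\<in>W. log 2 M / M * (\<Sum>m<M. \<Sum>z\<in>W. J s z * hit m s z))
      = log 2 M / M * (\<Sum>m<M. \<Sum>s\<in>W. \<Sum>z\<in>W. J s z * hit m s z)"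
      by (subst sum.swap) (simp only: sum_distrib_left)
    ultimately show ?thesis by (simp only: sum_subtractf sum_all of_nat_add of_nat_1 mult_1_left)
  qed
  finally have fano: "(1 - error_prob p \<delta> eps n M enc relay dec) * log 2 M \<le> n + 1 - (\<Sum>s\<in>W. ent W (J s))"
    using succ by simp

  have "cone (\<Sum>s\<in>W. n * (\<Sum>y\<in>W. \<mu> s y)) (\<Sum>s\<in>W. \<Sum>y\<in>W. \<mu> s y * sum_list (map of_bool y))
    (\<Sum>s\<in>W. ent W (\<mu> s)) (\<Sum>s\<in>W. ent W (J s))"
    unfolding J_def W_def by (intro cone_sum cone_words \<mu>0) simp
  moreover have "(\<Sum>s\<in>W. n * (\<Sum>y\<in>W. \<mu> s y)) = n" using sum_all by (simp flip: sum_distrib_left)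
  moreover have "(\<Sum>s\<in>W. \<Sum>y\<in>W. \<mu> s y * sum_list (map of_bool y)) = n * py1"
    by (subst sum.swap) (simp add: sum_\<mu> flip: sum_distrib_right, simp add: W_def mean_ones)
  ultimately have "cone n (n * py1) (\<Sum>s\<in>W. ent W (\<mu> s)) (\<Sum>s\<in>W. ent W (J s))" by simp
  then obtain v :: "real \<times> real \<times> real" where v: "v \<in> convex hull curve" "n * py1 = n * fst v"
    "(\<Sum>s\<in>W. ent W (\<mu> s)) = n * fst (snd v)" "n * snd (snd v) \<le> (\<Sum>s\<in>W. ent W (J s))"
    unfolding cone_def by blast

  \<comment> \<open>Given Y1, the word S is the link noise shifted by a fixed relay word, so the
    joint entropy is \<open>n * bent eps + n * bent py1\<close>. Subtracting the entropy of S, which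
    is at most n, bounds H(Y1 | S) from below.\<close>
  have "(\<Sum>s\<in>W. \<Sum>y\<in>W. eta (\<mu> s y)) = (\<Sum>y\<in>W. \<Sum>s\<in>W. eta (\<mu> s y))" by (rule sum.swap)
  also have "\<dots> = (\<Sum>y\<in>W. wt (ber py1) y * (\<Sum>s\<in>W. eta (wt (ber eps) (bxor (X y) s)))
      + (\<Sum>s\<in>W. wt (ber eps) (bxor (X y) s)) * eta (wt (ber py1) y))"
    using eps py1_bounds by (simp add: \<mu>_def eta_mult wt_ber_nonneg sum.distrib
        sum_distrib_left sum_distrib_right)
  also have "\<dots> = (\<Sum>y\<in>W. wt (ber py1) y * (n * bent eps) + eta (wt (ber py1) y))"
    unfolding W_def sum_bxor[OF X, of "wt (ber eps)"] sum_bxor[OF X, of "\<lambda>s. eta (wt (ber eps) s)"]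
    using eps by (simp add: sum_eta_wt_ber)
  also have "\<dots> = n * bent eps + n * bent py1"
    using py1_bounds by (simp add: sum.distrib W_def sum_eta_wt_ber flip: sum_distrib_right)
  finally have "(\<Sum>s\<in>W. ent W (\<mu> s)) = n * bent eps + n * bent py1 - (\<Sum>s\<in>W. eta (\<Sum>y\<in>W. \<mu> s y))"
    by (simp add: ent_def sum_subtractf)
  moreover have "(\<Sum>s\<in>W. eta (\<Sum>y\<in>W. \<mu> s y)) \<le> n"
  proof -
    have "ent W (\<lambda>s. \<Sum>y\<in>W. \<mu> s y) \<le> (\<Sum>s\<in>W. \<Sum>y\<in>W. \<mu> s y) * log 2 (card W)"
      using X[of "[]"] by (intro ent_le_log_card finW sum_nonneg \<mu>0) (auto simp: W_def words_def)
    thus ?thesis by (simp add: ent_def sum_all) (simp add: W_def card_words_bool log_nat_power)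
  qed
  ultimately have "real n * (bent py1 - R0 eps) \<le> n * fst (snd v)"
    using v(3) eps by (simp add: R0_eq algebra_simps)
  hence "bent py1 - R0 eps \<le> fst (snd v)" using n by simp
  moreover have "(1 - error_prob p \<delta> eps n M enc relay dec) * log 2 M \<le> n * (1 - snd (snd v)) + 1"
    using fano v(4) by (simp add: algebra_simps)
  ultimately show thesis using that v(1,2) n by simp
qed

end

section \<open>One-shot coding lemmas\<close>

lemma exists_le_average:
  fixes F w :: "'a \<Rightarrow> real"
  assumes fin: "finite U" and w0: "\<And>u. u \<in> U \<Longrightarrow> 0 \<le> w u" and w1: "(\<Sum>u\<in>U. w u) = 1"
  shows "\<exists>u\<in>U. F u \<le> (\<Sum>u\<in>U. w u * F u)"
proof (rule ccontr)
  define m where "m = (\<Sum>u\<in>U. w u * F u)"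
  assume "\<not> ?thesis"
  hence F: "m < F u" if "u \<in> U" for u using that by (auto simp: m_def)
  have "(\<Sum>u\<in>U. w u * (F u - m)) = 0"
    using w1 by (simp add: right_diff_distrib sum_subtractf m_def flip: sum_distrib_right)
  hence "\<forall>u\<in>U. w u * (F u - m) = 0"
    using fin by (subst sum_nonneg_eq_0_iff[symmetric]) (use w0 F in \<open>simp_all add: less_imp_le\<close>)
  hence "\<forall>u\<in>U. w u = 0" using F by force
  thus False using w1 by simp
qed

section \<open>Channel codes for additive noise\<close>

lemma sum_pairs_weight:
  fixes \<pi> :: "nat \<Rightarrow> real"
  shows "(\<Sum>j<M. \<Sum>i<j. \<pi> i + \<pi> j) = (real M - 1) * (\<Sum>j<M. \<pi> j)"
proof (induction M)
  case (Suc M)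
  have "(\<Sum>i<M. \<pi> i + \<pi> M) = (\<Sum>i<M. \<pi> i) + M * \<pi> M" by (simp add: sum.distrib)
  thus ?case unfolding sum.lessThan_Suc Suc by (simp add: algebra_simps)
qed simp

text \<open>Each unordered pair collects the weights of both its messages. Booking it to the later
  index is the form that a sequential choice of codewords can control.\<close>

lemma sum_pairs_symmetric:
  fixes \<pi> :: "nat \<Rightarrow> real"
  assumes "\<And>i j. c i j = c j i"
  shows "(\<Sum>j<M. \<pi> j * (\<Sum>i<M. of_bool (i \<noteq> j) * c j i)) = (\<Sum>j<M. \<Sum>i<j. (\<pi> i + \<pi> j) * c i j)"
proof (induction M)
  case (Suc M)
  have "(\<Sum>i<Suc M. of_bool (i \<noteq> j) * c j i) = (\<Sum>i<M. of_bool (i \<noteq> j) * c j i) + c j M" if "j < M" for j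
    using that by simp
  moreover have "(\<Sum>i<Suc M. of_bool (i \<noteq> M) * c M i) = (\<Sum>i<M. c M i)"
    by (simp cong: sum.cong_simp)
  ultimately have "(\<Sum>j<Suc M. \<pi> j * (\<Sum>i<Suc M. of_bool (i \<noteq> j) * c j i))
    = (\<Sum>j<M. \<pi> j * (\<Sum>i<M. of_bool (i \<noteq> j) * c j i)) + (\<Sum>j<M. \<pi> j * c j M) + \<pi> M * (\<Sum>i<M. c M i)"
    by (subst sum.lessThan_Suc) (simp add: distrib_left sum.distrib del: sum.lessThan_Suc)
  also have "\<pi> M * (\<Sum>i<M. c M i) = (\<Sum>i<M. \<pi> M * c i M)"
    using assms[of M] by (simp add: sum_distrib_left)
  finally show ?case unfolding Suc by (simp add: distrib_right sum.distrib)
qed simp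

text \<open>Both sides are the sum of the same three words; hence the collision cost of two
  codewords is symmetric.\<close>

lemma bxor_bxor_swap:
  assumes "length a = n" "length b = n" "length c = n"
  shows "bxor (bxor a b) c = bxor (bxor c b) a"
proof -
  have "length a = length b \<Longrightarrow> length b = length c \<Longrightarrow> bxor (bxor a b) c = bxor (bxor c b) a"
    by (induction a b c rule: list_induct3) auto
  thus ?thesis using assms by simp
qed

lemma bxor_bxor_self:
  assumes "length a = n" "length b = n"
  shows "bxor (bxor a b) a = b"
proof -
  have "length a = length b \<Longrightarrow> bxor (bxor a b) a = b"
    by (induction a b rule: list_induct2) auto
  thus ?thesis using assms by simp
qed

text \<open>Codewords are chosen one after the other, each with at most average collision cost against
  the earlier ones; this suffices because the cost of a pair is symmetric.\<close>

lemma additive_channel_coding: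
  fixes \<Omega> :: "'o set" and w :: "'o \<Rightarrow> real" and z :: "'o \<Rightarrow> bool list" and s :: "'o \<Rightarrow> 's"
    and T :: "bool list \<Rightarrow> 's \<Rightarrow> bool" and \<pi> :: "nat \<Rightarrow> real"
  assumes fin: "finite \<Omega>" and w0: "\<And>\<omega>. \<omega> \<in> \<Omega> \<Longrightarrow> 0 \<le> w \<omega>" and w1: "(\<Sum>\<omega>\<in>\<Omega>. w \<omega>) = 1"
    and z: "\<And>\<omega>. \<omega> \<in> \<Omega> \<Longrightarrow> length (z \<omega>) = N"
    and T: "\<And>\<omega>. \<omega> \<in> \<Omega> \<Longrightarrow> real (card {zs\<in>words UNIV N. T zs (s \<omega>)}) \<le> L"
    and \<pi>0: "\<And>j. 0 \<le> \<pi> j" and \<pi>1: "(\<Sum>j<M. \<pi> j) = 1"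
  obtains x dec where "\<And>j. length (x j) = N"
    "(\<Sum>j<M. \<pi> j * (\<Sum>\<omega>\<in>\<Omega>. w \<omega> * of_bool (dec (bxor (x j) (z \<omega>)) (s \<omega>) \<noteq> j)))
      \<le> (\<Sum>\<omega>\<in>\<Omega>. w \<omega> * of_bool (\<not> T (z \<omega>) (s \<omega>))) + M * L / 2 ^ N"
proof -
  define W where "W = words (UNIV :: bool set) N"
  \<comment> \<open>The probability that \<open>b\<close> passes the decoding test although
    \<open>a\<close> was sent: the residual of the received word against \<open>b\<close> is
    accepted as noise.\<close>
  define c where "c = (\<lambda>a b. \<Sum>\<omega>\<in>\<Omega>. w \<omega> * of_bool (T (bxor (bxor a (z \<omega>)) b) (s \<omega>)))"
  have "\<Omega> \<noteq> {}" using w1 by auto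
  hence L0: "0 \<le> L" using T by (meson all_not_in_conv of_nat_0_le_iff order_trans)
  have c_sym: "c a b = c b a" if "length a = N" "length b = N" for a b
    unfolding c_def using bxor_bxor_swap that z by (intro sum.cong refl) metis
  have c_avg: "(\<Sum>b\<in>W. c a b) \<le> L" if "length a = N" for a
  proof -
    have "(\<Sum>b\<in>W. c a b) = (\<Sum>\<omega>\<in>\<Omega>. w \<omega> * (\<Sum>b\<in>W. of_bool (T (bxor (bxor a (z \<omega>)) b) (s \<omega>))))"
      unfolding c_def by (subst sum.swap) (simp add: sum_distrib_left del: sum_of_bool_eq sum_mult_of_bool_eq)
    also have "\<dots> = (\<Sum>\<omega>\<in>\<Omega>. w \<omega> * (\<Sum>b\<in>W. of_bool (T b (s \<omega>))))"
      unfolding W_def using that z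
      by (intro sum.cong refl arg_cong2[where f = "(*)"] sum_bxor) simp
    also have "\<dots> \<le> (\<Sum>\<omega>\<in>\<Omega>. w \<omega> * L)"
    proof (intro sum_mono mult_left_mono w0)
      fix \<omega> assume "\<omega> \<in> \<Omega>"
      thus "(\<Sum>b\<in>W. of_bool (T b (s \<omega>))) \<le> L"
        using T[of \<omega>] by (simp add: W_def Int_def)
    qed
    also have "\<dots> = L" by (simp add: w1 flip: sum_distrib_right)
    finally show ?thesis .
  qed
  have "\<exists>x. (\<forall>j. length (x j) = N) \<and>
      (\<Sum>j<M. \<Sum>i<j. (\<pi> i + \<pi> j) * c (x i) (x j)) \<le> (\<Sum>j<M. \<Sum>i<j. \<pi> i + \<pi> j) * (L / 2 ^ N)" for M
  proof (induction M)
    case 0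
    show ?case by (auto intro: exI[of _ "\<lambda>_. replicate N False"])
  next
    case (Suc M)
    then obtain x where x: "\<And>j. length (x j) = N"
      and le: "(\<Sum>j<M. \<Sum>i<j. (\<pi> i + \<pi> j) * c (x i) (x j)) \<le> (\<Sum>j<M. \<Sum>i<j. \<pi> i + \<pi> j) * (L / 2 ^ N)"
      by blast
    define F where "F = (\<lambda>b. \<Sum>i<M. (\<pi> i + \<pi> M) * c (x i) b)"
    \<comment> \<open>For uniform b every residual is uniform, hence accepted with probability at
      most \<open>L / 2 ^ N\<close>; some b does no worse than the average.\<close>
    have "\<exists>b\<in>W. F b \<le> (\<Sum>b\<in>W. (1 / 2 ^ N) * F b)"
      by (rule exists_le_average) (auto simp: W_def card_words_bool)
    then obtain b where b: "b \<in> W" "F b \<le> (\<Sum>b\<in>W. (1 / 2 ^ N) * F b)" by blast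
    have "(\<Sum>b\<in>W. (1 / 2 ^ N) * F b) = (1 / 2 ^ N) * (\<Sum>i<M. (\<pi> i + \<pi> M) * (\<Sum>b\<in>W. c (x i) b))"
      unfolding F_def sum_distrib_left by (rule sum.swap)
    also have "\<dots> \<le> (1 / 2 ^ N) * (\<Sum>i<M. (\<pi> i + \<pi> M) * L)"
      using c_avg x \<pi>0 by (intro mult_left_mono sum_mono) auto
    also have "\<dots> = (\<Sum>i<M. \<pi> i + \<pi> M) * (L / 2 ^ N)" by (simp flip: sum_distrib_right)
    finally have Fb: "F b \<le> (\<Sum>i<M. \<pi> i + \<pi> M) * (L / 2 ^ N)" using b by simp
    define x' where "x' = x(M := b)"
    have "(\<Sum>j<Suc M. \<Sum>i<j. (\<pi> i + \<pi> j) * c (x' i) (x' j))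
      = (\<Sum>j<M. \<Sum>i<j. (\<pi> i + \<pi> j) * c (x i) (x j)) + F b"
      by (simp add: x'_def F_def)
    also have "\<dots> \<le> (\<Sum>j<M. \<Sum>i<j. \<pi> i + \<pi> j) * (L / 2 ^ N) + (\<Sum>i<M. \<pi> i + \<pi> M) * (L / 2 ^ N)"
      by (intro add_mono le Fb)
    also have "\<dots> = (\<Sum>j<Suc M. \<Sum>i<j. \<pi> i + \<pi> j) * (L / 2 ^ N)"
      by (simp only: sum.lessThan_Suc distrib_right)
    finally show ?case using x b(1) by (intro exI[of _ x']) (auto simp: x'_def W_def words_def)
  qed
  then obtain x where x: "\<And>j. length (x j) = N"
    and le: "(\<Sum>j<M. \<Sum>i<j. (\<pi> i + \<pi> j) * c (x i) (x j)) \<le> (\<Sum>j<M. \<Sum>i<j. \<pi> i + \<pi> j) * (L / 2 ^ N)"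
    by blast
  define dec where "dec = (\<lambda>y s. SOME i. i < M \<and> T (bxor y (x i)) s)"
  have dec: "of_bool (dec (bxor (x j) (z \<omega>)) (s \<omega>) \<noteq> j) \<le> of_bool (\<not> T (z \<omega>) (s \<omega>))
      + (\<Sum>i<M. of_bool (i \<noteq> j) * of_bool (T (bxor (bxor (x j) (z \<omega>)) (x i)) (s \<omega>)) :: real)"
    if "\<omega> \<in> \<Omega>" "j < M" for \<omega> j
  proof (cases "T (z \<omega>) (s \<omega>) \<and> (\<forall>i<M. i \<noteq> j \<longrightarrow> \<not> T (bxor (bxor (x j) (z \<omega>)) (x i)) (s \<omega>))")
    case True
    have "T (bxor (bxor (x j) (z \<omega>)) (x j)) (s \<omega>)"
      using True bxor_bxor_self[OF x z[OF that(1)]] by simp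
    hence "dec (bxor (x j) (z \<omega>)) (s \<omega>) = j"
      unfolding dec_def using True that(2) by (intro some_equality) auto
    thus ?thesis by (simp add: sum_nonneg)
  next
    case False
    show ?thesis
    proof (cases "T (z \<omega>) (s \<omega>)")
      case True
      then obtain i where i: "i < M" "i \<noteq> j" "T (bxor (bxor (x j) (z \<omega>)) (x i)) (s \<omega>)" using False by blast
      hence "(1::real) = of_bool (i \<noteq> j) * of_bool (T (bxor (bxor (x j) (z \<omega>)) (x i)) (s \<omega>))" by simp
      also have "\<dots> \<le> (\<Sum>i<M. of_bool (i \<noteq> j) * of_bool (T (bxor (bxor (x j) (z \<omega>)) (x i)) (s \<omega>)))"
        using i by (intro member_le_sum) auto
      finally have "1 \<le> (\<Sum>i<M. of_bool (i \<noteq> j) * of_bool (T (bxor (bxor (x j) (z \<omega>)) (x i)) (s \<omega>)) :: real)" .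
      thus ?thesis using True by simp
    next
      case False
      have "0 \<le> (\<Sum>i<M. of_bool (i \<noteq> j) * of_bool (T (bxor (bxor (x j) (z \<omega>)) (x i)) (s \<omega>)) :: real)"
        by (intro sum_nonneg) auto
      thus ?thesis using False by simp
    qed
  qed
  have "(\<Sum>j<M. \<pi> j * (\<Sum>\<omega>\<in>\<Omega>. w \<omega> * of_bool (dec (bxor (x j) (z \<omega>)) (s \<omega>) \<noteq> j)))
    \<le> (\<Sum>j<M. \<pi> j * ((\<Sum>\<omega>\<in>\<Omega>. w \<omega> * of_bool (\<not> T (z \<omega>) (s \<omega>))) + (\<Sum>i<M. of_bool (i \<noteq> j) * c (x j) (x i))))"
  proof (intro sum_mono mult_left_mono \<pi>0)
    fix j assume "j \<in> {..<M}"
    hence j: "j < M" by simp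
    have "(\<Sum>\<omega>\<in>\<Omega>. w \<omega> * of_bool (dec (bxor (x j) (z \<omega>)) (s \<omega>) \<noteq> j))
      \<le> (\<Sum>\<omega>\<in>\<Omega>. w \<omega> * (of_bool (\<not> T (z \<omega>) (s \<omega>))
      + (\<Sum>i<M. of_bool (i \<noteq> j) * of_bool (T (bxor (bxor (x j) (z \<omega>)) (x i)) (s \<omega>)))))"
      by (intro sum_mono mult_left_mono dec j w0)
    also have "\<dots> = (\<Sum>\<omega>\<in>\<Omega>. w \<omega> * of_bool (\<not> T (z \<omega>) (s \<omega>)))
      + (\<Sum>\<omega>\<in>\<Omega>. \<Sum>i<M. w \<omega> * (of_bool (i \<noteq> j) * of_bool (T (bxor (bxor (x j) (z \<omega>)) (x i)) (s \<omega>))))"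
      by (simp only: distrib_left sum.distrib sum_distrib_left)
    also have "(\<Sum>\<omega>\<in>\<Omega>. \<Sum>i<M. w \<omega> * (of_bool (i \<noteq> j) * of_bool (T (bxor (bxor (x j) (z \<omega>)) (x i)) (s \<omega>))))
      = (\<Sum>i<M. of_bool (i \<noteq> j) * c (x j) (x i))"
      unfolding c_def sum_distrib_left by (subst sum.swap) (simp only: mult_ac)
    finally show "(\<Sum>\<omega>\<in>\<Omega>. w \<omega> * of_bool (dec (bxor (x j) (z \<omega>)) (s \<omega>) \<noteq> j))
      \<le> (\<Sum>\<omega>\<in>\<Omega>. w \<omega> * of_bool (\<not> T (z \<omega>) (s \<omega>))) + (\<Sum>i<M. of_bool (i \<noteq> j) * c (x j) (x i))" .
  qed
  also have "\<dots> = (\<Sum>\<omega>\<in>\<Omega>. w \<omega> * of_bool (\<not> T (z \<omega>) (s \<omega>)))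
      + (\<Sum>j<M. \<pi> j * (\<Sum>i<M. of_bool (i \<noteq> j) * c (x j) (x i)))"
    by (simp only: distrib_left sum.distrib sum_distrib_right[symmetric] \<pi>1 mult_1_left)
  also have "(\<Sum>j<M. \<pi> j * (\<Sum>i<M. of_bool (i \<noteq> j) * c (x j) (x i))) \<le> M * L / 2 ^ N"
  proof -
    have "(\<Sum>j<M. \<pi> j * (\<Sum>i<M. of_bool (i \<noteq> j) * c (x j) (x i)))
        = (\<Sum>j<M. \<Sum>i<j. (\<pi> i + \<pi> j) * c (x i) (x j))"
      by (rule sum_pairs_symmetric) (rule c_sym[OF x x])
    \<comment> \<open>The total weight of all pairs is \<open>M - 1\<close>, because each index lies
      in that many pairs and \<open>\<pi>\<close> sums to one.\<close>
    also have "\<dots> \<le> (real M - 1) * (L / 2 ^ N)"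
      using le by (simp add: sum_pairs_weight \<pi>1)
    also have "\<dots> \<le> M * L / 2 ^ N" using L0 by (simp add: divide_right_mono left_diff_distrib)
    finally show ?thesis .
  qed
  finally show thesis by (intro that[OF x]) simp
qed

text \<open>The chord of the convex function \<open>exp\<close> between 0 and -k. In the covering
  argument b is the conditional probability of a good pair, and the two terms separate bad pairs
  from too small a number of trials.\<close>

lemma exp_neg_convex_bound:
  fixes b k :: real
  assumes "0 \<le> b" "b \<le> 1"
  shows "exp (- (k * b)) \<le> 1 - b + exp (- k)"
proof -
  have *: "exp ((1 - b) *\<^sub>R 0 + b *\<^sub>R (- k)) \<le> (1 - b) * exp 0 + b * exp (- k)"
    using assms by (intro convex_onD[OF exp_convex]) auto
  have "exp (- (k * b)) \<le> 1 - b + b * exp (- k)" using * by (simp add: mult.commute)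
  also have "\<dots> \<le> 1 - b + 1 * exp (- k)"
    using assms by (intro add_left_mono mult_right_mono) auto
  finally show ?thesis by simp
qed

text \<open>Greedy version of random covering: each new \<open>u\<close> is chosen to be at least as good as an average one.\<close>

lemma covering:
  fixes Y :: "'y set" and U :: "'u set" and J :: "'y \<Rightarrow> 'u \<Rightarrow> real" and PU :: "'u \<Rightarrow> real"
    and K :: nat
  defines "PY \<equiv> (\<lambda>y. \<Sum>u\<in>U. J y u)"
  assumes finU: "finite U"
    and J0: "\<And>y u. y \<in> Y \<Longrightarrow> u \<in> U \<Longrightarrow> 0 \<le> J y u"
    and PY1: "(\<Sum>y\<in>Y. PY y) = 1"
    and PU0: "\<And>u. u \<in> U \<Longrightarrow> 0 \<le> PU u" and PU1: "(\<Sum>u\<in>U. PU u) = 1"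
    and A: "\<And>y u. y \<in> Y \<Longrightarrow> u \<in> U \<Longrightarrow> A y u \<Longrightarrow> J y u \<le> \<tau> * (PU u * PY y)" and \<tau>: "0 < \<tau>"
  obtains us where "\<And>j. j < K \<Longrightarrow> us j \<in> U"
    "(\<Sum>y\<in>Y. PY y * of_bool (\<forall>j<K. \<not> A y (us j)))
      \<le> (\<Sum>y\<in>Y. \<Sum>u\<in>U. J y u * of_bool (\<not> A y u)) + exp (- (K / \<tau>))"
proof -
  define a where "a = (\<lambda>y. \<Sum>u\<in>U. PU u * of_bool (A y u))"
  have PY0: "0 \<le> PY y" if "y \<in> Y" for y unfolding PY_def using J0 that by (intro sum_nonneg) auto
  have a_le: "a y \<le> 1" for y
  proof -
    have "a y \<le> (\<Sum>u\<in>U. PU u * 1)" unfolding a_def by (intro sum_mono mult_left_mono PU0) auto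
    thus ?thesis by (simp add: PU1)
  qed
  have a_compl: "(\<Sum>u\<in>U. PU u * of_bool (\<not> A y u)) = 1 - a y" for y
    unfolding a_def PU1[symmetric] sum_subtractf[symmetric] by (intro sum.cong refl) auto
  \<comment> \<open>The weights \<open>\<psi>\<close> are arbitrary because the induction step
    restricts them to those y that the newly chosen u misses.\<close>
  have "\<exists>us. (\<forall>j<K. us j \<in> U) \<and>
    (\<Sum>y\<in>Y. \<psi> y * of_bool (\<forall>j<K. \<not> A y (us j))) \<le> (\<Sum>y\<in>Y. \<psi> y * (1 - a y) ^ K)" for K and \<psi> :: "'y \<Rightarrow> real"
  proof (induction K arbitrary: \<psi>)
    case 0
    show ?case by simp
  next
    case (Suc K)
    define F where "F = (\<lambda>u. \<Sum>y\<in>Y. \<psi> y * of_bool (\<not> A y u) * (1 - a y) ^ K)"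
    obtain u0 where u0: "u0 \<in> U" "F u0 \<le> (\<Sum>u\<in>U. PU u * F u)"
      using exists_le_average[of U PU F] finU PU0 PU1 by blast
    have "(\<Sum>u\<in>U. PU u * F u) = (\<Sum>y\<in>Y. (\<psi> y * (1 - a y) ^ K) * (\<Sum>u\<in>U. PU u * of_bool (\<not> A y u)))"
      unfolding F_def sum_distrib_left by (subst sum.swap) (simp only: mult_ac)
    also have "\<dots> = (\<Sum>y\<in>Y. \<psi> y * (1 - a y) ^ Suc K)" unfolding a_compl by (simp add: mult_ac)
    finally have F0: "F u0 \<le> (\<Sum>y\<in>Y. \<psi> y * (1 - a y) ^ Suc K)" using u0 by simp
    obtain us where us: "\<forall>j<K. us j \<in> U"
      "(\<Sum>y\<in>Y. (\<psi> y * of_bool (\<not> A y u0)) * of_bool (\<forall>j<K. \<not> A y (us j))) \<le> F u0"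
      using Suc.IH[of "\<lambda>y. \<psi> y * of_bool (\<not> A y u0)"] unfolding F_def by blast
    define us' where "us' = us(K := u0)"
    have "(\<forall>j<Suc K. \<not> A y (us' j)) \<longleftrightarrow> \<not> A y u0 \<and> (\<forall>j<K. \<not> A y (us j))" for y
      by (auto simp: us'_def less_Suc_eq)
    hence "(\<Sum>y\<in>Y. \<psi> y * of_bool (\<forall>j<Suc K. \<not> A y (us' j)))
      = (\<Sum>y\<in>Y. (\<psi> y * of_bool (\<not> A y u0)) * of_bool (\<forall>j<K. \<not> A y (us j)))"
      by (simp only: of_bool_conj mult.assoc)
    also have "\<dots> \<le> (\<Sum>y\<in>Y. \<psi> y * (1 - a y) ^ Suc K)" using us(2) F0 by linarith
    finally show ?case using us(1) u0(1) by (intro exI[of _ us']) (auto simp: us'_def less_Suc_eq)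
  qed
  then obtain us where us: "\<forall>j<K. us j \<in> U"
    "(\<Sum>y\<in>Y. PY y * of_bool (\<forall>j<K. \<not> A y (us j))) \<le> (\<Sum>y\<in>Y. PY y * (1 - a y) ^ K)" by blast
  have "PY y * (1 - a y) ^ K \<le> (\<Sum>u\<in>U. J y u * of_bool (\<not> A y u)) + PY y * exp (- (K / \<tau>))"
    if y: "y \<in> Y" for y
  proof (cases "PY y = 0")
    case True
    thus ?thesis using J0[OF y] by (auto intro!: sum_nonneg)
  next
    case False
    hence PYy: "0 < PY y" using PY0[OF y] by simp
    \<comment> \<open>\<open>b\<close> is the probability of a good pair given y under the joint
      law, \<open>a y\<close> the one for an independent u. On good pairs the joint law is at most
      \<open>\<tau>\<close> times the product law, so \<open>b \<le> \<tau> * a y\<close>.\<close>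
    define b where "b = (\<Sum>u\<in>U. J y u * of_bool (A y u)) / PY y"
    have comp: "PY y * (1 - b) = (\<Sum>u\<in>U. J y u * of_bool (\<not> A y u))"
    proof -
      have "PY y * (1 - b) = PY y - (\<Sum>u\<in>U. J y u * of_bool (A y u))"
        using PYy by (simp add: b_def algebra_simps)
      also have "\<dots> = (\<Sum>u\<in>U. J y u * of_bool (\<not> A y u))"
        unfolding PY_def sum_subtractf[symmetric] by (intro sum.cong refl) auto
      finally show ?thesis .
    qed
    have b0: "0 \<le> b" unfolding b_def using J0[OF y] PYy by (intro divide_nonneg_pos sum_nonneg) auto
    have "0 \<le> PY y * (1 - b)" unfolding comp using J0[OF y] by (intro sum_nonneg) auto
    hence b1: "b \<le> 1" using PYy by (simp add: zero_le_mult_iff)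
    have "(\<Sum>u\<in>U. J y u * of_bool (A y u)) \<le> (\<Sum>u\<in>U. \<tau> * PY y * (PU u * of_bool (A y u)))"
      using A[OF y] by (intro sum_mono) (auto simp: mult_ac)
    hence "b \<le> \<tau> * a y"
      using PYy by (simp only: b_def a_def sum_distrib_left[symmetric]) (simp add: field_simps)
    hence ba: "b / \<tau> \<le> a y" using \<tau> by (simp add: field_simps)
    have "(1 - a y) ^ K \<le> exp (- a y) ^ K"
      using a_le[of y] exp_ge_add_one_self[of "- a y"] by (intro power_mono) auto
    also have "\<dots> = exp (- (K * a y))" by (simp flip: exp_of_nat_mult)
    also have "\<dots> \<le> exp (- (K * (b / \<tau>)))"
      using mult_left_mono[OF ba, of "real K"] by simp
    also have "\<dots> = exp (- (K / \<tau> * b))" by simp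
    also have "\<dots> \<le> 1 - b + exp (- (K / \<tau>))" by (rule exp_neg_convex_bound[OF b0 b1])
    finally have "PY y * (1 - a y) ^ K \<le> PY y * (1 - b + exp (- (K / \<tau>)))"
      using PYy by (intro mult_left_mono) auto
    thus ?thesis by (simp add: comp[symmetric] distrib_left)
  qed
  hence "(\<Sum>y\<in>Y. PY y * (1 - a y) ^ K) \<le> (\<Sum>y\<in>Y. (\<Sum>u\<in>U. J y u * of_bool (\<not> A y u)) + PY y * exp (- (K / \<tau>)))"
    by (rule sum_mono)
  also have "\<dots> = (\<Sum>y\<in>Y. \<Sum>u\<in>U. J y u * of_bool (\<not> A y u)) + exp (- (K / \<tau>))"
    by (simp only: sum.distrib sum_distrib_right[symmetric] PY1 mult_1_left)
  finally show thesis using that us by (meson order_trans)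
qed

section \<open>Counting likely words, and coding for the relay link\<close>

lemma sum_list_le_length:
  fixes f :: "'a \<Rightarrow> real" and B :: real
  shows "(\<And>x. f x \<le> B) \<Longrightarrow> sum_list (map f xs) \<le> length xs * B"
proof (induction xs)
  case (Cons x xs)
  have "f x \<le> B" "sum_list (map f xs) \<le> length xs * B" using Cons by blast+
  thus ?case by (simp add: distrib_right)
qed simp

lemma sum_wt_zip:
  "length ys = n \<Longrightarrow> (\<Sum>us\<in>words B n. wt \<omega> (zip ys us)) = wt (\<lambda>y. \<Sum>u\<in>B. \<omega> (y, u)) ys"
proof (induction ys arbitrary: n)
  case (Cons y ys)
  then obtain n' where n: "n = Suc n'" "length ys = n'" by auto
  have "(\<Sum>us\<in>words B n. wt \<omega> (zip (y # ys) us)) = (\<Sum>u\<in>B. \<omega> (y, u) * (\<Sum>us\<in>words B n'. wt \<omega> (zip ys us)))"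
    by (simp add: n(1) sum_words_Suc sum_distrib_left)
  thus ?case using Cons.IH[OF n(2)] by (simp flip: sum_distrib_right)
qed simp

lemma wt_zip_factor:
  assumes "length ys = length us"
    and "\<And>y u. u \<in> set us \<Longrightarrow> \<omega> (y, u) = w u * r (y, u) * a y"
  shows "wt \<omega> (zip ys us) = wt w us * wt r (zip ys us) * wt a ys"
  using assms by (induction ys us rule: list_induct2) simp_all

lemma wt_inverse: "wt (\<lambda>a. 1 / w a) xs = 1 / wt w xs"
  by (induction xs) simp_all

lemma card_likely_words:
  assumes fin: "finite A" and w0: "\<And>a. a \<in> A \<Longrightarrow> 0 \<le> w a" and w1: "(\<Sum>a\<in>A. w a) = 1"
  shows "real (card {xs\<in>words A n. wt w xs \<ge> 2 powr (- \<theta>)}) \<le> 2 powr \<theta>"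
proof -
  let ?S = "{xs\<in>words A n. wt w xs \<ge> 2 powr (- \<theta>)}"
  have "real (card ?S) * 2 powr (- \<theta>) \<le> (\<Sum>xs\<in>?S. wt w xs)"
    by (intro sum_bounded_below) auto
  also have "\<dots> \<le> (\<Sum>xs\<in>words A n. wt w xs)"
    using fin wt_nonneg[of A w] w0 by (intro sum_mono2) auto
  also have "\<dots> = 1" by (simp add: sum_wt w1)
  finally show ?thesis by (simp add: powr_minus divide_simps)
qed

text \<open>The decoding test accepts noise words of probability at least
  \<open>2 powr (- \<theta>)\<close>: there are at most \<open>2 powr \<theta>\<close> of them, and
  the weak law for \<open>1 / ber q\<close> shows that the actual noise is rarely rejected. The law
  \<open>\<pi>\<close> of the index is arbitrary, because quantiser indices need not be
  uniform.\<close>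

lemma bsc_coding:
  fixes K m :: nat
  assumes q: "0 \<le> q" "q \<le> 1" and m: "0 < m" and e: "0 < e"
    and \<pi>0: "\<And>j. 0 \<le> \<pi> j" and \<pi>1: "(\<Sum>j<K. \<pi> j) = 1"
  defines "V \<equiv> (\<Sum>b\<in>UNIV. ber q b * (log 2 (1 / ber q b) - bent q)\<^sup>2)"
  obtains x dec where "\<And>j. length (x j) = m"
    "(\<Sum>j<K. \<pi> j * (\<Sum>ns\<in>words UNIV m. wt (ber q) ns * of_bool (dec (bxor (x j) ns) \<noteq> j)))
      \<le> V / e\<^sup>2 / m + K * 2 powr (m * (bent q + e)) / 2 ^ m"
proof -
  define \<theta> where "\<theta> = m * (bent q + e)"
  define T where "T = (\<lambda>ns (_::unit). wt (ber q) ns \<ge> 2 powr (- \<theta>))"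
  have "(\<Sum>ns\<in>words UNIV m. wt (ber q) ns * of_bool (\<not> T ns ()))
    \<le> (\<Sum>ns\<in>words UNIV m. wt (ber q) ns * of_bool (wt (\<lambda>b. 1 / ber q b) ns > 2 powr \<theta>))"
  proof (intro sum_mono)
    fix ns assume "ns \<in> words (UNIV :: bool set) m"
    show "wt (ber q) ns * of_bool (\<not> T ns ()) \<le> wt (ber q) ns * of_bool (wt (\<lambda>b. 1 / ber q b) ns > 2 powr \<theta>)"
    proof (cases "wt (ber q) ns = 0")
      case False
      hence pos: "0 < wt (ber q) ns" using wt_ber_nonneg[OF q, of ns] by simp
      have "2 powr \<theta> < 1 / wt (ber q) ns" if "wt (ber q) ns < 2 powr (- \<theta>)"
        using that pos by (simp add: powr_minus field_simps)
      thus ?thesis using pos by (auto simp: T_def wt_inverse not_le)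
    qed simp
  qed
  also have "\<dots> \<le> V / e\<^sup>2 / m"
    unfolding V_def \<theta>_def
  proof (rule aep_words)
    show "bent q = (\<Sum>b\<in>UNIV. ber q b * log 2 (1 / ber q b))"
      unfolding sum_eta_ber[symmetric]
      by (intro sum.cong refl) (use q in \<open>auto simp: eta_def log_recip\<close>)
  qed (use q m e in \<open>auto simp: ber_nonneg\<close>)
  finally have bad: "(\<Sum>ns\<in>words UNIV m. wt (ber q) ns * of_bool (\<not> T ns ())) \<le> V / e\<^sup>2 / m" .
  show thesis
  proof (rule additive_channel_coding[where \<Omega> = "words UNIV m" and w = "wt (ber q)" and z = id
      and s = "\<lambda>_. ()" and T = T and \<pi> = \<pi> and M = K and N = m and L = "2 powr \<theta>"])
    fix x dec
    assume x: "\<And>j. length (x j) = m" and le: "(\<Sum>j<K. \<pi> j * (\<Sum>\<omega>\<in>words UNIV m. wt (ber q) \<omega> *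
        of_bool (dec (bxor (x j) (id \<omega>)) () \<noteq> j)))
      \<le> (\<Sum>\<omega>\<in>words UNIV m. wt (ber q) \<omega> * of_bool (\<not> T (id \<omega>) ())) + real K * 2 powr \<theta> / 2 ^ m"
    show thesis
      by (rule that[of x "\<lambda>y. dec y ()"]) (use x le bad in \<open>auto simp: \<theta>_def\<close>)
  qed (use \<pi>0 \<pi>1 q card_likely_words[of UNIV "ber q" m \<theta>] in
      \<open>auto simp: wt_ber_nonneg length_words T_def ber_nonneg\<close>)
qed

context binary_relay
begin

section \<open>Quantisation over the relay link\<close>

text \<open>Ideal codelength of the noise word under the product of the guesses
  \<open>\<tau>\<close>.\<close>

definition logloss :: "(nat \<Rightarrow> real) \<Rightarrow> bool list \<Rightarrow> nat list \<Rightarrow> real" where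
  "logloss \<tau> zs us = sum_list (map2 (\<lambda>z u. - log 2 (ber (\<tau> u) z)) zs us)"

text \<open>A memoryless use of the relay link on blocks of length \<open>m\<close>: \<open>f\<close> encodes a whole block of \<open>Y\<^sub>1\<close>, \<open>g\<close>
  recovers a word of indices, and \<open>\<tau> u\<close> is the guess for \<open>P(Z = 1 | u)\<close>.\<close>

definition block_scheme ::
  "real \<Rightarrow> nat \<Rightarrow> (bool list \<Rightarrow> bool list) \<Rightarrow> (bool list \<Rightarrow> nat list) \<Rightarrow> (nat \<Rightarrow> real) \<Rightarrow> bool" where
  "block_scheme D m f g \<tau> \<longleftrightarrow> 0 < m \<and> (\<forall>ys. length (f ys) = m) \<and> (\<forall>ss. length (g ss) = m) \<and>
    (\<forall>u. 0 < \<tau> u \<and> \<tau> u < 1) \<and>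
    (\<Sum>zs\<in>words UNIV m. \<Sum>vs\<in>words UNIV m. \<Sum>ns\<in>words UNIV m.
      wt (ber p) zs * wt (ber \<delta>) vs * wt (ber eps) ns * logloss \<tau> zs (g (bxor (f (bxor zs vs)) ns)))
    \<le> m * D"

text \<open>Expected loss of the guess for u once Y1 = y is known. It is the distortion measure for
  the quantiser, which sees Y1 but not Z.\<close>

definition mean_loss :: "(nat \<Rightarrow> real) \<Rightarrow> bool \<times> nat \<Rightarrow> real" where
  "mean_loss \<tau> = (\<lambda>(y, u). \<Sum>z\<in>UNIV. ber (post y) z * (- log 2 (ber (\<tau> u) z)))"

lemma mean_logloss:
  "length ys = length us \<Longrightarrow>
    (\<Sum>zs\<in>words UNIV (length ys). kern ys zs * logloss \<tau> zs us) = sum_list (map (mean_loss \<tau>) (zip ys us))"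
proof (induction ys us rule: list_induct2)
  case (Cons y ys u us)
  let ?l = "\<lambda>z. - log 2 (ber (\<tau> u) z)"
  have "(\<Sum>zs\<in>words UNIV (length (y # ys)). kern (y # ys) zs * logloss \<tau> zs (u # us))
    = (\<Sum>z\<in>UNIV. ber (post y) z * ?l z * (\<Sum>zs\<in>words UNIV (length ys). kern ys zs)
        + ber (post y) z * (\<Sum>zs\<in>words UNIV (length ys). kern ys zs * logloss \<tau> zs us))"
    unfolding list.size add_0_right add_Suc_right sum_words_Suc sum_distrib_left sum.distrib[symmetric]
    by (intro sum.cong refl) (simp add: logloss_def algebra_simps)
  also have "\<dots> = mean_loss \<tau> (y, u) + sum_list (map (mean_loss \<tau>) (zip ys us))"
    unfolding Cons.IH sum_kern[OF refl] 
    by (simp only: sum.distrib mult_1_right sum_distrib_right[symmetric] sum_ber mult_1_left mean_loss_def prod.case)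
  finally show ?case by simp
qed (simp add: logloss_def)

text \<open>Given Y1, the noise Z is independent of all that the link and \<open>g\<close> produce,
  so its expectation can be taken innermost, where the loss becomes the additive distortion
  \<open>mean_loss\<close>.\<close>

lemma block_cost:
  assumes g: "\<And>ss. length (g ss) = m"
  shows "(\<Sum>zs\<in>words UNIV m. \<Sum>vs\<in>words UNIV m. \<Sum>ns\<in>words UNIV m.
      wt (ber p) zs * wt (ber \<delta>) vs * wt (ber eps) ns * logloss \<tau> zs (g (bxor (f (bxor zs vs)) ns)))
    = (\<Sum>ys\<in>words UNIV m. wt (ber py1) ys * (\<Sum>ns\<in>words UNIV m. wt (ber eps) ns *
        sum_list (map (mean_loss \<tau>) (zip ys (g (bxor (f ys) ns))))))"
proof -
  let ?W = "words (UNIV :: bool set) m"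
  have "(\<Sum>zs\<in>?W. \<Sum>vs\<in>?W. \<Sum>ns\<in>?W.
      wt (ber p) zs * wt (ber \<delta>) vs * wt (ber eps) ns * logloss \<tau> zs (g (bxor (f (bxor zs vs)) ns)))
    = (\<Sum>zs\<in>?W. \<Sum>vs\<in>?W. wt (ber p) zs * wt (ber \<delta>) vs *
        (\<Sum>ns\<in>?W. wt (ber eps) ns * logloss \<tau> zs (g (bxor (f (bxor zs vs)) ns))))"
    by (simp only: sum_distrib_left mult.assoc)
  also have "\<dots> = (\<Sum>ys\<in>?W. \<Sum>zs\<in>?W. wt (ber py1) ys * kern ys zs *
        (\<Sum>ns\<in>?W. wt (ber eps) ns * logloss \<tau> zs (g (bxor (f ys) ns))))"
    by (rule sum_noise_change)
  also have "\<dots> = (\<Sum>ys\<in>?W. wt (ber py1) ys * (\<Sum>ns\<in>?W. wt (ber eps) ns *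
        (\<Sum>zs\<in>?W. kern ys zs * logloss \<tau> zs (g (bxor (f ys) ns)))))"
  proof (intro sum.cong refl)
    fix ys
    show "(\<Sum>zs\<in>?W. wt (ber py1) ys * kern ys zs *
        (\<Sum>ns\<in>?W. wt (ber eps) ns * logloss \<tau> zs (g (bxor (f ys) ns))))
      = wt (ber py1) ys * (\<Sum>ns\<in>?W. wt (ber eps) ns *
        (\<Sum>zs\<in>?W. kern ys zs * logloss \<tau> zs (g (bxor (f ys) ns))))"
      unfolding sum_distrib_left by (subst sum.swap) (simp only: mult_ac)
  qed
  also have "\<dots> = (\<Sum>ys\<in>?W. wt (ber py1) ys * (\<Sum>ns\<in>?W. wt (ber eps) ns *
        sum_list (map (mean_loss \<tau>) (zip ys (g (bxor (f ys) ns))))))"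
  proof (intro sum.cong refl arg_cong2[where f = "(*)"])
    fix ys ns assume "ys \<in> ?W"
    hence "length ys = m" by (simp add: length_words)
    thus "(\<Sum>zs\<in>?W. kern ys zs * logloss \<tau> zs (g (bxor (f ys) ns)))
      = sum_list (map (mean_loss \<tau>) (zip ys (g (bxor (f ys) ns))))"
      using mean_logloss[of ys "g (bxor (f ys) ns)" \<tau>] g by simp
  qed
  finally show ?thesis .
qed

section \<open>Information and distortion of a test channel\<close>

lemma mean_marginal:
  assumes rep: "repr k w t" and mean: "(\<Sum>u<k. w u * t u) = py1"
  shows "(\<Sum>u<k. w u * ber (t u) y) = ber py1 y"
  using mean rep by (cases y) (simp_all add: repr_def ber_def right_diff_distrib sum_subtractf)

lemma repr_support:
  assumes rep: "repr k w t" and mean: "(\<Sum>u<k. w u * t u) = py1"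
    and u: "u < k" and y: "ber py1 y = 0"
  shows "w u * ber (t u) y = 0"
proof -
  have "\<forall>u\<in>{..<k}. w u * ber (t u) y = 0"
    using mean_marginal[OF rep mean, of y] y rep
    by (subst sum_nonneg_eq_0_iff[symmetric]) (auto simp: repr_def ber_nonneg)
  thus ?thesis using u by simp
qed

lemma sum_repr_log:
  assumes rep: "repr k w t" and mean: "(\<Sum>u<k. w u * t u) = py1"
  shows "(\<Sum>u<k. w u * (\<Sum>y\<in>UNIV. - ber (t u) y * log 2 (ber py1 y))) = bent py1"
proof -
  have "(\<Sum>u<k. w u * (\<Sum>y\<in>UNIV. - ber (t u) y * log 2 (ber py1 y)))
    = (\<Sum>y\<in>UNIV. - (\<Sum>u<k. w u * ber (t u) y) * log 2 (ber py1 y))"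
    unfolding sum_distrib_left sum_distrib_right sum_negf[symmetric]
    by (subst sum.swap) (simp add: mult.assoc)
  thus ?thesis unfolding mean_marginal[OF rep mean] by (simp add: eta_def flip: sum_eta_ber)
qed

lemma repr_information_nonneg:
  assumes rep: "repr k w t" and mean: "(\<Sum>u<k. w u * t u) = py1"
  shows "(\<Sum>u<k. w u * bent (t u)) \<le> bent py1"
proof -
  have "w u * bent (t u) \<le> w u * (\<Sum>y\<in>UNIV. - ber (t u) y * log 2 (ber py1 y))" if u: "u < k" for u
  proof (cases "w u = 0")
    case False
    have t: "0 \<le> t u" "t u \<le> 1" "0 \<le> w u" using rep u by (auto simp: repr_def)
    have "ent UNIV (ber (t u)) \<le> (\<Sum>y\<in>UNIV. - ber (t u) y * log 2 (ber py1 y)) +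
      (\<Sum>y\<in>UNIV. ber (t u) y) * log 2 (\<Sum>y\<in>UNIV. ber py1 y)"
      using t py1_bounds repr_support[OF rep mean u] False by (intro gibbs) (auto simp: ber_nonneg)
    thus ?thesis using t by (intro mult_left_mono) (auto simp: ent_def sum_eta_ber)
  qed simp
  hence "(\<Sum>u<k. w u * bent (t u)) \<le> (\<Sum>u<k. w u * (\<Sum>y\<in>UNIV. - ber (t u) y * log 2 (ber py1 y)))"
    by (intro sum_mono) simp
  thus ?thesis by (simp only: sum_repr_log[OF rep mean])
qed

definition joint_yu :: "(nat \<Rightarrow> real) \<Rightarrow> (nat \<Rightarrow> real) \<Rightarrow> bool \<times> nat \<Rightarrow> real" where
  "joint_yu w t = (\<lambda>(y, u). w u * ber (t u) y)"

lemma sum_joint_yu: "(\<Sum>x\<in>UNIV \<times> {..<k}. joint_yu w t x * F x) = (\<Sum>u<k. w u * (\<Sum>y\<in>UNIV. ber (t u) y * F (y, u)))"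
proof -
  have "(\<Sum>x\<in>UNIV \<times> {..<k}. joint_yu w t x * F x) = (\<Sum>y\<in>UNIV. \<Sum>u<k. w u * ber (t u) y * F (y, u))"
    by (simp add: sum.cartesian_product joint_yu_def case_prod_beta')
  also have "\<dots> = (\<Sum>u<k. \<Sum>y\<in>UNIV. w u * ber (t u) y * F (y, u))" by (rule sum.swap)
  finally show ?thesis by (simp only: sum_distrib_left mult.assoc)
qed

lemma smoothed_test_channel:
  assumes rep: "repr k w t" and \<Delta>: "0 < \<Delta>"
  obtains \<tau> B where "\<And>u. 0 < \<tau> u" "\<And>u. \<tau> u < 1" "\<And>x. 0 \<le> mean_loss \<tau> x" "\<And>x. mean_loss \<tau> x \<le> B"
    "(\<Sum>x\<in>UNIV \<times> {..<k}. joint_yu w t x * mean_loss \<tau> x) \<le> (\<Sum>u<k. w u * bent (mix (t u))) + \<Delta>"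
proof -
  \<comment> \<open>Mixing with a fair coin of weight \<open>\<gamma>\<close>: the guess is at least
    \<open>1 - \<gamma>\<close> times the true posterior, which costs at most
    \<open>- log 2 (1 - \<gamma>) = \<Delta>\<close>, and at least \<open>\<gamma> / 2\<close>,
    which bounds every loss by \<open>B\<close>.\<close>
  define \<gamma> where "\<gamma> = 1 - 2 powr (- \<Delta>)"
  have \<gamma>: "0 < \<gamma>" "\<gamma> < 1" using \<Delta> by (simp_all add: \<gamma>_def powr_less_one)
  define \<tau> where "\<tau> = (\<lambda>u. (1 - \<gamma>) * (if u < k then mix (t u) else 0) + \<gamma> / 2)"
  define B where "B = - log 2 (\<gamma> / 2)"
  have mix01: "0 \<le> mix (t u)" "mix (t u) \<le> 1" if "u < k" for u
    using rep that mix_bounds by (auto simp: repr_def)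
  have mean_post: "(\<Sum>z\<in>UNIV. ber (post y) z * c) = c" for y c by (simp flip: sum_distrib_right)
  have lo: "\<gamma> / 2 \<le> \<tau> u" for u using mix01[of u] \<gamma> by (simp add: \<tau>_def)
  have hi: "\<tau> u \<le> 1 - \<gamma> / 2" for u
  proof -
    have "(1 - \<gamma>) * (if u < k then mix (t u) else 0) \<le> (1 - \<gamma>) * 1"
      using mix01[of u] \<gamma> by (intro mult_left_mono) auto
    thus ?thesis by (simp add: \<tau>_def)
  qed
  have \<tau>0: "0 < \<tau> u" and \<tau>1: "\<tau> u < 1" for u using lo[of u] hi[of u] \<gamma> by linarith+
  have ber_lo: "\<gamma> / 2 \<le> ber (\<tau> u) z" for u z
    using lo[of u] hi[of u] by (auto simp: ber_def)
  have ber_pos: "0 < ber (\<tau> u) z" for u z using ber_lo[of u z] \<gamma> by linarith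
  have l0: "0 \<le> - log 2 (ber (\<tau> u) z)" for u z
    using ber_pos[of u z] ber_le_1[of "\<tau> u" z] \<tau>0[of u] \<tau>1[of u] by simp
  have lB: "- log 2 (ber (\<tau> u) z) \<le> B" for u z
    using ber_lo[of u z] ber_pos[of u z] \<gamma> unfolding B_def by simp
  have post0: "0 \<le> ber (post y) z" for y z using post_bounds by (simp add: ber_nonneg)
  have d0: "0 \<le> mean_loss \<tau> x" for x
    unfolding mean_loss_def case_prod_beta by (intro sum_nonneg mult_nonneg_nonneg post0 l0)
  have dB: "mean_loss \<tau> x \<le> B" for x
  proof -
    have "mean_loss \<tau> x \<le> (\<Sum>z\<in>UNIV. ber (post (fst x)) z * B)"
      unfolding mean_loss_def case_prod_beta by (intro sum_mono mult_left_mono post0 lB)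
    thus ?thesis by (simp only: mean_post)
  qed
  have "w u * (\<Sum>y\<in>UNIV. ber (t u) y * mean_loss \<tau> (y, u)) \<le> w u * (bent (mix (t u)) + \<Delta>)" if u: "u < k" for u
  proof (intro mult_left_mono)
    have "(\<Sum>y\<in>UNIV. ber (t u) y * mean_loss \<tau> (y, u))
      = (\<Sum>z\<in>UNIV. (\<Sum>y\<in>UNIV. ber (t u) y * ber (post y) z) * (- log 2 (ber (\<tau> u) z)))"
      unfolding mean_loss_def prod.case sum_distrib_left sum_distrib_right
      by (subst sum.swap) (simp only: mult.assoc)
    also have "\<dots> = (\<Sum>z\<in>UNIV. ber (mix (t u)) z * (- log 2 (ber (\<tau> u) z)))"
      unfolding ber_mix ..
    also have "\<dots> \<le> (\<Sum>z\<in>UNIV. eta (ber (mix (t u)) z) + ber (mix (t u)) z * \<Delta>)"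
    proof (intro sum_mono)
      fix z
      let ?b = "ber (mix (t u)) z"
      show "?b * (- log 2 (ber (\<tau> u) z)) \<le> eta ?b + ?b * \<Delta>"
      proof (cases "?b = 0")
        case False
        have b: "0 < ?b" using False mix01[OF u] by (simp add: order_less_le ber_nonneg)
        have "(1 - \<gamma>) * ?b \<le> ber (\<tau> u) z"
          using u \<gamma> by (cases z) (simp_all add: \<tau>_def ber_def algebra_simps)
        hence "log 2 ((1 - \<gamma>) * ?b) \<le> log 2 (ber (\<tau> u) z)"
          using b \<gamma> by (intro log_mono) auto
        moreover have "log 2 ((1 - \<gamma>) * ?b) = log 2 (1 - \<gamma>) + log 2 ?b"
          using b \<gamma> by (simp add: log_mult)
        moreover have "log 2 (1 - \<gamma>) = - \<Delta>" by (simp add: \<gamma>_def)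
        ultimately have "- log 2 (ber (\<tau> u) z) \<le> - log 2 ?b + \<Delta>" by linarith
        hence "?b * (- log 2 (ber (\<tau> u) z)) \<le> ?b * (- log 2 ?b + \<Delta>)"
          using b by (intro mult_left_mono) auto
        thus ?thesis by (simp add: eta_def algebra_simps)
      qed simp
    qed
    also have "\<dots> = bent (mix (t u)) + \<Delta>"
      by (simp only: sum.distrib sum_eta_ber sum_distrib_right[symmetric] sum_ber mult_1_left)
    finally show "(\<Sum>y\<in>UNIV. ber (t u) y * mean_loss \<tau> (y, u)) \<le> bent (mix (t u)) + \<Delta>" .
  qed (use rep u in \<open>auto simp: repr_def\<close>)
  hence "(\<Sum>u<k. w u * (\<Sum>y\<in>UNIV. ber (t u) y * mean_loss \<tau> (y, u))) \<le> (\<Sum>u<k. w u * (bent (mix (t u)) + \<Delta>))"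
    by (intro sum_mono) simp
  also have "\<dots> = (\<Sum>u<k. w u * bent (mix (t u))) + \<Delta>"
    using rep by (simp add: distrib_left sum.distrib repr_def flip: sum_distrib_right)
  finally show thesis using that[OF \<tau>0 \<tau>1 d0 dB] by (simp only: sum_joint_yu)
qed

text \<open>\<open>V\<close> is fixed before m and K, so one constant serves all block lengths. A
  pair of words is good if neither its log-likelihood ratio nor its distortion exceeds its mean by
  much: the first is the comparison with the product law that \<open>covering\<close> asks for, the
  second makes a covered word well described.\<close>

lemma quantizer:
  fixes d :: "bool \<times> nat \<Rightarrow> real"
  assumes rep: "repr k w t" and mean: "(\<Sum>u<k. w u * t u) = py1"
    and I: "I = bent py1 - (\<Sum>u<k. w u * bent (t u))"
    and \<mu>: "\<mu> = (\<Sum>x\<in>UNIV \<times> {..<k}. joint_yu w t x * d x)" and e: "0 < e"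
  shows "\<exists>V. \<forall>m K. 0 < m \<longrightarrow> (\<exists>us. (\<forall>j<K. us j \<in> words {..<k} m) \<and>
      (\<Sum>ys\<in>words UNIV m. wt (ber py1) ys *
          of_bool (\<forall>j<K. \<not> sum_list (map d (zip ys (us j))) \<le> m * (\<mu> + e)))
        \<le> V / m + exp (- (real K / 2 powr (m * (I + e)))))"
proof -
  let ?A = "(UNIV :: bool set) \<times> {..<k}"
  have w0: "0 \<le> w u" and t0: "0 \<le> t u" "t u \<le> 1" if "u < k" for u
    using rep that by (auto simp: repr_def)
  have w1: "(\<Sum>u<k. w u) = 1" using rep by (simp add: repr_def)
  have py0: "0 \<le> ber py1 y" for y using py1_bounds by (simp add: ber_nonneg)
  \<comment> \<open>The ratio of P(y | u) to P(y); its expected logarithm is the information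
    \<open>I\<close>.\<close>
  define r where "r = (\<lambda>(y, u). ber (t u) y / ber py1 y)"
  have joint0: "0 \<le> joint_yu w t x" if "x \<in> ?A" for x
    using that w0 t0 by (auto simp: joint_yu_def ber_nonneg)
  have joint1: "(\<Sum>x\<in>?A. joint_yu w t x) = 1"
    using sum_joint_yu[of w t "\<lambda>_. 1" k] by (simp add: w1)
  have factor: "joint_yu w t (y, u) = w u * r (y, u) * ber py1 y" if "u < k" for y u
    using repr_support[OF rep mean that, of y] by (auto simp: joint_yu_def r_def)
  have r_pos: "0 < r x" if "x \<in> ?A" "0 < joint_yu w t x" for x
  proof -
    define y u where "y = fst x" and "u = snd x"
    hence x: "x = (y, u)" "u < k" using that(1) by auto
    have "0 < w u * ber (t u) y" using that(2) x by (simp add: joint_yu_def)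
    hence "0 < ber (t u) y" using w0[OF x(2)] by (simp add: zero_less_mult_iff)
    moreover have "0 < ber py1 y"
      using py0[of y] repr_support[OF rep mean x(2), of y] \<open>0 < w u * ber (t u) y\<close> by force
    ultimately show ?thesis by (simp add: x r_def)
  qed
  have info: "I = (\<Sum>x\<in>?A. joint_yu w t x * log 2 (r x))"
  proof -
    have "joint_yu w t x * log 2 (r x) = joint_yu w t x * (log 2 (ber (t (snd x)) (fst x)) - log 2 (ber py1 (fst x)))"
      if "x \<in> ?A" for x
    proof (cases "joint_yu w t x = 0")
      case False
      hence "0 < r x" using r_pos[OF that] joint0[OF that] by simp
      hence "0 < ber (t (snd x)) (fst x)" "0 < ber py1 (fst x)"
        using py0[of "fst x"] t0[of "snd x"] that
        by (auto simp: r_def zero_less_divide_iff case_prod_beta not_less[symmetric])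
      thus ?thesis by (simp add: r_def case_prod_beta log_divide)
    qed simp
    hence "(\<Sum>x\<in>?A. joint_yu w t x * log 2 (r x))
      = (\<Sum>x\<in>?A. joint_yu w t x * (log 2 (ber (t (snd x)) (fst x)) - log 2 (ber py1 (fst x))))"
      by (intro sum.cong refl)
    also have "\<dots> = (\<Sum>u<k. w u * (\<Sum>y\<in>UNIV. ber (t u) y * (log 2 (ber (t u) y) - log 2 (ber py1 y))))"
      by (simp add: sum_joint_yu)
    also have "\<dots> = (\<Sum>u<k. w u * (\<Sum>y\<in>UNIV. - ber (t u) y * log 2 (ber py1 y)) - w u * bent (t u))"
      unfolding sum_eta_ber[symmetric] right_diff_distrib[symmetric] sum_subtractf[symmetric]
      by (intro sum.cong refl arg_cong2[where f = "(*)"]) (simp add: eta_def algebra_simps)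
    also have "\<dots> = I" by (simp only: sum_subtractf sum_repr_log[OF rep mean] I)
    finally show ?thesis ..
  qed
  define V where "V = (\<Sum>x\<in>?A. joint_yu w t x * (log 2 (r x) - I)\<^sup>2) / e\<^sup>2 + (\<Sum>x\<in>?A. joint_yu w t x * (d x - \<mu>)\<^sup>2) / e\<^sup>2"
  show ?thesis
  proof (rule exI[of _ V], intro allI impI)
    fix m K :: nat assume m: "0 < m"
    define W where "W = words (UNIV :: bool set) m"
    define U where "U = words {..<k} m"
    define J where "J = (\<lambda>ys us. wt (joint_yu w t) (zip ys us))"
    define G where "G = (\<lambda>xs. wt r xs \<le> 2 powr (m * (I + e)) \<and> sum_list (map d xs) \<le> m * (\<mu> + e))"
    have PY: "(\<Sum>us\<in>U. J ys us) = wt (ber py1) ys" if "ys \<in> W" for ys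
    proof -
      have "(\<Sum>us\<in>U. J ys us) = wt (\<lambda>y. \<Sum>u<k. joint_yu w t (y, u)) ys"
        unfolding J_def U_def by (rule sum_wt_zip) (use that in \<open>simp add: W_def length_words\<close>)
      also have "(\<lambda>y. \<Sum>u<k. joint_yu w t (y, u)) = ber py1"
        by (simp add: joint_yu_def mean_marginal[OF rep mean] fun_eq_iff)
      finally show ?thesis .
    qed
    have zip_in: "zip ys us \<in> words ?A m" if "ys \<in> W" "us \<in> U" for ys us
      using that by (auto simp: W_def U_def words_def dest: set_zip_rightD)
    have bad: "(\<Sum>ys\<in>W. \<Sum>us\<in>U. J ys us * of_bool (\<not> G (zip ys us))) \<le> V / m"
    proof -
      have "(\<Sum>ys\<in>W. \<Sum>us\<in>U. J ys us * of_bool (\<not> G (zip ys us)))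
        = (\<Sum>xs\<in>words ?A m. wt (joint_yu w t) xs * of_bool (\<not> G xs))"
        unfolding W_def U_def J_def sum_words_zip zip_map_fst_snd ..
      also have "\<dots> \<le> (\<Sum>xs\<in>words ?A m. wt (joint_yu w t) xs * of_bool (wt r xs > 2 powr (m * (I + e)))
          + wt (joint_yu w t) xs * of_bool (sum_list (map d xs) > m * (\<mu> + e)))"
      proof (intro sum_mono)
        fix xs assume "xs \<in> words ?A m"
        hence "0 \<le> wt (joint_yu w t) xs" using wt_nonneg[of ?A "joint_yu w t"] joint0 by blast
        thus "wt (joint_yu w t) xs * of_bool (\<not> G xs) \<le> wt (joint_yu w t) xs * of_bool (wt r xs > 2 powr (m * (I + e)))
          + wt (joint_yu w t) xs * of_bool (sum_list (map d xs) > m * (\<mu> + e))"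
          by (auto simp: G_def not_le)
      qed
      also have "\<dots> \<le> (\<Sum>x\<in>?A. joint_yu w t x * (log 2 (r x) - I)\<^sup>2) / e\<^sup>2 / m
          + (\<Sum>x\<in>?A. joint_yu w t x * (d x - \<mu>)\<^sup>2) / e\<^sup>2 / m"
        unfolding sum.distrib
        by (intro add_mono aep_words chebyshev_words joint0 joint1 info \<mu> r_pos m e) auto
      also have "\<dots> = V / m" by (simp add: V_def add_divide_distrib)
      finally show ?thesis .
    qed
    obtain us where us: "\<And>j. j < K \<Longrightarrow> us j \<in> U"
      "(\<Sum>ys\<in>W. (\<Sum>us\<in>U. J ys us) * of_bool (\<forall>j<K. \<not> G (zip ys (us j))))
        \<le> (\<Sum>ys\<in>W. \<Sum>us\<in>U. J ys us * of_bool (\<not> G (zip ys us))) + exp (- (K / 2 powr (m * (I + e))))"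
    proof (rule covering[of U W J "wt w" "\<lambda>ys us. G (zip ys us)" "2 powr (m * (I + e))" K])
      show "(\<Sum>y\<in>W. \<Sum>u\<in>U. J y u) = 1" by (simp add: PY cong: sum.cong) (simp add: W_def)
      show "0 \<le> J y u" if "y \<in> W" "u \<in> U" for y u
        unfolding J_def using wt_nonneg[of ?A "joint_yu w t", OF joint0 zip_in[OF that]] .
      show "0 \<le> wt w u" if "u \<in> U" for u
        using wt_nonneg[of "{..<k}" w u m] w0 that by (auto simp: U_def)
      show "(\<Sum>u\<in>U. wt w u) = 1" by (simp add: U_def sum_wt w1)
      show "J y u \<le> 2 powr (m * (I + e)) * (wt w u * (\<Sum>u\<in>U. J y u))"
        if y: "y \<in> W" and u: "u \<in> U" and G: "G (zip y u)" for y u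
      proof -
        have "J y u = wt w u * wt r (zip y u) * wt (ber py1) y"
          unfolding J_def using y u factor by (intro wt_zip_factor) (auto simp: W_def U_def words_def)
        also have "\<dots> \<le> wt w u * 2 powr (m * (I + e)) * wt (ber py1) y"
          using G wt_ber_nonneg[OF py1_bounds, of y] wt_nonneg[of "{..<k}" w u m] w0 u
          by (intro mult_right_mono mult_left_mono) (auto simp: G_def U_def)
        finally show ?thesis by (simp add: PY[OF y] mult_ac)
      qed
    qed (auto simp: U_def W_def)
    have "(\<Sum>ys\<in>W. wt (ber py1) ys * of_bool (\<forall>j<K. \<not> sum_list (map d (zip ys (us j))) \<le> m * (\<mu> + e)))
      \<le> (\<Sum>ys\<in>W. (\<Sum>us\<in>U. J ys us) * of_bool (\<forall>j<K. \<not> G (zip ys (us j))))"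
      using wt_ber_nonneg[OF py1_bounds] by (intro sum_mono) (auto simp: PY G_def intro!: mult_left_mono)
    also have "\<dots> \<le> V / m + exp (- (K / 2 powr (m * (I + e))))" using us(2) bad by linarith
    finally show "\<exists>us. (\<forall>j<K. us j \<in> words {..<k} m) \<and>
      (\<Sum>ys\<in>words UNIV m. wt (ber py1) ys *
          of_bool (\<forall>j<K. \<not> sum_list (map d (zip ys (us j))) \<le> m * (\<mu> + e)))
        \<le> V / m + exp (- (real K / 2 powr (m * (I + e))))"
      using us(1) unfolding U_def W_def by blast
  qed
qed

lemma block_scheme_exists:
  assumes rep: "repr k w t" and mean: "(\<Sum>u<k. w u * t u) = py1"
    and info: "bent py1 - (\<Sum>u<k. w u * bent (t u)) < 1 - bent eps"
    and D: "(\<Sum>u<k. w u * bent (mix (t u))) < D"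
  obtains m f g \<tau> where "block_scheme D m f g \<tau>"
proof -
  define I where "I = bent py1 - (\<Sum>u<k. w u * bent (t u))"
  define H where "H = (\<Sum>u<k. w u * bent (mix (t u)))"
  \<comment> \<open>Smoothing, the margin \<open>e\<close> and the coding failures may each use up
    one \<open>\<Delta>\<close> of the gap.\<close>
  define \<Delta> where "\<Delta> = (D - H) / 4"
  have \<Delta>: "0 < \<Delta>" using D by (simp add: \<Delta>_def H_def)
  obtain \<tau> B where \<tau>: "\<And>u. 0 < \<tau> u" "\<And>u. \<tau> u < 1" and d0: "\<And>x. 0 \<le> mean_loss \<tau> x" and dB: "\<And>x. mean_loss \<tau> x \<le> B"
    and dH: "(\<Sum>x\<in>UNIV \<times> {..<k}. joint_yu w t x * mean_loss \<tau> x) \<le> H + \<Delta>"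
    using smoothed_test_channel[OF rep \<Delta>] unfolding H_def by blast
  have B0: "0 \<le> B" using d0 dB order_trans by blast
  define \<mu> where "\<mu> = (\<Sum>x\<in>UNIV \<times> {..<k}. joint_yu w t x * mean_loss \<tau> x)"
  have \<mu>0: "0 \<le> \<mu>" unfolding \<mu>_def using rep d0
    by (intro sum_nonneg mult_nonneg_nonneg) (auto simp: joint_yu_def repr_def ber_nonneg)
  \<comment> \<open>The number of indices has exponent \<open>I + 2 * e\<close>, one
    \<open>e\<close> above what covering needs. The link code adds \<open>bent eps + e\<close>
    against one bit per use, so a quarter of the gap leaves the exponent \<open>- e\<close>.\<close>
  define e where "e = min \<Delta> ((1 - bent eps - I) / 4)"
  have e: "0 < e" "e \<le> \<Delta>" "I + 3 * e + bent eps - 1 \<le> - e"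
  proof -
    have "e \<le> (1 - bent eps - I) / 4" unfolding e_def by (rule min.cobounded2)
    thus "I + 3 * e + bent eps - 1 \<le> - e" by (simp add: field_simps)
  qed (use \<Delta> info in \<open>auto simp: e_def I_def\<close>)
  have I0: "0 \<le> I" using repr_information_nonneg[OF rep mean] by (simp add: I_def)
  obtain V where V: "\<And>m K. 0 < m \<Longrightarrow> \<exists>us. (\<forall>j<K. us j \<in> words {..<k} m) \<and>
      (\<Sum>ys\<in>words UNIV m. wt (ber py1) ys *
          of_bool (\<forall>j<K. \<not> sum_list (map (mean_loss \<tau>) (zip ys (us j))) \<le> m * (\<mu> + e)))
        \<le> V / m + exp (- (real K / 2 powr (m * (I + e))))"
    using quantizer[OF rep mean I_def \<mu>_def e(1)] by blast
  define V' where "V' = (\<Sum>b\<in>UNIV. ber eps b * (log 2 (1 / ber eps b) - bent eps)\<^sup>2) / e\<^sup>2"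
  \<comment> \<open>The failure terms in order: bad pairs, too few quantiser words, unlikely link
    noise, confusion of indices.\<close>
  define \<phi> where "\<phi> = (\<lambda>m::nat. V / m + exp (- (2 powr (m * e))) + (V' / m + 2 * 2 powr (- (m * e))))"
  have "\<phi> \<longlonglongrightarrow> 0"
    unfolding \<phi>_def using e(1) by real_asymp
  hence "(\<lambda>m. B * \<phi> m) \<longlonglongrightarrow> B * 0" by (intro tendsto_mult tendsto_const)
  hence "eventually (\<lambda>m. B * \<phi> m < \<Delta>) sequentially" using \<Delta> by (intro order_tendstoD) auto
  hence "eventually (\<lambda>m. B * \<phi> m < \<Delta> \<and> 0 < m) sequentially"
    using eventually_gt_at_top[of 0] by eventually_elim simp
  then obtain m where m: "B * \<phi> m < \<Delta>" "0 < m" by (auto simp: eventually_sequentially)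
  define K where "K = nat \<lceil>2 powr (m * (I + 2 * e))\<rceil>"
  have K_ge: "2 powr (m * (I + 2 * e)) \<le> K" unfolding K_def by (simp add: real_nat_ceiling_ge)
  have "1 \<le> 2 powr (m * (I + 2 * e))" using I0 e by (intro ge_one_powr_ge_zero) auto
  moreover have "real K < 2 powr (m * (I + 2 * e)) + 1"
    unfolding K_def using ceiling_correct[of "2 powr (m * (I + 2 * e))"] by (simp add: less_ceiling_iff)
  ultimately have K_le: "K \<le> 2 * 2 powr (m * (I + 2 * e))" and K0: "0 < K"
    using K_ge by simp_all
  have exp_bound: "exp (- (real K / 2 powr (m * (I + e)))) \<le> exp (- (2 powr (m * e)))"
  proof -
    have "2 powr (m * e) = 2 powr (m * (I + 2 * e)) / 2 powr (m * (I + e))"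
      by (simp add: algebra_simps flip: powr_diff)
    also have "\<dots> \<le> real K / 2 powr (m * (I + e))" using K_ge by (intro divide_right_mono) auto
    finally show ?thesis by simp
  qed
  have rate_bound: "K * 2 powr (m * (bent eps + e)) / 2 ^ m \<le> 2 * 2 powr (- (m * e))"
  proof -
    have "K * 2 powr (m * (bent eps + e)) / 2 ^ m
      \<le> 2 * 2 powr (m * (I + 2 * e)) * 2 powr (m * (bent eps + e)) / 2 powr m"
      using K_le by (simp add: powr_realpow divide_right_mono)
    also have "\<dots> = 2 * 2 powr (m * (I + 3 * e + bent eps - 1))"
    proof -
      have "real m * (I + 3 * e + bent eps - 1) = m * (I + 2 * e) + m * (bent eps + e) - m"
        by (simp add: algebra_simps)
      thus ?thesis by (simp add: powr_add powr_diff)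
    qed
    also have "\<dots> \<le> 2 * 2 powr (- (m * e))"
      using mult_left_mono[OF e(3), of "real m"] by simp
    finally show ?thesis .
  qed
  define W where "W = words (UNIV :: bool set) m"
  obtain us where us: "\<And>j. j < K \<Longrightarrow> us j \<in> words {..<k} m"
    and cover': "(\<Sum>ys\<in>W. wt (ber py1) ys *
          of_bool (\<forall>j<K. \<not> sum_list (map (mean_loss \<tau>) (zip ys (us j))) \<le> m * (\<mu> + e)))
        \<le> V / m + exp (- (real K / 2 powr (m * (I + e))))"
    using V[OF m(2), of K] unfolding W_def by blast
  have cover: "(\<Sum>ys\<in>W. wt (ber py1) ys *
          of_bool (\<forall>j<K. \<not> sum_list (map (mean_loss \<tau>) (zip ys (us j))) \<le> m * (\<mu> + e)))
        \<le> V / m + exp (- (2 powr (m * e)))"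
    using cover' exp_bound by linarith
  define good where "good = (\<lambda>ys j. sum_list (map (mean_loss \<tau>) (zip ys (us j))) \<le> m * (\<mu> + e))"
  \<comment> \<open>An uncovered block is sent as index 0; such blocks are charged as failures
    anyway.\<close>
  define ix where "ix = (\<lambda>ys. if \<exists>j<K. good ys j then SOME j. j < K \<and> good ys j else 0)"
  have ix_good: "ix ys < K \<and> good ys (ix ys)" if "\<exists>j<K. good ys j" for ys
    unfolding ix_def using that someI_ex[OF that] by simp
  have ix_less: "ix ys < K" for ys
    using ix_good[of ys] K0 by (cases "\<exists>j<K. good ys j") (auto simp: ix_def)
  \<comment> \<open>The link code is built for this law of the index, which the quantiser
    induces.\<close>
  define \<pi> where "\<pi> = (\<lambda>j. \<Sum>ys\<in>W. wt (ber py1) ys * of_bool (ix ys = j))"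
  have \<pi>_sum: "(\<Sum>j<K. \<pi> j * F j) = (\<Sum>ys\<in>W. wt (ber py1) ys * F (ix ys))" for F
  proof -
    have "(\<Sum>j<K. \<pi> j * F j) = (\<Sum>ys\<in>W. \<Sum>j<K. wt (ber py1) ys * of_bool (ix ys = j) * F j)"
      unfolding \<pi>_def sum_distrib_right by (rule sum.swap)
    also have "\<dots> = (\<Sum>ys\<in>W. wt (ber py1) ys * F (ix ys))"
    proof (intro sum.cong refl)
      fix ys
      have "(\<Sum>j<K. wt (ber py1) ys * of_bool (ix ys = j) * F j)
        = (\<Sum>j<K. if j = ix ys then wt (ber py1) ys * F j else 0)"
        by (intro sum.cong refl) auto
      thus "(\<Sum>j<K. wt (ber py1) ys * of_bool (ix ys = j) * F j) = wt (ber py1) ys * F (ix ys)"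
        using ix_less[of ys] by simp
    qed
    finally show ?thesis .
  qed
  have \<pi>0: "0 \<le> \<pi> j" for j
    unfolding \<pi>_def using wt_ber_nonneg[OF py1_bounds] by (intro sum_nonneg) auto
  have \<pi>1: "(\<Sum>j<K. \<pi> j) = 1" using \<pi>_sum[of "\<lambda>_. 1"] by (simp add: W_def)
  obtain x dec where x: "\<And>j. length (x j) = m"
    and bsc: "(\<Sum>j<K. \<pi> j * (\<Sum>ns\<in>W. wt (ber eps) ns * of_bool (dec (bxor (x j) ns) \<noteq> j)))
      \<le> V' / m + K * 2 powr (m * (bent eps + e)) / 2 ^ m"
    using bsc_coding[OF eps m(2) e(1) \<pi>0 \<pi>1] unfolding W_def V'_def by blast
  have chan: "(\<Sum>j<K. \<pi> j * (\<Sum>ns\<in>W. wt (ber eps) ns * of_bool (dec (bxor (x j) ns) \<noteq> j)))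
      \<le> V' / m + 2 * 2 powr (- (m * e))"
    using bsc rate_bound by linarith
  define f where "f = (\<lambda>ys. x (ix ys))"
  \<comment> \<open>\<open>dec\<close> may return a number outside the codebook; the constant word
    keeps the output length m.\<close>
  define g where "g = (\<lambda>ss. if dec ss < K then us (dec ss) else replicate m 0)"
  have lf: "length (f ys) = m" for ys by (simp add: f_def x)
  have lg: "length (g ss) = m" for ss using us by (auto simp: g_def words_def)
  define fail where "fail = (\<lambda>ys. of_bool (\<forall>j<K. \<not> good ys j) :: real)"
  define err where "err = (\<lambda>ys ns. of_bool (dec (bxor (x (ix ys)) ns) \<noteq> ix ys) :: real)"
  have pt: "sum_list (map (mean_loss \<tau>) (zip ys (g (bxor (f ys) ns)))) \<le> m * (\<mu> + e) + m * B * (fail ys + err ys ns)"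
    if "ys \<in> W" for ys ns
  proof (cases "(\<exists>j<K. good ys j) \<and> dec (bxor (x (ix ys)) ns) = ix ys")
    case True
    hence "g (bxor (f ys) ns) = us (ix ys)" using ix_less by (simp add: g_def f_def)
    moreover have "good ys (ix ys)" using ix_good True by blast
    moreover have "0 \<le> m * B * (fail ys + err ys ns)" using B0 by (simp add: fail_def err_def)
    ultimately show ?thesis by (simp add: good_def)
  next
    case False
    hence 1: "1 \<le> fail ys + err ys ns" by (auto simp: fail_def err_def)
    have "sum_list (map (mean_loss \<tau>) (zip ys (g (bxor (f ys) ns)))) \<le> length (zip ys (g (bxor (f ys) ns))) * B"
      by (rule sum_list_le_length[OF dB])
    also have "\<dots> = m * B * 1" using that lg by (simp add: W_def length_words)
    also have "\<dots> \<le> m * B * (fail ys + err ys ns)" using B0 by (intro mult_left_mono 1) simp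
    finally show ?thesis using \<mu>0 e by (simp add: add_increasing)
  qed
  have "(\<Sum>ys\<in>W. wt (ber py1) ys * (\<Sum>ns\<in>W. wt (ber eps) ns *
        sum_list (map (mean_loss \<tau>) (zip ys (g (bxor (f ys) ns))))))
    \<le> (\<Sum>ys\<in>W. wt (ber py1) ys * (\<Sum>ns\<in>W. wt (ber eps) ns * (m * (\<mu> + e) + m * B * (fail ys + err ys ns))))"
    using pt wt_ber_nonneg[OF py1_bounds] wt_ber_nonneg[OF eps] by (intro sum_mono mult_left_mono) auto
  also have "\<dots> = (\<Sum>ys\<in>W. wt (ber py1) ys * (m * (\<mu> + e) + m * B * (fail ys + (\<Sum>ns\<in>W. wt (ber eps) ns * err ys ns))))"
  proof (intro sum.cong refl arg_cong2[where f = "(*)"])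
    fix ys
    have "(\<Sum>ns\<in>W. wt (ber eps) ns * (m * (\<mu> + e) + m * B * (fail ys + err ys ns)))
      = (\<Sum>ns\<in>W. wt (ber eps) ns) * (m * (\<mu> + e) + m * B * fail ys) + m * B * (\<Sum>ns\<in>W. wt (ber eps) ns * err ys ns)"
      unfolding sum_distrib_left sum_distrib_right sum.distrib[symmetric]
      by (intro sum.cong refl) (simp add: algebra_simps)
    also have "(\<Sum>ns\<in>W. wt (ber eps) ns) = 1" by (simp add: W_def)
    finally show "(\<Sum>ns\<in>W. wt (ber eps) ns * (m * (\<mu> + e) + m * B * (fail ys + err ys ns)))
      = m * (\<mu> + e) + m * B * (fail ys + (\<Sum>ns\<in>W. wt (ber eps) ns * err ys ns))"
      by (simp add: algebra_simps)
  qed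
  also have "\<dots> = (\<Sum>ys\<in>W. wt (ber py1) ys) * (m * (\<mu> + e)) + m * B * ((\<Sum>ys\<in>W. wt (ber py1) ys * fail ys)
      + (\<Sum>ys\<in>W. wt (ber py1) ys * (\<Sum>ns\<in>W. wt (ber eps) ns * err ys ns)))"
    unfolding sum.distrib[symmetric] sum_distrib_left[of "m * B"] sum_distrib_right[of _ _ "m * (\<mu> + e)"]
    by (intro sum.cong refl) (simp add: algebra_simps)
  also have "(\<Sum>ys\<in>W. wt (ber py1) ys) = 1" by (simp add: W_def)
  also have "(\<Sum>ys\<in>W. wt (ber py1) ys * (\<Sum>ns\<in>W. wt (ber eps) ns * err ys ns))
      = (\<Sum>j<K. \<pi> j * (\<Sum>ns\<in>W. wt (ber eps) ns * of_bool (dec (bxor (x j) ns) \<noteq> j)))"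
    unfolding err_def \<pi>_sum ..
  finally have "(\<Sum>ys\<in>W. wt (ber py1) ys * (\<Sum>ns\<in>W. wt (ber eps) ns *
        sum_list (map (mean_loss \<tau>) (zip ys (g (bxor (f ys) ns))))))
    \<le> m * (\<mu> + e) + m * B * ((\<Sum>ys\<in>W. wt (ber py1) ys * fail ys)
        + (\<Sum>j<K. \<pi> j * (\<Sum>ns\<in>W. wt (ber eps) ns * of_bool (dec (bxor (x j) ns) \<noteq> j))))" by simp
  also have "\<dots> \<le> m * (\<mu> + e) + m * B * \<phi> m"
    using cover chan B0 unfolding fail_def good_def \<phi>_def
    by (intro add_left_mono mult_left_mono add_mono) auto
  also have "\<dots> = m * (\<mu> + e + B * \<phi> m)" by (simp add: algebra_simps)
  also have "\<dots> \<le> m * D"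
  proof (intro mult_left_mono)
    have "D = H + 4 * \<Delta>" by (simp add: \<Delta>_def field_simps)
    moreover have "\<mu> \<le> H + \<Delta>" using dH by (simp only: \<mu>_def)
    ultimately show "\<mu> + e + B * \<phi> m \<le> D" using m(1) e(2) \<Delta> by linarith
  qed simp
  finally have "block_scheme D m f g \<tau>"
    unfolding block_scheme_def block_cost[where g = g, OF lg] W_def using m(2) lf lg \<tau> by blast
  thus thesis by (rule that)
qed

end

section \<open>Block codes for the relay channel\<close>

lemma sum_words_concat:
  "(\<Sum>xs\<in>words A (k * m). G xs) = (\<Sum>bs\<in>words (words A m) k. G (concat bs))"
  by (induction k arbitrary: G) (simp_all add: sum_words_append sum_words_Suc)

lemma wt_concat: "wt w (concat bs) = wt (wt w) bs"
  by (induction bs) simp_all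

fun blocks :: "nat \<Rightarrow> nat \<Rightarrow> 'a list \<Rightarrow> 'a list list" where
  "blocks m 0 xs = []"
| "blocks m (Suc k) xs = take m xs # blocks m k (drop m xs)"

lemma length_blocks [simp]: "length (blocks m k xs) = k"
  by (induction k arbitrary: xs) simp_all

lemma blocks_concat:
  "length bs = k \<Longrightarrow> (\<And>b. b \<in> set bs \<Longrightarrow> length b = m) \<Longrightarrow> blocks m k (concat bs) = bs"
  by (induction bs arbitrary: k) auto

lemma blocks_take: "k * m \<le> n \<Longrightarrow> blocks m k (take n xs) = blocks m k xs"
proof (induction k arbitrary: n xs)
  case (Suc k)
  have "take m (take n xs) = take m xs" using Suc.prems by (simp add: min_def)
  moreover have "drop m (take n xs) = take (n - m) (drop m xs)" by (rule drop_take)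
  moreover have "k * m \<le> n - m" using Suc.prems by simp
  ultimately show ?case using Suc.IH by simp
qed simp

lemma length_concat_const:
  "(\<And>b. b \<in> set bs \<Longrightarrow> length b = m) \<Longrightarrow> length (concat bs) = length bs * m"
  by (induction bs) auto

text \<open>Matches the blockwise relay word with relay functions that emit one letter at a
  time.\<close>

lemma nth_concat_blocks:
  assumes f: "\<And>ys. length (f ys) = m"
  shows "i < k * m \<Longrightarrow> concat (map f (blocks m k ys)) ! i = f (take m (drop (i div m * m) ys)) ! (i mod m)"
proof (induction k arbitrary: i ys)
  case (Suc k)
  show ?case
  proof (cases "i < m")
    case True
    thus ?thesis by (simp add: nth_append f)
  next
    case False
    hence m: "0 < m" using Suc.prems by (cases m) auto
    have "i - m < k * m" using Suc.prems False by simp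
    from Suc.IH[OF this, of "drop m ys"]
    have "concat (map f (blocks m (Suc k) ys)) ! i = f (take m (drop ((i - m) div m * m + m) ys)) ! ((i - m) mod m)"
      using False by (simp add: nth_append f)
    moreover have "(i - m) div m * m + m = i div m * m" "(i - m) mod m = i mod m"
      using False m by (simp_all add: le_div_geq le_mod_geq not_less)
    ultimately show ?thesis by simp
  qed
qed simp

lemma bxor_append:
  "length xs = length ys \<Longrightarrow> bxor (xs @ xs') (ys @ ys') = bxor xs ys @ bxor xs' ys'"
  by (simp add: bxor_def)

lemma bxor_concat:
  "length as = length bs \<Longrightarrow> (\<And>a. a \<in> set as \<Longrightarrow> length a = m) \<Longrightarrow> (\<And>b. b \<in> set bs \<Longrightarrow> length b = m) \<Longrightarrow>
    bxor (concat as) (concat bs) = concat (map2 bxor as bs)"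
  by (induction as bs rule: list_induct2) (auto simp: bxor_append)

lemma take_bxor: "take n (bxor xs ys) = bxor (take n xs) (take n ys)"
  by (simp add: bxor_def take_map take_zip)

lemma drop_bxor: "drop n (bxor xs ys) = bxor (drop n xs) (drop n ys)"
  by (simp add: bxor_def drop_map drop_zip)

text \<open>The coordinates that \<open>G\<close> does not read sum to one. This discards the
  letters outside the coded window.\<close>

lemma sum_wt_ber_take:
  "(\<Sum>xs\<in>words UNIV (N + b). wt (ber q) xs * G (take N xs)) = (\<Sum>xs\<in>words UNIV N. wt (ber q) xs * G xs)"
  unfolding sum_words_append
proof (intro sum.cong refl)
  fix xs assume "xs \<in> words (UNIV :: bool set) N"
  hence "(\<Sum>ys\<in>words UNIV b. wt (ber q) (xs @ ys) * G (take N (xs @ ys)))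
    = wt (ber q) xs * G xs * (\<Sum>ys\<in>words UNIV b. wt (ber q) ys)"
    unfolding sum_distrib_left by (intro sum.cong refl) (simp add: length_words)
  thus "(\<Sum>ys\<in>words UNIV b. wt (ber q) (xs @ ys) * G (take N (xs @ ys))) = wt (ber q) xs * G xs" by simp
qed

lemma sum_wt_ber_drop:
  "(\<Sum>xs\<in>words UNIV (a + N). wt (ber q) xs * G (drop a xs)) = (\<Sum>xs\<in>words UNIV N. wt (ber q) xs * G xs)"
proof -
  have "(\<Sum>xs\<in>words UNIV (a + N). wt (ber q) xs * G (drop a xs))
    = (\<Sum>xs\<in>words UNIV a. wt (ber q) xs * (\<Sum>ys\<in>words UNIV N. wt (ber q) ys * G ys))"
    unfolding sum_words_append sum_distrib_left by (intro sum.cong refl) (simp add: length_words)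
  thus ?thesis by (simp flip: sum_distrib_right)
qed

context binary_relay
begin

section \<open>Counting noise words by their loss\<close>

lemma logloss_append:
  "length xs = length us \<Longrightarrow> logloss \<tau> (xs @ xs') (us @ us') = logloss \<tau> xs us + logloss \<tau> xs' us'"
  by (simp add: logloss_def)

lemma logloss_concat:
  "length as = length bs \<Longrightarrow> (\<And>a. a \<in> set as \<Longrightarrow> length a = m) \<Longrightarrow> (\<And>b. b \<in> set bs \<Longrightarrow> length b = m) \<Longrightarrow>
    logloss \<tau> (concat as) (concat bs) = sum_list (map2 (logloss \<tau>) as bs)"
  by (induction as bs rule: list_induct2) (auto simp: logloss_append logloss_def)

lemma sum_powr_logloss:
  assumes \<tau>: "\<And>u. 0 < \<tau> u" "\<And>u. \<tau> u < 1"
  shows "length us = N \<Longrightarrow> (\<Sum>zs\<in>words UNIV N. 2 powr (- logloss \<tau> zs us)) = 1"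
proof (induction us arbitrary: N)
  case Nil
  thus ?case by (simp add: logloss_def)
next
  case (Cons u us)
  then obtain N' where N: "N = Suc N'" "length us = N'" by auto
  have "0 < ber (\<tau> u) z" for z using \<tau> by (simp add: ber_def)
  hence "2 powr (- logloss \<tau> (z # zs) (u # us)) = ber (\<tau> u) z * 2 powr (- logloss \<tau> zs us)" for z zs
    by (simp add: logloss_def powr_diff powr_minus_divide powr_add)
  hence "(\<Sum>zs\<in>words UNIV N. 2 powr (- logloss \<tau> zs (u # us)))
    = (\<Sum>z\<in>UNIV. ber (\<tau> u) z * (\<Sum>zs\<in>words UNIV N'. 2 powr (- logloss \<tau> zs us)))"
    by (simp add: N(1) sum_words_Suc sum_distrib_left)
  thus ?case using Cons.IH[OF N(2)] by (simp flip: sum_distrib_right)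
qed

text \<open>A Kraft count: the losses are codelengths of a probability law on noise words. It holds
  for every \<open>us\<close>, however the destination arrived at it, and so bounds the size of the
  decoding test.\<close>

lemma card_small_logloss:
  assumes \<tau>: "\<And>u. 0 < \<tau> u" "\<And>u. \<tau> u < 1" and us: "length us = N"
  shows "real (card {zs\<in>words UNIV N. logloss \<tau> zs us \<le> \<theta>}) \<le> 2 powr \<theta>"
proof -
  let ?S = "{zs\<in>words UNIV N. logloss \<tau> zs us \<le> \<theta>}"
  have "real (card ?S) * 2 powr (- \<theta>) \<le> (\<Sum>zs\<in>?S. 2 powr (- logloss \<tau> zs us))"
    by (intro sum_bounded_below) auto
  also have "\<dots> \<le> (\<Sum>zs\<in>words UNIV N. 2 powr (- logloss \<tau> zs us))" by (intro sum_mono2) auto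
  also have "\<dots> = 1" by (rule sum_powr_logloss[OF \<tau> us])
  finally show ?thesis by (simp add: powr_minus divide_simps)
qed

end

lemma wt_map: "wt w (map h xs) = wt (\<lambda>x. w (h x)) xs"
  by (simp add: wt_def comp_def)

lemma wt_mult: "wt v xs * wt w xs = wt (\<lambda>x. v x * w x) xs"
  by (induction xs) simp_all

lemma sum_words_zip3:
  "(\<Sum>xs\<in>words A n. \<Sum>ys\<in>words B n. \<Sum>zs\<in>words C n. F xs ys zs)
    = (\<Sum>ws\<in>words (A \<times> (B \<times> C)) n. F (map fst ws) (map (fst \<circ> snd) ws) (map (snd \<circ> snd) ws))"
  by (simp add: sum_words_zip)

lemma sum_triple:
  "(\<Sum>x\<in>A \<times> (B \<times> C). F (fst x) (fst (snd x)) (snd (snd x))) = (\<Sum>a\<in>A. \<Sum>b\<in>B. \<Sum>c\<in>C. F a b c)"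
  by (simp add: sum.cartesian_product case_prod_beta')

context binary_relay
begin

definition relay_word :: "(bool list \<Rightarrow> bool list) \<Rightarrow> nat \<Rightarrow> nat \<Rightarrow> bool list \<Rightarrow> bool list" where
  "relay_word f m k ys = concat (map f (blocks m k ys))"

definition side_info :: "(bool list \<Rightarrow> nat list) \<Rightarrow> nat \<Rightarrow> nat \<Rightarrow> bool list \<Rightarrow> nat list" where
  "side_info g m k ss = concat (map g (blocks m k ss))"

text \<open>All maps act block by block, so the total loss is a sum of one contribution per triple
  of noise blocks; these are i.i.d., and Chebyshev applies.\<close>

lemma logloss_blocks:
  assumes f: "\<And>ys. length (f ys) = m" and g: "\<And>ss. length (g ss) = m"
    and xs: "xs \<in> words (words UNIV m \<times> (words UNIV m \<times> words UNIV m)) k"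
  defines "zb \<equiv> map fst xs" and "vb \<equiv> map (fst \<circ> snd) xs" and "nb \<equiv> map (snd \<circ> snd) xs"
  shows "logloss \<tau> (concat zb) (side_info g m k (bxor (relay_word f m k (bxor (concat zb) (concat vb))) (concat nb)))
    = sum_list (map (\<lambda>x. logloss \<tau> (fst x) (g (bxor (f (bxor (fst x) (fst (snd x)))) (snd (snd x))))) xs)"
proof -
  have len: "length xs = k" using xs by (simp add: words_def)
  have lz: "\<And>b. b \<in> set zb \<Longrightarrow> length b = m" and lv: "\<And>b. b \<in> set vb \<Longrightarrow> length b = m"
    and ln: "\<And>b. b \<in> set nb \<Longrightarrow> length b = m"
    using xs by (auto simp: words_def zb_def vb_def nb_def)
  define yb where "yb = map (\<lambda>x. bxor (fst x) (fst (snd x))) xs"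
  have "bxor (concat zb) (concat vb) = concat (map2 bxor zb vb)"
    using lz lv by (intro bxor_concat) (auto simp: zb_def vb_def)
  also have "map2 bxor zb vb = yb" by (simp add: zb_def vb_def yb_def map2_map_map)
  finally have y: "bxor (concat zb) (concat vb) = concat yb" .
  have ly: "length b = m" if "b \<in> set yb" for b
    using that xs by (auto simp: yb_def words_def)
  have "relay_word f m k (concat yb) = concat (map f yb)"
    unfolding relay_word_def using ly len by (subst blocks_concat) (auto simp: yb_def)
  moreover have "bxor (concat (map f yb)) (concat nb) = concat (map2 bxor (map f yb) nb)"
    using ln f by (intro bxor_concat) (auto simp: yb_def nb_def)
  moreover have "map2 bxor (map f yb) nb = map (\<lambda>x. bxor (f (bxor (fst x) (fst (snd x)))) (snd (snd x))) xs"
    by (simp add: yb_def nb_def map2_map_map)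
  ultimately have s: "bxor (relay_word f m k (concat yb)) (concat nb)
      = concat (map (\<lambda>x. bxor (f (bxor (fst x) (fst (snd x)))) (snd (snd x))) xs)" by simp
  define sb where "sb = map (\<lambda>x. bxor (f (bxor (fst x) (fst (snd x)))) (snd (snd x))) xs"
  have ls: "length b = m" if "b \<in> set sb" for b
    using that xs f by (auto simp: sb_def words_def)
  have "side_info g m k (concat sb) = concat (map g sb)"
    unfolding side_info_def using ls len by (subst blocks_concat) (auto simp: sb_def)
  moreover have "logloss \<tau> (concat zb) (concat (map g sb)) = sum_list (map2 (logloss \<tau>) zb (map g sb))"
    using lz g by (intro logloss_concat) (auto simp: zb_def sb_def)
  ultimately show ?thesis unfolding y s sb_def[symmetric]
    by (simp add: zb_def sb_def map2_map_map)
qed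

text \<open>The side information is a function of the noises only, so it acts as receiver state of
  an additive channel, independent of the message. The length makes room for k coded blocks, one
  block of relay delay and a remainder r.\<close>

lemma block_code:
  assumes sch: "block_scheme D m f g \<tau>" and e: "0 < e"
  shows "\<exists>V. \<forall>k r M. 0 < k \<longrightarrow> 0 < M \<longrightarrow> (\<exists>enc relay dec.
    error_prob p \<delta> eps (m * (k + 1) + r) M enc relay dec
      \<le> V / k + M * 2 powr (k * (m * (D + e))) / 2 ^ (k * m))"
proof -
  have m: "0 < m" and f: "\<And>ys. length (f ys) = m" and g: "\<And>ss. length (g ss) = m"
    and \<tau>: "\<And>u. 0 < \<tau> u" "\<And>u. \<tau> u < 1"
    using sch by (auto simp: block_scheme_def)
  define A where "A = words (UNIV :: bool set) m"
  define \<omega> where "\<omega> = (\<lambda>x. wt (ber p) (fst x) * wt (ber \<delta>) (fst (snd x)) * wt (ber eps) (snd (snd x)))"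
  define c where "c = (\<lambda>x. logloss \<tau> (fst x) (g (bxor (f (bxor (fst x) (fst (snd x)))) (snd (snd x)))))"
  define \<mu> where "\<mu> = (\<Sum>x\<in>A \<times> (A \<times> A). \<omega> x * c x)"
  have \<omega>0: "0 \<le> \<omega> x" for x unfolding \<omega>_def using p \<delta> eps by (simp add: wt_ber_nonneg)
  have prod_one: "(\<Sum>a\<in>B. \<Sum>b\<in>B. \<Sum>c\<in>B. wt (ber p) a * wt (ber \<delta>) b * wt (ber eps) c) = 1"
    if "B = words UNIV n" for B n
    by (simp add: that flip: sum_distrib_left sum_distrib_right)
  have \<omega>1: "(\<Sum>x\<in>A \<times> (A \<times> A). \<omega> x) = 1"
    using prod_one[OF A_def]
      sum_triple[of "\<lambda>a b c. wt (ber p) a * wt (ber \<delta>) b * wt (ber eps) c" A A A] by (simp add: \<omega>_def)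
  have \<mu>_le: "\<mu> \<le> m * D"
    using sch sum_triple[of "\<lambda>a b c. wt (ber p) a * wt (ber \<delta>) b * wt (ber eps) c *
        logloss \<tau> a (g (bxor (f (bxor a b)) c))" A A A]
    by (simp add: block_scheme_def \<mu>_def \<omega>_def c_def A_def)
  define V where "V = (\<Sum>x\<in>A \<times> (A \<times> A). \<omega> x * (c x - \<mu>)\<^sup>2) / (m * e)\<^sup>2"
  show ?thesis
  proof (rule exI[of _ V], intro allI impI)
    fix k r M :: nat assume k: "0 < k" and M: "0 < M"
    define N where "N = k * m"
    define n where "n = m * (k + 1) + r"
    \<comment> \<open>The codeword occupies the first \<open>N\<close> letters, the useful relay
      words the \<open>N\<close> letters from position m on; each split isolates one of these
      windows.\<close>
    have n1: "n = N + (m + r)" and n2: "n = m + (N + r)" by (simp_all add: n_def N_def)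
    define W where "W = words (UNIV :: bool set) N"
    define \<theta> where "\<theta> = k * (m * (D + e))"
    define U where "U = (\<lambda>zs vs ns. side_info g m k (bxor (relay_word f m k (bxor zs vs)) ns))"
    define T where "T = (\<lambda>zs us. logloss \<tau> zs us \<le> \<theta>)"
    have len_relay: "length (relay_word f m k ys) = N" for ys
      unfolding relay_word_def N_def using f by (subst length_concat_const[where m = m]) auto
    have len_side: "length (side_info g m k ss) = N" for ss
      unfolding side_info_def N_def using g by (subst length_concat_const[where m = m]) auto
    have bad: "(\<Sum>zs\<in>W. \<Sum>vs\<in>W. \<Sum>ns\<in>W. wt (ber p) zs * wt (ber \<delta>) vs * wt (ber eps) ns *
        of_bool (\<not> T zs (U zs vs ns))) \<le> V / k"
    proof -
      have "(\<Sum>zs\<in>W. \<Sum>vs\<in>W. \<Sum>ns\<in>W. wt (ber p) zs * wt (ber \<delta>) vs * wt (ber eps) ns *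
          of_bool (\<not> T zs (U zs vs ns)))
        = (\<Sum>xs\<in>words (A \<times> (A \<times> A)) k. wt (ber p) (concat (map fst xs)) * wt (ber \<delta>) (concat (map (fst \<circ> snd) xs))
            * wt (ber eps) (concat (map (snd \<circ> snd) xs)) *
            of_bool (\<not> T (concat (map fst xs)) (U (concat (map fst xs)) (concat (map (fst \<circ> snd) xs)) (concat (map (snd \<circ> snd) xs)))))"
        unfolding W_def N_def sum_words_concat A_def sum_words_zip3 ..
      also have "\<dots> = (\<Sum>xs\<in>words (A \<times> (A \<times> A)) k. wt \<omega> xs * of_bool (\<not> sum_list (map c xs) \<le> \<theta>))"
      proof (intro sum.cong refl arg_cong2[where f = "(*)"])
        fix xs assume xs: "xs \<in> words (A \<times> (A \<times> A)) k"
        show "wt (ber p) (concat (map fst xs)) * wt (ber \<delta>) (concat (map (fst \<circ> snd) xs))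
            * wt (ber eps) (concat (map (snd \<circ> snd) xs)) = wt \<omega> xs"
          by (simp add: wt_concat wt_map wt_mult \<omega>_def)
        show "of_bool (\<not> T (concat (map fst xs)) (U (concat (map fst xs)) (concat (map (fst \<circ> snd) xs)) (concat (map (snd \<circ> snd) xs))))
          = (of_bool (\<not> sum_list (map c xs) \<le> \<theta>) :: real)"
          unfolding T_def U_def logloss_blocks[OF f g xs[unfolded A_def]] c_def ..
      qed
      also have "\<dots> \<le> (\<Sum>xs\<in>words (A \<times> (A \<times> A)) k. wt \<omega> xs * of_bool (sum_list (map c xs) > k * (\<mu> + m * e)))"
      proof (intro sum_mono mult_left_mono)
        fix xs assume "xs \<in> words (A \<times> (A \<times> A)) k"
        thus "0 \<le> wt \<omega> xs" using wt_nonneg[of "A \<times> (A \<times> A)" \<omega> xs k] \<omega>0 by simp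
        have "k * (\<mu> + m * e) \<le> \<theta>" unfolding \<theta>_def using \<mu>_le
          by (intro mult_left_mono) (auto simp: distrib_left)
        thus "of_bool (\<not> sum_list (map c xs) \<le> \<theta>) \<le> (of_bool (sum_list (map c xs) > k * (\<mu> + m * e)) :: real)"
          by auto
      qed
      also have "\<dots> \<le> V / k"
        unfolding V_def using m e k by (intro chebyshev_words \<omega>0 \<omega>1 \<mu>_def) (auto simp: A_def)
      finally show ?thesis .
    qed
    define w where "w = (\<lambda>x. wt (ber p) (fst x) * wt (ber \<delta>) (fst (snd x)) * wt (ber eps) (snd (snd x)))"
    have w1: "(\<Sum>x\<in>W \<times> (W \<times> W). w x) = 1"
      using prod_one[OF W_def]
        sum_triple[of "\<lambda>a b c. wt (ber p) a * wt (ber \<delta>) b * wt (ber eps) c" W W W] by (simp add: w_def)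
    obtain x dec0 where x: "\<And>j. length (x j) = N"
      and code: "(\<Sum>j<M. 1 / M * (\<Sum>\<omega>\<in>W \<times> (W \<times> W). w \<omega> *
          of_bool (dec0 (bxor (x j) (fst \<omega>)) (U (fst \<omega>) (fst (snd \<omega>)) (snd (snd \<omega>))) \<noteq> j)))
        \<le> (\<Sum>\<omega>\<in>W \<times> (W \<times> W). w \<omega> * of_bool (\<not> T (fst \<omega>) (U (fst \<omega>) (fst (snd \<omega>)) (snd (snd \<omega>)))))
          + M * 2 powr \<theta> / 2 ^ N"
    proof (rule additive_channel_coding[where \<Omega> = "W \<times> (W \<times> W)" and w = w and z = fst
        and s = "\<lambda>\<omega>. U (fst \<omega>) (fst (snd \<omega>)) (snd (snd \<omega>))" and T = T and \<pi> = "\<lambda>_. 1 / real M"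
        and M = M and N = N and L = "2 powr \<theta>"])
      show "real (card {zs\<in>words UNIV N. T zs (U (fst \<omega>) (fst (snd \<omega>)) (snd (snd \<omega>)))}) \<le> 2 powr \<theta>" for \<omega>
        unfolding T_def U_def by (intro card_small_logloss \<tau> len_side)
    qed (use M w1 p \<delta> eps in \<open>auto simp: W_def w_def wt_ber_nonneg length_words\<close>)
    define enc where "enc = (\<lambda>j i. i < N \<and> x j ! i)"
    \<comment> \<open>Block \<open>j\<close> of \<open>Y\<^sub>1\<close> is forwarded during block \<open>j + 1\<close>, so the relay is causal; what it sends in
      block \<open>0\<close> is ignored by the decoder.\<close>
    define relay where "relay = (\<lambda>i ys. f (take m (drop ((i div m - 1) * m) ys)) ! (i mod m))"
    define dec where "dec = (\<lambda>ys ss. dec0 (take N ys) (side_info g m k (take N (drop m ss))))"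
    have enc_word: "take N (map (enc j) [0..<n]) = x j" for j
      by (rule nth_equalityI) (auto simp: x n1 enc_def)
    have relay_eq: "take N (drop m (map (\<lambda>i. relay i (take i ys)) [0..<n])) = relay_word f m k ys"
      if "length ys = n" for ys
    proof (rule nth_equalityI)
      fix i assume "i < length (take N (drop m (map (\<lambda>i. relay i (take i ys)) [0..<n])))"
      hence i: "i < N" by (simp add: n2)
      \<comment> \<open>At time \<open>m + i\<close> the observation block containing position i is
        complete, so cutting the observations at \<open>m + i\<close> leaves it intact.\<close>
      have "i div m * m \<le> i" by simp
      hence im: "m \<le> m + i - i div m * m" by linarith
      have "take m (drop (i div m * m) (take (m + i) ys)) = take m (drop (i div m * m) ys)"
        using im by (simp only: drop_take take_take min_absorb1)
      hence "relay (m + i) (take (m + i) ys) = f (take m (drop (i div m * m) ys)) ! (i mod m)"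
        using m by (simp add: relay_def div_add_self1)
      moreover have "relay_word f m k ys ! i = f (take m (drop (i div m * m) ys)) ! (i mod m)"
        unfolding relay_word_def using i unfolding N_def by (rule nth_concat_blocks[OF f])
      ultimately show "take N (drop m (map (\<lambda>i. relay i (take i ys)) [0..<n])) ! i = relay_word f m k ys ! i"
        using i by (simp add: n2)
    qed (simp add: len_relay n2)
    have relay_take: "relay_word f m k (bxor zs vs) = relay_word f m k (bxor (take N zs) (take N vs))" for zs vs
      unfolding relay_word_def N_def by (simp add: blocks_take flip: take_bxor)
    have "error_prob p \<delta> eps n M enc relay dec = (1 / real M) * (\<Sum>j<M.
      \<Sum>zs\<in>words UNIV n. \<Sum>vs\<in>words UNIV n. \<Sum>ns\<in>words UNIV n.
       wt (ber p) zs * wt (ber \<delta>) vs * wt (ber eps) ns *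
       of_bool (dec0 (bxor (x j) (take N zs)) (U (take N zs) (take N vs) (take N (drop m ns))) \<noteq> j))"
      unfolding error_prob_bxor
    proof (intro arg_cong2[where f = "(*)"] sum.cong refl arg_cong[where f = of_bool])
      fix j zs vs ns assume zv: "zs \<in> words (UNIV :: bool set) n" "vs \<in> words (UNIV :: bool set) n"
      define ys where "ys = bxor zs vs"
      have l: "length ys = n" using zv by (simp add: ys_def length_words)
      show "(dec (bxor (map (enc j) [0..<n]) zs) (bxor (map (\<lambda>i. relay i (take i (bxor zs vs))) [0..<n]) ns) \<noteq> j)
        = (dec0 (bxor (x j) (take N zs)) (U (take N zs) (take N vs) (take N (drop m ns))) \<noteq> j)"
        unfolding dec_def U_def relay_take[of zs vs, symmetric] unfolding ys_def[symmetric]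
        unfolding take_bxor drop_bxor enc_word relay_eq[OF l] ..
    qed
    also have "\<dots> = (1 / real M) * (\<Sum>j<M. \<Sum>zs\<in>W. \<Sum>vs\<in>W. \<Sum>ns\<in>W.
       wt (ber p) zs * wt (ber \<delta>) vs * wt (ber eps) ns *
       of_bool (dec0 (bxor (x j) zs) (U zs vs ns) \<noteq> j))"
    proof (rule arg_cong2[where f = "(*)", OF refl], rule sum.cong[OF refl])
      fix j
      define G where "G = (\<lambda>zs vs ns. of_bool (dec0 (bxor (x j) zs) (U zs vs ns) \<noteq> j) :: real)"
      have "(\<Sum>ns\<in>words UNIV n. wt (ber eps) ns * G z v (take N (drop m ns))) = (\<Sum>ns\<in>W. wt (ber eps) ns * G z v ns)" for z v
        unfolding n2 W_def sum_wt_ber_drop[of eps "\<lambda>ns. G z v (take N ns)" m] by (rule sum_wt_ber_take)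
      hence "(\<Sum>zs\<in>words UNIV n. \<Sum>vs\<in>words UNIV n. \<Sum>ns\<in>words UNIV n.
          wt (ber p) zs * wt (ber \<delta>) vs * wt (ber eps) ns * G (take N zs) (take N vs) (take N (drop m ns)))
        = (\<Sum>zs\<in>words UNIV n. wt (ber p) zs * (\<Sum>vs\<in>words UNIV n. wt (ber \<delta>) vs * (\<Sum>ns\<in>W. wt (ber eps) ns * G (take N zs) (take N vs) ns)))"
        by (simp only: mult.assoc sum_distrib_left[symmetric])
      also have "\<dots> = (\<Sum>zs\<in>W. wt (ber p) zs * (\<Sum>vs\<in>W. wt (ber \<delta>) vs * (\<Sum>ns\<in>W. wt (ber eps) ns * G zs vs ns)))"
        unfolding n1 W_def
          sum_wt_ber_take[of \<delta> "\<lambda>v. \<Sum>ns\<in>words UNIV N. wt (ber eps) ns * G z v ns" for z]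
          sum_wt_ber_take[of p "\<lambda>z. \<Sum>vs\<in>words UNIV N. wt (ber \<delta>) vs * (\<Sum>ns\<in>words UNIV N. wt (ber eps) ns * G z vs ns)"] ..
      also have "\<dots> = (\<Sum>zs\<in>W. \<Sum>vs\<in>W. \<Sum>ns\<in>W. wt (ber p) zs * wt (ber \<delta>) vs * wt (ber eps) ns * G zs vs ns)"
        by (simp only: mult.assoc sum_distrib_left)
      finally show "(\<Sum>zs\<in>words UNIV n. \<Sum>vs\<in>words UNIV n. \<Sum>ns\<in>words UNIV n.
          wt (ber p) zs * wt (ber \<delta>) vs * wt (ber eps) ns *
          of_bool (dec0 (bxor (x j) (take N zs)) (U (take N zs) (take N vs) (take N (drop m ns))) \<noteq> j))
        = (\<Sum>zs\<in>W. \<Sum>vs\<in>W. \<Sum>ns\<in>W. wt (ber p) zs * wt (ber \<delta>) vs * wt (ber eps) ns *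
          of_bool (dec0 (bxor (x j) zs) (U zs vs ns) \<noteq> j))"
        unfolding G_def .
    qed
    also have "\<dots> = (\<Sum>j<M. 1 / M * (\<Sum>\<omega>\<in>W \<times> (W \<times> W). w \<omega> *
          of_bool (dec0 (bxor (x j) (fst \<omega>)) (U (fst \<omega>) (fst (snd \<omega>)) (snd (snd \<omega>))) \<noteq> j)))"
      unfolding sum_distrib_left[of "1 / real M"] w_def
        sum_triple[of "\<lambda>a b c. wt (ber p) a * wt (ber \<delta>) b * wt (ber eps) c *
          of_bool (dec0 (bxor (x j) a) (U a b c) \<noteq> j)" W W W for j] ..
    also note code
    also have "(\<Sum>\<omega>\<in>W \<times> (W \<times> W). w \<omega> * of_bool (\<not> T (fst \<omega>) (U (fst \<omega>) (fst (snd \<omega>)) (snd (snd \<omega>))))) \<le> V / k"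
      unfolding w_def using bad
        sum_triple[of "\<lambda>a b c. wt (ber p) a * wt (ber \<delta>) b * wt (ber eps) c * of_bool (\<not> T a (U a b c))" W W W] by simp
    finally have "error_prob p \<delta> eps n M enc relay dec \<le> V / k + M * 2 powr \<theta> / 2 ^ N" by simp
    thus "\<exists>enc relay dec. error_prob p \<delta> eps (m * (k + 1) + r) M enc relay dec
      \<le> V / k + M * 2 powr (k * (m * (D + e))) / 2 ^ (k * m)"
      unfolding n_def N_def \<theta>_def by blast
  qed
qed

section \<open>Capacity\<close>

lemma error_prob_nonneg: "0 \<le> error_prob p \<delta> eps n M enc relay dec"
  unfolding error_prob_bxor using p \<delta> eps
  by (intro mult_nonneg_nonneg sum_nonneg) (auto simp: wt_ber_nonneg)

lemma achievable_of_block_scheme: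
  assumes sch: "block_scheme D m f g \<tau>" and R: "0 \<le> R" "R < 1 - D"
  shows "achievable p \<delta> eps R"
proof -
  have m: "0 < m" using sch by (simp add: block_scheme_def)
  \<comment> \<open>Half of the slack pays for the concentration of the loss; the other half remains
    as the exponent of decay.\<close>
  define e where "e = (1 - D - R) / 2"
  have e: "0 < e" using R by (simp add: e_def)
  obtain V where V: "\<And>k r M. 0 < k \<Longrightarrow> 0 < M \<Longrightarrow> \<exists>enc relay dec.
    error_prob p \<delta> eps (m * (k + 1) + r) M enc relay dec
      \<le> V / real k + real M * 2 powr (real k * (m * (D + e))) / 2 ^ (k * m)"
    using block_code[OF sch e] by blast
  define M where "M = (\<lambda>n. nat \<lceil>2 powr (real n * R)\<rceil>)"
  define k where "k = (\<lambda>n. n div m - 1)"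
  define bound where "bound = (\<lambda>k::nat. V / real k + 2 * 2 powr (2 * m * R) * 2 powr (- (k * (m * e))))"
  have "\<exists>enc relay dec. error_prob p \<delta> eps n (M n) enc relay dec \<le> bound (k n)" if n: "2 * m \<le> n" for n
  proof -
    have "2 \<le> n div m" using n m by (simp add: less_eq_div_iff_mult_less_eq)
    hence k0: "0 < k n" and kn: "k n + 1 = n div m" by (simp_all add: k_def)
    have n_eq: "m * (k n + 1) + n mod m = n" unfolding kn by simp
    \<comment> \<open>Delay and remainder waste fewer than \<open>2 * m\<close> letters, hence only
      a constant factor in the number of messages.\<close>
    have "n \<le> (k n + 2) * m"
      using n_eq mod_less_divisor[OF m, of n] by (simp add: algebra_simps)
    hence "real n \<le> real ((k n + 2) * m)" by (rule of_nat_mono)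
    hence nR: "real n * R \<le> (real (k n) + 2) * m * R" using R
      by (intro mult_right_mono) (simp_all add: algebra_simps)
    have one: "1 \<le> 2 powr (real n * R)" using R by (intro ge_one_powr_ge_zero) auto
    have M0: "0 < M n" unfolding M_def by simp
    have "real (M n) < 2 powr (real n * R) + 1"
      unfolding M_def using ceiling_correct[of "2 powr (real n * R)"] by simp
    hence "real (M n) \<le> 2 * 2 powr (real n * R)" using one by simp
    also have "\<dots> \<le> 2 * 2 powr ((real (k n) + 2) * m * R)" using nR by simp
    finally have M_le: "real (M n) \<le> 2 * 2 powr ((real (k n) + 2) * m * R)" .
    obtain enc relay dec where "error_prob p \<delta> eps (m * (k n + 1) + n mod m) (M n) enc relay dec
      \<le> V / real (k n) + real (M n) * 2 powr (real (k n) * (m * (D + e))) / 2 ^ (k n * m)"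
      using V[OF k0 M0] by blast
    also have "real (M n) * 2 powr (real (k n) * (m * (D + e))) / 2 ^ (k n * m)
      \<le> 2 * 2 powr ((real (k n) + 2) * m * R) * 2 powr (real (k n) * (m * (D + e))) / 2 powr real (k n * m)"
    proof -
      have "(2::real) ^ (k n * m) = 2 powr real (k n * m)" by (subst powr_realpow) auto
      thus ?thesis using M_le by (simp only:) (intro divide_right_mono mult_right_mono, auto)
    qed
    also have "\<dots> = 2 * 2 powr ((real (k n) + 2) * m * R + real (k n) * (m * (D + e)) - real (k n * m))"
      by (simp add: powr_add powr_diff)
    also have "(real (k n) + 2) * m * R + real (k n) * (m * (D + e)) - real (k n * m)
      = 2 * m * R + - (real (k n) * (m * e))"
      by (simp add: e_def field_simps)
    finally have "error_prob p \<delta> eps n (M n) enc relay dec \<le> bound (k n)"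
      by (simp only: n_eq bound_def powr_add mult.assoc)
    thus ?thesis by blast
  qed
  hence "\<exists>c. 2 * m \<le> n \<longrightarrow> error_prob p \<delta> eps n (M n) (fst c) (fst (snd c)) (snd (snd c)) \<le> bound (k n)" for n
    by (cases "2 * m \<le> n") auto
  then obtain c where c: "\<And>n. 2 * m \<le> n \<Longrightarrow>
      error_prob p \<delta> eps n (M n) (fst (c n)) (fst (snd (c n))) (snd (snd (c n))) \<le> bound (k n)"
    by metis
  have me: "0 < real m * e" using m e by simp
  have "(\<lambda>k::nat. V / real k + A * 2 powr (- (real k * d))) \<longlonglongrightarrow> 0" if "0 < d" for A d :: real
    using that by real_asymp
  hence "bound \<longlonglongrightarrow> 0" unfolding bound_def using me by blast
  moreover have "filterlim k at_top sequentially"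
    unfolding filterlim_at_top eventually_sequentially
  proof (intro allI exI impI)
    fix Z n assume "(Z + 1) * m \<le> n"
    hence "Z + 1 \<le> n div m" using m by (simp add: less_eq_div_iff_mult_less_eq)
    thus "Z \<le> k n" by (simp add: k_def)
  qed
  ultimately have lim: "(\<lambda>n. bound (k n)) \<longlonglongrightarrow> 0" by (rule filterlim_compose)
  have "(\<lambda>n. error_prob p \<delta> eps n (M n) (fst (c n)) (fst (snd (c n))) (snd (snd (c n)))) \<longlonglongrightarrow> 0"
  proof (rule tendsto_sandwich[OF _ _ tendsto_const lim])
    show "\<forall>\<^sub>F n in sequentially. error_prob p \<delta> eps n (M n) (fst (c n)) (fst (snd (c n))) (snd (snd (c n))) \<le> bound (k n)"
      using c by (auto simp: eventually_sequentially)
  qed (simp add: error_prob_nonneg)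
  thus ?thesis unfolding achievable_def M_def using R(1)
    by (intro conjI exI[of _ "\<lambda>n. fst (c n)"] exI[of _ "\<lambda>n. fst (snd (c n))"] exI[of _ "\<lambda>n. snd (snd (c n))"]) auto
qed

text \<open>A constant u requires no help from the relay. Its posterior for Y1 is the prior
  \<open>py1\<close>, and \<open>mix py1 = p\<close>, so the loss is H(Z) up to smoothing.\<close>

lemma uninformative_block_scheme:
  assumes "bent p < D"
  obtains m f g \<tau> where "block_scheme D m f g \<tau>"
proof -
  have rep: "repr 1 (\<lambda>_. 1) (\<lambda>_. py1)" using py1_bounds by (simp add: repr_def)
  have gap: "0 < D - bent p" using assms by simp
  obtain \<tau> where \<tau>: "\<And>u. 0 < \<tau> u" "\<And>u. \<tau> u < 1"
    and cost: "(\<Sum>x\<in>UNIV \<times> {..<1}. joint_yu (\<lambda>_. 1) (\<lambda>_. py1) x * mean_loss \<tau> x) \<le> D"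
  proof (rule smoothed_test_channel[OF rep gap], goal_cases)
    case (1 \<tau> B)
    show ?case by (rule 1(1)[OF 1(2,3)]) (use 1(6) in \<open>simp add: mix_py1\<close>)
  qed
  have "(\<Sum>y\<in>UNIV. ber py1 y * mean_loss \<tau> (y, 0)) \<le> D"
    using cost unfolding sum_joint_yu by simp
  moreover have "(\<Sum>ys\<in>words UNIV 1. wt (ber py1) ys * (\<Sum>ns\<in>words UNIV 1. wt (ber eps) ns *
      sum_list (map (mean_loss \<tau>) (zip ys [0])))) = (\<Sum>y\<in>UNIV. ber py1 y * mean_loss \<tau> (y, 0))"
    by (simp add: sum_words_Suc flip: sum_distrib_right)
  ultimately have "block_scheme D 1 (\<lambda>_. [False]) (\<lambda>_. [0]) \<tau>"
    unfolding block_scheme_def using \<tau>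
    by (subst block_cost) simp_all
  thus thesis by (rule that)
qed

text \<open>I(U;Z) is at most I(U;Y1): for each u and z the contributions of both letters y are
  merged by the log-sum inequality. This settles a link of capacity zero.\<close>

lemma data_processing:
  assumes rep: "repr k w t" and mean: "(\<Sum>u<k. w u * t u) = py1"
  shows "bent p - (\<Sum>u<k. w u * bent (mix (t u))) \<le> bent py1 - (\<Sum>u<k. w u * bent (t u))"
proof -
  define \<Phi> where "\<Phi> = (\<lambda>u. \<Sum>y\<in>UNIV. - ber (t u) y * log 2 (ber py1 y))"
  define \<Psi> where "\<Psi> = (\<lambda>u. \<Sum>z\<in>UNIV. - ber (mix (t u)) z * log 2 (ber p z))"
  have step: "w u * (bent (t u) - \<Phi> u) \<le> w u * (bent (mix (t u)) - \<Psi> u)" if u: "u < k" for u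
  proof (cases "w u = 0")
    case False
    have t: "0 \<le> t u" "t u \<le> 1" and w: "0 \<le> w u" using rep u by (auto simp: repr_def)
    have supp: "ber (t u) y = 0" if "ber py1 y = 0" for y
      using repr_support[OF rep mean u that] False by simp
    have t0: "0 \<le> ber (t u) y" and py0: "0 \<le> ber py1 y" and post0: "0 \<le> ber (post y) z" for y z
      using t py1_bounds post_bounds by (simp_all add: ber_nonneg)
    have z: "(\<Sum>y\<in>UNIV. ber (post y) z * (eta (ber (t u) y) + ber (t u) y * log 2 (ber py1 y)))
      \<le> eta (ber (mix (t u)) z) + ber (mix (t u)) z * log 2 (ber p z)" for z
    proof -
      let ?x = "\<lambda>y. ber (t u) y * ber (post y) z" and ?y = "\<lambda>y. ber py1 y * ber (post y) z"
      have "ent UNIV ?x \<le> (\<Sum>y\<in>UNIV. - ?x y * log 2 (?y y)) + (\<Sum>y\<in>UNIV. ?x y) * log 2 (\<Sum>y\<in>UNIV. ?y y)"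
        using t0 py0 post0 supp by (intro gibbs) auto
      hence 1: "(\<Sum>y\<in>UNIV. eta (?x y)) - (\<Sum>y\<in>UNIV. - ?x y * log 2 (?y y))
        \<le> eta (ber (mix (t u)) z) + ber (mix (t u)) z * log 2 (ber p z)"
        unfolding ent_def ber_mix[symmetric] mix_py1 by linarith
      have "ber (post y) z * (eta (ber (t u) y) + ber (t u) y * log 2 (ber py1 y))
        = eta (?x y) - (- ?x y * log 2 (?y y))" for y
      proof (cases "ber (t u) y = 0 \<or> ber (post y) z = 0")
        case False
        hence "0 < ber (t u) y" "0 < ber (post y) z" "0 < ber py1 y"
          using t0[of y] post0[of y z] py0[of y] supp[of y] by force+
        thus ?thesis by (simp add: eta_def log_mult algebra_simps)
      qed auto
      thus ?thesis using 1 by (simp only: sum_subtractf)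
    qed
    have "bent (t u) - \<Phi> u = (\<Sum>y\<in>UNIV. eta (ber (t u) y) + ber (t u) y * log 2 (ber py1 y))"
      by (simp add: \<Phi>_def sum.distrib sum_negf sum_eta_ber)
    also have "\<dots> = (\<Sum>y\<in>UNIV. \<Sum>z\<in>UNIV. ber (post y) z * (eta (ber (t u) y) + ber (t u) y * log 2 (ber py1 y)))"
      by (simp flip: sum_distrib_right)
    also have "\<dots> = (\<Sum>z\<in>UNIV. \<Sum>y\<in>UNIV. ber (post y) z * (eta (ber (t u) y) + ber (t u) y * log 2 (ber py1 y)))"
      by (rule sum.swap)
    also have "\<dots> \<le> (\<Sum>z\<in>UNIV. eta (ber (mix (t u)) z) + ber (mix (t u)) z * log 2 (ber p z))"
      by (intro sum_mono z)
    also have "\<dots> = bent (mix (t u)) - \<Psi> u"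
      by (simp add: \<Psi>_def sum.distrib sum_negf sum_eta_ber)
    finally show ?thesis using w by (intro mult_left_mono)
  qed simp
  have "(\<Sum>u<k. w u * \<Psi> u) = bent p"
  proof -
    have "(\<Sum>u<k. w u * ber (mix (t u)) z) = ber p z" for z
    proof -
      have "(\<Sum>u<k. w u * ber (mix (t u)) z) = (\<Sum>y\<in>UNIV. (\<Sum>u<k. w u * ber (t u) y) * ber (post y) z)"
        unfolding ber_mix sum_distrib_left sum_distrib_right by (subst sum.swap) (simp only: mult.assoc)
      also have "\<dots> = ber p z" unfolding mean_marginal[OF rep mean] ber_mix[symmetric] mix_py1 ..
      finally show ?thesis .
    qed
    moreover have "(\<Sum>u<k. w u * \<Psi> u) = (\<Sum>z\<in>UNIV. - (\<Sum>u<k. w u * ber (mix (t u)) z) * log 2 (ber p z))"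
      unfolding \<Psi>_def sum_distrib_left sum_distrib_right sum_negf[symmetric]
      by (subst sum.swap) (simp add: mult.assoc)
    ultimately show ?thesis by (simp add: eta_def flip: sum_eta_ber)
  qed
  moreover have "(\<Sum>u<k. w u * \<Phi> u) = bent py1" unfolding \<Phi>_def by (rule sum_repr_log[OF rep mean])
  moreover have "(\<Sum>u<k. w u * (bent (t u) - \<Phi> u)) \<le> (\<Sum>u<k. w u * (bent (mix (t u)) - \<Psi> u))"
    by (intro sum_mono step) simp
  ultimately show ?thesis by (simp add: right_diff_distrib sum_subtractf)
qed

lemma achievable_below_point:
  assumes v: "v \<in> convex hull curve" "fst v = py1" "bent py1 - R0 eps \<le> fst (snd v)"
    and R: "0 \<le> R" "R < 1 - snd (snd v)"
  shows "achievable p \<delta> eps R"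
proof (cases "R0 eps = 0")
  case True
  obtain k w t where rep: "repr k w t" and vb: "v = bary k w t" using hull_repr[OF v(1)] by blast
  have "(\<Sum>u<k. w u * t u) = py1" using v(2) by (simp add: vb bary_def)
  from data_processing[OF rep this] have "bent p \<le> snd (snd v)"
    using v(3) True by (simp add: vb bary_def)
  hence "bent p < (bent p + (1 - R)) / 2" and D: "R < 1 - (bent p + (1 - R)) / 2"
    using R by (simp_all add: field_simps)
  then obtain m f g \<tau> where "block_scheme ((bent p + (1 - R)) / 2) m f g \<tau>"
    using uninformative_block_scheme by blast
  thus ?thesis using achievable_of_block_scheme R(1) D by blast
next
  case False
  have R0: "0 < R0 eps" using False bent_le_1[OF eps] by (simp add: R0_eq[OF eps])
  define s where "s = 1 - R - snd (snd v)"
  define b where "b = bent p - snd (snd v)"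
  \<comment> \<open>Small enough that the objective moves by less than the slack \<open>s\<close>;
    the \<open>+ 1\<close> covers the case b = 0.\<close>
  define l where "l = min 1 (s / (2 * (\<bar>b\<bar> + 1)))"
  have s: "0 < s" using R by (simp add: s_def)
  have l: "0 < l" "l \<le> 1" using s by (auto simp: l_def)
  have "l * (\<bar>b\<bar> + 1) \<le> s / (2 * (\<bar>b\<bar> + 1)) * (\<bar>b\<bar> + 1)"
    by (intro mult_right_mono) (auto simp: l_def)
  also have "\<dots> = s / 2" by (simp add: field_simps)
  finally have "l * \<bar>b\<bar> < s" using s l by (simp add: distrib_left)
  moreover have "l * b \<le> l * \<bar>b\<bar>" using l by (intro mult_left_mono) auto
  ultimately have lb: "l * b < s" by linarith
  \<comment> \<open>Moving towards the constant test channel brings the information down to at most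
    \<open>(1 - l) * R0 eps\<close>, strictly below capacity.\<close>
  define v' where "v' = (1 - l) *\<^sub>R v + l *\<^sub>R (py1, bent py1, bent (mix py1))"
  have "(py1, bent py1, bent (mix py1)) \<in> convex hull curve"
    using py1_bounds by (intro hull_inc) (auto simp: curve_def)
  hence "v' \<in> convex hull curve" unfolding v'_def
    using v(1) l by (intro convexD[OF convex_convex_hull]) auto
  then obtain k w t where rep: "repr k w t" and vb: "v' = bary k w t" using hull_repr by blast
  have mean: "(\<Sum>u<k. w u * t u) = py1"
  proof -
    have "fst v' = py1" by (simp add: v'_def v(2) algebra_simps)
    thus ?thesis by (simp add: vb bary_def)
  qed
  have info: "bent py1 - (\<Sum>u<k. w u * bent (t u)) < 1 - bent eps"
  proof -
    have "(1 - l) * (bent py1 - R0 eps) \<le> (1 - l) * fst (snd v)"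
      using v(3) l by (intro mult_left_mono) auto
    hence "bent py1 - (1 - l) * R0 eps \<le> fst (snd v')" by (simp add: v'_def algebra_simps)
    moreover have "(1 - l) * R0 eps < 1 * R0 eps" using l R0 by (intro mult_strict_right_mono) auto
    ultimately have "bent py1 - fst (snd v') < R0 eps" by linarith
    thus ?thesis by (simp add: vb bary_def R0_eq[OF eps])
  qed
  define H where "H = (\<Sum>u<k. w u * bent (mix (t u)))"
  have "H = snd (snd v) + l * b"
  proof -
    have "snd (snd v') = snd (snd v) + l * b" by (simp add: v'_def b_def mix_py1 algebra_simps)
    thus ?thesis by (simp add: vb bary_def H_def)
  qed
  hence "H < 1 - R" using lb by (simp add: s_def)
  hence D: "H < (H + (1 - R)) / 2" "R < 1 - (H + (1 - R)) / 2" by (simp_all add: field_simps)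
  obtain m f g \<tau> where "block_scheme ((H + (1 - R)) / 2) m f g \<tau>"
    using block_scheme_exists[OF rep mean info] D(1) unfolding H_def by blast
  thus ?thesis using achievable_of_block_scheme R(1) D(2) by blast
qed

text \<open>A single message is always decoded. This keeps the supremum at 0 or above when no
  positive rate is achievable.\<close>

lemma achievable_0: "achievable p \<delta> eps 0"
proof -
  have "error_prob p \<delta> eps n (nat \<lceil>2 powr (real n * 0)\<rceil>) enc relay (\<lambda>_ _. 0) = 0" for n enc relay
    unfolding error_prob_bxor by simp
  thus ?thesis unfolding achievable_def
    by (intro conjI exI[of _ "\<lambda>_ _ _. False"] exI[of _ "\<lambda>_ _ _. False"] exI[of _ "\<lambda>_ _ _. 0"]) simp_all
qed

text \<open>Each length supplies its own point of the hull. A bound common to all admissible points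
  survives the limit, where the error probability and the term \<open>1 / n\<close> vanish.\<close>

lemma achievable_le:
  assumes ach: "achievable p \<delta> eps R"
    and C: "\<And>v. v \<in> convex hull curve \<Longrightarrow> fst v = py1 \<Longrightarrow> bent py1 - R0 eps \<le> fst (snd v) \<Longrightarrow> 1 - snd (snd v) \<le> C"
  shows "R \<le> C"
proof -
  obtain enc relay dec where R: "0 \<le> R"
    and lim: "(\<lambda>n. error_prob p \<delta> eps n (nat \<lceil>2 powr (real n * R)\<rceil>) (enc n) (relay n) (dec n)) \<longlonglongrightarrow> 0"
    using ach unfolding achievable_def by blast
  define M where "M = (\<lambda>n. nat \<lceil>2 powr (real n * R)\<rceil>)"
  define P where "P = (\<lambda>n. error_prob p \<delta> eps n (M n) (enc n) (relay n) (dec n))"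
  have P: "P \<longlonglongrightarrow> 0" using lim by (simp add: P_def M_def)
  have bound: "(1 - P n) * R \<le> C + 1 / n" if n: "0 < n" and Pn: "P n < 1" for n
  proof -
    have M0: "0 < M n" unfolding M_def by simp
    obtain v :: "real \<times> real \<times> real" where v: "v \<in> convex hull curve" "fst v = py1" "bent py1 - R0 eps \<le> fst (snd v)"
      "(1 - P n) * log 2 (M n) \<le> n * (1 - snd (snd v)) + 1"
      unfolding P_def by (rule converse_bound[OF n M0])
    have "2 powr (real n * R) \<le> M n" unfolding M_def by (simp add: real_nat_ceiling_ge)
    hence "n * R \<le> log 2 (M n)" using M0 by (simp add: le_log_iff)
    hence "(1 - P n) * (n * R) \<le> (1 - P n) * log 2 (M n)" using Pn by (intro mult_left_mono) auto
    also note v(4)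
    also have "n * (1 - snd (snd v)) + 1 \<le> n * C + 1"
      using C[OF v(1-3)] by (intro add_right_mono mult_left_mono) auto
    finally have "n * ((1 - P n) * R) \<le> n * (C + 1 / n)" using n by (simp add: algebra_simps)
    thus ?thesis using n by simp
  qed
  have "(\<lambda>n. (1 - P n) * R) \<longlonglongrightarrow> (1 - 0) * R" by (intro tendsto_intros P)
  moreover have "(\<lambda>n. C + 1 / real n) \<longlonglongrightarrow> C + 0" by (intro tendsto_intros lim_1_over_n)
  moreover have "\<forall>\<^sub>F n in sequentially. (1 - P n) * R \<le> C + 1 / real n"
    using order_tendstoD(2)[OF P zero_less_one] eventually_gt_at_top[of 0]
    by eventually_elim (rule bound)
  ultimately have "(1 - 0) * R \<le> C + 0" by (intro tendsto_le[OF sequentially_bot])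
  thus ?thesis by simp
qed

end

theorem theorem1:
  fixes p \<delta> eps :: real
  assumes "0 \<le> p" "p \<le> 1" "0 \<le> \<delta>" "\<delta> \<le> 1" "0 \<le> eps" "eps \<le> 1"
  shows "\<exists>k q. feasible p \<delta> eps k q \<and> k \<le> 4
           \<and> (\<forall>k' q'. feasible p \<delta> eps k' q' \<longrightarrow> objective p \<delta> k' q' \<le> objective p \<delta> k q)
           \<and> relay_capacity p \<delta> eps = ereal (objective p \<delta> k q)"
proof -
  interpret binary_relay p \<delta> eps using assms by unfold_locales
  define S where "S = convex hull curve \<inter> ({v. fst v = py1} \<inter> {v. bent py1 - R0 eps \<le> fst (snd v)})"
  have "closed ({v :: real \<times> real \<times> real. fst v = py1} \<inter> {v. bent py1 - R0 eps \<le> fst (snd v)})"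
    by (intro closed_Int closed_Collect_eq closed_Collect_le continuous_intros)
  hence "compact S" unfolding S_def by (intro compact_Int_closed compact_convex_hull compact_curve)
  \<comment> \<open>The constant test channel is feasible because \<open>R0 eps\<close> is
    nonnegative.\<close>
  moreover have "(py1, bent py1, bent (mix py1)) \<in> S"
    using py1_bounds bent_le_1[OF eps]
    by (auto simp: S_def R0_eq[OF eps] curve_def intro!: hull_inc)
  hence "S \<noteq> {}" by blast
  ultimately have "\<exists>v\<in>S. \<forall>v'\<in>S. snd (snd v) \<le> snd (snd v')"
    by (intro continuous_attains_inf continuous_intros)
  then obtain v where v: "v \<in> S" and min: "\<And>v'. v' \<in> S \<Longrightarrow> snd (snd v) \<le> snd (snd v')" by blast
  have vS: "v \<in> convex hull curve" "fst v = py1" "bent py1 - R0 eps \<le> fst (snd v)"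
    using v by (auto simp: S_def)
  obtain k w t where rep: "repr k w t" and k4: "k \<le> 4" and vb: "v = bary k w t"
    using hull_repr[OF vS(1)] by blast
  have mean: "(\<Sum>u<k. w u * t u) = py1" using vS(2) by (simp add: vb bary_def)
  obtain q where q: "\<And>y u. 0 \<le> q y u" "\<And>y. (\<Sum>u<k. q y u) = 1"
    "\<And>y u. u < k \<Longrightarrow> ber py1 y * q y u = w u * ber (t u) y"
    using point_test_channel[OF rep mean] by blast
  have vals: "mutinf (\<lambda>y1 u. \<Sum>z\<in>UNIV. jointZYU p \<delta> q z y1 u) UNIV {..<k}
      = bent py1 - (\<Sum>u<k. w u * bent (t u))"
    "objective p \<delta> k q = 1 - (\<Sum>u<k. w u * bent (mix (t u)))"
    by (rule test_channel_values[OF rep q(2)], erule q(3))+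
  have obj: "objective p \<delta> k q = 1 - snd (snd v)" using vals(2) by (simp add: vb bary_def)
  have feas: "feasible p \<delta> eps k q"
  proof -
    have "mutinf (\<lambda>y1 u. \<Sum>z\<in>UNIV. jointZYU p \<delta> q z y1 u) UNIV {..<k} \<le> R0 eps"
      unfolding vals(1) using vS(3) by (simp add: vb bary_def)
    thus ?thesis unfolding feasible_def using rep q(1,2) by (simp add: repr_def)
  qed
  have opt: "objective p \<delta> k' q' \<le> objective p \<delta> k q" if "feasible p \<delta> eps k' q'" for k' q'
  proof -
    from that have f: "0 < k'" "\<And>y u. 0 \<le> q' y u" "\<And>y. (\<Sum>u<k'. q' y u) = 1"
      "mutinf (\<lambda>y1 u. \<Sum>z\<in>UNIV. jointZYU p \<delta> q' z y1 u) UNIV {..<k'} \<le> R0 eps"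
      by (auto simp: feasible_def)
    obtain v' :: "real \<times> real \<times> real" where v': "v' \<in> convex hull curve" "fst v' = py1"
      "mutinf (\<lambda>y1 u. \<Sum>z\<in>UNIV. jointZYU p \<delta> q' z y1 u) UNIV {..<k'} = bent py1 - fst (snd v')"
      "objective p \<delta> k' q' = 1 - snd (snd v')"
      by (rule feasible_point[OF f(1-3)])
    have "v' \<in> S" using v'(1-3) f(4) by (simp add: S_def)
    thus ?thesis using min by (simp add: v'(4) obj)
  qed
  define C where "C = 1 - snd (snd v)"
  have "relay_capacity p \<delta> eps = ereal C"
    unfolding relay_capacity_def
  proof (rule antisym)
    show "Sup (ereal ` {R. achievable p \<delta> eps R}) \<le> ereal C"
    proof (rule Sup_least)
      fix x assume "x \<in> ereal ` {R. achievable p \<delta> eps R}"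
      then obtain R where R: "x = ereal R" "achievable p \<delta> eps R" by auto
      have "R \<le> C" by (rule achievable_le[OF R(2)]) (use min in \<open>auto simp: S_def C_def\<close>)
      thus "x \<le> ereal C" by (simp add: R(1))
    qed
    \<comment> \<open>Achievable rates are nonnegative by definition, so approximation from below is
      used for positive C only, with negative targets raised to 0.\<close>
    show "ereal C \<le> Sup (ereal ` {R. achievable p \<delta> eps R})"
    proof (cases "C \<le> 0")
      case True
      hence "ereal C \<le> ereal 0" by simp
      also have "\<dots> \<le> Sup (ereal ` {R. achievable p \<delta> eps R})" by (rule Sup_upper) (use achievable_0 in auto)
      finally show ?thesis .
    next
      case False
      show ?thesis
      proof (rule dense_le)
        fix y assume y: "y < ereal C"
        show "y \<le> Sup (ereal ` {R. achievable p \<delta> eps R})"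
        proof (cases y)
          case (real r)
          have "achievable p \<delta> eps (max r 0)"
            by (rule achievable_below_point[OF vS]) (use y real False in \<open>auto simp: C_def\<close>)
          hence "ereal (max r 0) \<le> Sup (ereal ` {R. achievable p \<delta> eps R})" 
            by (intro Sup_upper imageI) simp
          moreover have "y \<le> ereal (max r 0)" using real by simp
          ultimately show ?thesis by (rule order_trans[rotated])
        qed (use y in auto)
      qed
    qed
  qed
  thus ?thesis using feas k4 opt obj unfolding C_def by metis
qed

end
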